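(* Let $K$ be a commutative ring with unit that is both a $\mathbb{Q}$-ring (contains $\mathbb{Q}$ as a subring) and an integral domain, let $\chi=(\chi_d\colon W_d\to U(K))_{d\ge1}$ be an $\omega$-invariant sequence of characters, and let $E$ be a $K$-module with finite basis. (i) $\iota=\coprod_{d\ge0}\iota^{(d)}\colon[\chi](-^* )\to([\chi](-))^{*gr}$ is an isomorphism of functors on the category of $K$-modules with finite bases. (ii) After the identification via $\iota$, the restriction of the canonical bilinear form of the $K$-module $[\chi](E)$ to $[\chi](E)\times[\chi](E^* )$ is given by $$\langle x_1\chi\ldots\chi x_r,\ x_1^*\chi\ldots\chi x_s^*\rangle=\begin{cases}0&\text{if }r\ne s,\\ d_\chi\big((\langle x_i,x_j^*\rangle)_{i,j=1}^r\big)&\text{if }r=s\ge1,\\ 1&\text{if }r=s=0\end{cases}$$ (in the case $r=s=0$ both empty products are the unit $1$). (iii) For any $k\ge2$ the restriction of the canonical bilinear form of the $K$-module $([\chi](E))^{\otimes k}$ to $([\chi](E))^{\otimes k}\times([\chi](E^* ))^{\otimes k}$ is given as follows: for decomposable $\chi$-vectors $z_i=x_{i,1}\chi\ldots\chi x_{i,r_i}\in[\chi]^{r_i}(E)$ and decomposable $\chi$-forms $z_i^*=x_{i,1}^*\chi\ldots\chi x_{i,s_i}^*\in[\chi]^{s_i}(E^* )$, $1\le i\le k$, $$\langle z_1\otimes\cdots\otimes z_k,\ z_1^*\otimes\cdots\otimes z_k^*\rangle=\begin{cases}0&\text{if }(r_1,\ldots,r_k)\ne(s_1,\ldots,s_k),\\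 \langle z_1,z_1^*\rangle\langle z_2,z_2^*\rangle\cdots\langle z_k,z_k^*\rangle&\text{if }(r_1,\ldots,r_k)=(s_1,\ldots,s_k).\end{cases}$$
   Context: $S_\infty$ is the group of permutations of the positive integers fixing all but finitely many elements, $S_d\le S_\infty$ the subgroup fixing all $t>d$, and $\omega\colon S_\infty\to S_\infty$ the injective endomorphism $(\omega(\sigma))(1)=1$, $(\omega(\sigma))(t)=\sigma(t-1)+1$ for $t\ge2$. A sequence of group homomorphisms $\chi=(\chi_d\colon W_d\to U(K))_{d\ge1}$ ($U(K)$ the group of units of $K$) is $\omega$-invariant if $W_d\le S_d$, $W_d\le W_{d+1}$, $\omega(W_d)\le W_{d+1}$, and $\chi_{d+1}|_{W_d}=\chi_d=\chi_{d+1}\circ\omega|_{W_d}$ for all $d\ge1$. It is known that then $\chi_d=\chi_d^{-1}$ for all $d$. $S_d$ acts on $T^d(E)$ by $\sigma(x_1\otimes\cdots\otimes x_d)=x_{\sigma^{-1}(1)}\otimes\cdots\otimes x_{\sigma^{-1}(d)}$. $[\chi]^d(E)$ is the quotient of $T^d(E)$ by the submodule generated by all $\chi_d(\sigma)^{-1}z-\sigma z$, $\sigma\in W_d$, $z\in T^d(E)$; $[\chi]^0(E)=K$; the image of $x_1\otimes\cdots\otimes x_d$ is $x_1\chi\ldots\chi x_d$ (a decomposable $\chi$-vector). $[\chi](E)=\coprod_{d\ge0}[\chi]^d(E)$ is the semi-symmetric algebra of weight $\chi$; it is functorial in $E$ via $x_1\chi\ldots\chi x_d\mapsto u(x_1)\chi\ldots\chi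 u(x_d)$. Elements of $[\chi](E^* )$ are called $\chi$-forms. For an $r\times r$ matrix $A=(a_{ij})$, $d_\chi(A)=\sum_{\sigma\in W_r}\chi_r(\sigma)a_{\sigma^{-1}(1)1}\cdots a_{\sigma^{-1}(r)r}$. For $d\ge1$, $\iota^{(d)}_E\colon[\chi]^d(E^* )\to([\chi]^d(E))^*$ is the $K$-linear map given by $\iota^{(d)}_E(x_1^*\chi\ldots\chi x_d^* )(x_1\chi\ldots\chi x_d)=d_\chi((\langle x_i,x_j^*\rangle)_{i,j=1}^d)$, where $\langle x,x^*\rangle=x^*(x)$; $\iota^{(0)}\colon K\to K^*$ is $k^*\mapsto(k\mapsto kk^* )$. $M^*$ is the dual of a $K$-module $M$, and its canonical bilinear form is $M\times M^*\to K$, $\langle x,f\rangle=f(x)$. The dual graded module is $([\chi](E))^{*gr}=\coprod_{d\ge0}([\chi]^d(E))^*\subset([\chi](E))^*$, a linear form on $[\chi]^d(E)$ being identified with its extension by $0$ to $[\chi](E)$. In (iii), $([\chi](E^* ))^{\otimes k}$, identified with $(([\chi](E))^{*gr})^{\otimes k}$, is regarded as a submodule of $(([\chi](E))^{\otimes k})^*$ in the canonical way (a tensor product of linear forms acts as the product of their values). *)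

theory Defs
  imports "HOL-Algebra.Algebra"
begin

section \<open>Ground rings\<close>

definition rat_ring :: "rat ring" where
  "rat_ring = \<lparr>carrier = UNIV, monoid.mult = (*), one = 1, ring.zero = 0, add = (+)\<rparr>"

definition Q_ring :: "('k, 'r) ring_scheme \<Rightarrow> bool" where
  "Q_ring K \<longleftrightarrow> (\<exists>h \<in> ring_hom rat_ring K. inj h)"


section \<open>Modules and linear maps\<close>

text \<open>
  The ring-multiplication fields of the module records built here play no role and are left
  undefined. Linear maps are extensional on the carrier, so that equality of linear maps is
  equality in HOL.
\<close>

definition lin_maps ::
  "('k, 'r) ring_scheme \<Rightarrow> ('k, 'a, 'm) module_scheme \<Rightarrow> ('k, 'b, 'n) module_scheme
    \<Rightarrow> ('a \<Rightarrow> 'b) set" where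
  "lin_maps K M N = {f \<in> carrier M \<rightarrow>\<^sub>E carrier N.
     (\<forall>x\<in>carrier M. \<forall>y\<in>carrier M. f (x \<oplus>\<^bsub>M\<^esub> y) = f x \<oplus>\<^bsub>N\<^esub> f y) \<and>
     (\<forall>a\<in>carrier K. \<forall>x\<in>carrier M. f (a \<odot>\<^bsub>M\<^esub> x) = a \<odot>\<^bsub>N\<^esub> f x)}"

definition lin_isos ::
  "('k, 'r) ring_scheme \<Rightarrow> ('k, 'a, 'm) module_scheme \<Rightarrow> ('k, 'b, 'n) module_scheme
    \<Rightarrow> ('a \<Rightarrow> 'b) set" where
  "lin_isos K M N = {f \<in> lin_maps K M N. bij_betw f (carrier M) (carrier N)}"

text \<open>
  The linear map \<open>M \<rightarrow> N\<close> sending \<open>g a\<close> to \<open>h a\<close> for all \<open>a \<in> A\<close>. Below, \<open>g ` A\<close> always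
  generates \<open>M\<close>, so there is at most one such map.
\<close>

definition lin_ext ::
  "('k, 'r) ring_scheme \<Rightarrow> ('k, 'a, 'm) module_scheme \<Rightarrow> ('k, 'b, 'n) module_scheme
    \<Rightarrow> 'i set \<Rightarrow> ('i \<Rightarrow> 'a) \<Rightarrow> ('i \<Rightarrow> 'b) \<Rightarrow> 'a \<Rightarrow> 'b" where
  "lin_ext K M N A g h = (THE f. f \<in> lin_maps K M N \<and> (\<forall>a\<in>A. f (g a) = h a))"

definition has_finite_basis ::
  "('k, 'r) ring_scheme \<Rightarrow> ('k, 'a, 'm) module_scheme \<Rightarrow> bool" where
  "has_finite_basis K M \<longleftrightarrow> (\<exists>B. finite B \<and> B \<subseteq> carrier M \<and>
     (\<forall>x\<in>carrier M. \<exists>!c. c \<in> B \<rightarrow>\<^sub>E carrier K \<and> x = (\<Oplus>\<^bsub>M\<^esub>b\<in>B. c b \<odot>\<^bsub>M\<^esub> b)))"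

definition ring_module :: "('k, 'r) ring_scheme \<Rightarrow> ('k, 'k) module" where
  "ring_module K = \<lparr>carrier = carrier K, monoid.mult = undefined, one = undefined,
     ring.zero = \<zero>\<^bsub>K\<^esub>, add = (\<oplus>\<^bsub>K\<^esub>), smult = (\<otimes>\<^bsub>K\<^esub>)\<rparr>"

definition gen_submodule ::
  "('k, 'r) ring_scheme \<Rightarrow> ('k, 'a, 'm) module_scheme \<Rightarrow> 'a set \<Rightarrow> 'a set" where
  "gen_submodule K M S = \<Inter>{N. submodule N K M \<and> S \<subseteq> N}"

definition quot_module ::
  "('k, 'a, 'm) module_scheme \<Rightarrow> 'a set \<Rightarrow> ('k, 'a set) module" where
  "quot_module M N = \<lparr>carrier = a_rcosets\<^bsub>M\<^esub> N, monoid.mult = undefined, one = undefined,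
     ring.zero = N, add = set_add M, smult = (\<lambda>a C. \<Union>x\<in>C. N +>\<^bsub>M\<^esub> (a \<odot>\<^bsub>M\<^esub> x))\<rparr>"


subsection \<open>Duals\<close>

definition dual ::
  "('k, 'r) ring_scheme \<Rightarrow> ('k, 'a, 'm) module_scheme \<Rightarrow> ('k, 'a \<Rightarrow> 'k) module" where
  "dual K M = \<lparr>carrier = lin_maps K M (ring_module K), monoid.mult = undefined, one = undefined,
     ring.zero = (\<lambda>x\<in>carrier M. \<zero>\<^bsub>K\<^esub>),
     add = (\<lambda>f g. \<lambda>x\<in>carrier M. f x \<oplus>\<^bsub>K\<^esub> g x),
     smult = (\<lambda>a f. \<lambda>x\<in>carrier M. a \<otimes>\<^bsub>K\<^esub> f x)\<rparr>"

definition transpose_map ::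
  "('k, 'r) ring_scheme \<Rightarrow> ('k, 'a, 'm) module_scheme \<Rightarrow> ('k, 'b, 'n) module_scheme
    \<Rightarrow> ('a \<Rightarrow> 'b) \<Rightarrow> ('b \<Rightarrow> 'k) \<Rightarrow> ('a \<Rightarrow> 'k)" where
  "transpose_map K M N u = (\<lambda>f\<in>carrier (dual K N). \<lambda>x\<in>carrier M. f (u x))"

definition canon_form :: "'a \<Rightarrow> ('a \<Rightarrow> 'k) \<Rightarrow> 'k" where
  "canon_form x f = f x"


subsection \<open>Direct sums\<close>

definition dsum ::
  "'i set \<Rightarrow> ('i \<Rightarrow> ('k, 'a, 'm) module_scheme) \<Rightarrow> ('k, 'i \<Rightarrow> 'a) module" where
  "dsum I M = \<lparr>carrier = {f \<in> \<Pi>\<^sub>E i\<in>I. carrier (M i). finite {i\<in>I. f i \<noteq> \<zero>\<^bsub>M i\<^esub>}},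
     monoid.mult = undefined, one = undefined,
     ring.zero = (\<lambda>i\<in>I. \<zero>\<^bsub>M i\<^esub>),
     add = (\<lambda>f g. \<lambda>i\<in>I. f i \<oplus>\<^bsub>M i\<^esub> g i),
     smult = (\<lambda>a f. \<lambda>i\<in>I. a \<odot>\<^bsub>M i\<^esub> f i)\<rparr>"

definition dsum_inj ::
  "'i set \<Rightarrow> ('i \<Rightarrow> ('k, 'a, 'm) module_scheme) \<Rightarrow> 'i \<Rightarrow> 'a \<Rightarrow> ('i \<Rightarrow> 'a)" where
  "dsum_inj I M i x = (\<lambda>j\<in>I. if j = i then x else \<zero>\<^bsub>M j\<^esub>)"

definition dsum_map ::
  "'i set \<Rightarrow> ('i \<Rightarrow> ('k, 'a, 'm) module_scheme) \<Rightarrow> ('i \<Rightarrow> 'a \<Rightarrow> 'b)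
    \<Rightarrow> ('i \<Rightarrow> 'a) \<Rightarrow> ('i \<Rightarrow> 'b)" where
  "dsum_map I M h = (\<lambda>z\<in>carrier (dsum I M). \<lambda>i\<in>I. h i (z i))"

definition free_module :: "('k, 'r) ring_scheme \<Rightarrow> 'x set \<Rightarrow> ('k, 'x \<Rightarrow> 'k) module" where
  "free_module K S = dsum S (\<lambda>_. ring_module K)"

definition free_gen :: "('k, 'r) ring_scheme \<Rightarrow> 'x set \<Rightarrow> 'x \<Rightarrow> ('x \<Rightarrow> 'k)" where
  "free_gen K S x = dsum_inj S (\<lambda>_. ring_module K) x \<one>\<^bsub>K\<^esub>"

definition gr_dual ::
  "('k, 'r) ring_scheme \<Rightarrow> ('i \<Rightarrow> ('k, 'a, 'm) module_scheme) \<Rightarrow> ('k, 'i \<Rightarrow> 'a \<Rightarrow> 'k) module"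
  where
  "gr_dual K M = dsum UNIV (\<lambda>d. dual K (M d))"

text \<open>
  The inclusion of the graded dual into the dual of the direct sum: each component \<open>f d\<close> is
  extended by \<open>0\<close> to the other summands.
\<close>

definition gr_dual_incl ::
  "('k, 'r) ring_scheme \<Rightarrow> ('i \<Rightarrow> ('k, 'a, 'm) module_scheme)
    \<Rightarrow> ('i \<Rightarrow> 'a \<Rightarrow> 'k) \<Rightarrow> (('i \<Rightarrow> 'a) \<Rightarrow> 'k)" where
  "gr_dual_incl K M f =
     (\<lambda>z\<in>carrier (dsum UNIV M). \<Oplus>\<^bsub>K\<^esub>d\<in>{d. z d \<noteq> \<zero>\<^bsub>M d\<^esub>}. f d (z d))"


subsection \<open>Tensor powers\<close>

definition words :: "nat \<Rightarrow> ('k, 'a, 'm) module_scheme \<Rightarrow> 'a list set" where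
  "words d M = {xs. length xs = d \<and> set xs \<subseteq> carrier M}"

definition tensor_rels ::
  "('k, 'r) ring_scheme \<Rightarrow> nat \<Rightarrow> ('k, 'a, 'm) module_scheme \<Rightarrow> ('a list \<Rightarrow> 'k) set" where
  "tensor_rels K d M = (let F = free_module K (words d M); e = free_gen K (words d M) in
     {e (xs[i := x \<oplus>\<^bsub>M\<^esub> y]) \<ominus>\<^bsub>F\<^esub> (e (xs[i := x]) \<oplus>\<^bsub>F\<^esub> e (xs[i := y])) | xs i x y.
        xs \<in> words d M \<and> i < d \<and> x \<in> carrier M \<and> y \<in> carrier M} \<union>
     {e (xs[i := a \<odot>\<^bsub>M\<^esub> x]) \<ominus>\<^bsub>F\<^esub> (a \<odot>\<^bsub>F\<^esub> e (xs[i := x])) | xs i a x.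
        xs \<in> words d M \<and> i < d \<and> a \<in> carrier K \<and> x \<in> carrier M})"

definition tensor_power ::
  "('k, 'r) ring_scheme \<Rightarrow> nat \<Rightarrow> ('k, 'a, 'm) module_scheme \<Rightarrow> ('k, ('a list \<Rightarrow> 'k) set) module"
  where
  "tensor_power K d M =
     quot_module (free_module K (words d M))
       (gen_submodule K (free_module K (words d M)) (tensor_rels K d M))"

definition tensor ::
  "('k, 'r) ring_scheme \<Rightarrow> nat \<Rightarrow> ('k, 'a, 'm) module_scheme \<Rightarrow> 'a list \<Rightarrow> ('a list \<Rightarrow> 'k) set"
  where
  "tensor K d M xs =
     gen_submodule K (free_module K (words d M)) (tensor_rels K d M)
       +>\<^bsub>free_module K (words d M)\<^esub> free_gen K (words d M) xs"

definition tensor_map ::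
  "('k, 'r) ring_scheme \<Rightarrow> nat \<Rightarrow> ('k, 'a, 'm) module_scheme \<Rightarrow> ('k, 'b, 'n) module_scheme
    \<Rightarrow> ('a \<Rightarrow> 'b) \<Rightarrow> ('a list \<Rightarrow> 'k) set \<Rightarrow> ('b list \<Rightarrow> 'k) set" where
  "tensor_map K d M N u = lin_ext K (tensor_power K d M) (tensor_power K d N)
     (words d M) (tensor K d M) (\<lambda>xs. tensor K d N (map u xs))"

text \<open>
  For a module \<open>G\<close> mapped into the dual of \<open>M\<close> by \<open>j\<close>: the map from the \<open>k\<close>-th tensor power of
  \<open>G\<close> to the dual of the \<open>k\<close>-th tensor power of \<open>M\<close> with
  \<open>f\<^sub>1 \<otimes> \<dots> \<otimes> f\<^sub>k \<mapsto> (z\<^sub>1 \<otimes> \<dots> \<otimes> z\<^sub>k \<mapsto> j f\<^sub>1 z\<^sub>1 \<cdots> j f\<^sub>k z\<^sub>k)\<close>.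
\<close>

definition tensor_forms ::
  "('k, 'r) ring_scheme \<Rightarrow> nat \<Rightarrow> ('k, 'a, 'm) module_scheme \<Rightarrow> ('k, 'g, 'n) module_scheme
    \<Rightarrow> ('g \<Rightarrow> 'a \<Rightarrow> 'k) \<Rightarrow> ('g list \<Rightarrow> 'k) set \<Rightarrow> (('a list \<Rightarrow> 'k) set \<Rightarrow> 'k)" where
  "tensor_forms K k M G j =
     lin_ext K (tensor_power K k G) (dual K (tensor_power K k M)) (words k G) (tensor K k G)
       (\<lambda>fs. lin_ext K (tensor_power K k M) (ring_module K) (words k M) (tensor K k M)
          (\<lambda>zs. \<Otimes>\<^bsub>K\<^esub>i\<in>{..<k}. j (fs ! i) (zs ! i)))"


section \<open>Invariant sequences of characters\<close>

text \<open>
  Permutations of the positive integers are represented by functions on \<open>nat\<close> that fix \<open>0\<close>.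
\<close>

definition omega :: "(nat \<Rightarrow> nat) \<Rightarrow> (nat \<Rightarrow> nat)" where
  "omega \<sigma> = (\<lambda>t. if t \<ge> 2 then \<sigma> (t - 1) + 1 else t)"

text \<open>
  Only the indices \<open>d \<ge> 1\<close> matter: \<open>W 0\<close> and \<open>chi 0\<close> are unconstrained, and neither the
  semi-symmetric algebra nor the comparison map below depends on them.
\<close>

definition omega_invariant ::
  "('k, 'r) ring_scheme \<Rightarrow> (nat \<Rightarrow> (nat \<Rightarrow> nat) set) \<Rightarrow> (nat \<Rightarrow> (nat \<Rightarrow> nat) \<Rightarrow> 'k) \<Rightarrow> bool"
  where
  "omega_invariant K W chi \<longleftrightarrow> (\<forall>d\<ge>1.
     subgroup (W d) (sym_group d) \<and>
     chi d \<in> hom (sym_group d\<lparr>carrier := W d\<rparr>) (units_of K) \<and>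
     W d \<subseteq> W (Suc d) \<and> omega ` W d \<subseteq> W (Suc d) \<and>
     (\<forall>\<sigma>\<in>W d. chi (Suc d) \<sigma> = chi d \<sigma> \<and> chi (Suc d) (omega \<sigma>) = chi d \<sigma>))"


section \<open>Semi-symmetric algebras\<close>

definition permute_word :: "(nat \<Rightarrow> nat) \<Rightarrow> 'a list \<Rightarrow> 'a list" where
  "permute_word \<sigma> xs = map (\<lambda>i. xs ! (inv' \<sigma> i - 1)) [1..<Suc (length xs)]"

definition perm_action ::
  "('k, 'r) ring_scheme \<Rightarrow> nat \<Rightarrow> ('k, 'a, 'm) module_scheme \<Rightarrow> (nat \<Rightarrow> nat)
    \<Rightarrow> ('a list \<Rightarrow> 'k) set \<Rightarrow> ('a list \<Rightarrow> 'k) set" where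
  "perm_action K d M \<sigma> = lin_ext K (tensor_power K d M) (tensor_power K d M)
     (words d M) (tensor K d M) (\<lambda>xs. tensor K d M (permute_word \<sigma> xs))"

text \<open>
  In degree \<open>0\<close> there are no relations, and the power is \<open>tensor_power K 0 M\<close>, that is, \<open>K\<close>:
  the free module on the empty word. The class of the empty word is the unit \<open>1 \<in> K\<close>.
\<close>

definition chi_rels ::
  "('k, 'r) ring_scheme \<Rightarrow> (nat \<Rightarrow> (nat \<Rightarrow> nat) set) \<Rightarrow> (nat \<Rightarrow> (nat \<Rightarrow> nat) \<Rightarrow> 'k)
    \<Rightarrow> nat \<Rightarrow> ('k, 'a, 'm) module_scheme \<Rightarrow> ('a list \<Rightarrow> 'k) set set" where
  "chi_rels K W chi d M = (if d = 0 then {} else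
     {(inv\<^bsub>K\<^esub> (chi d \<sigma>) \<odot>\<^bsub>tensor_power K d M\<^esub> z) \<ominus>\<^bsub>tensor_power K d M\<^esub> perm_action K d M \<sigma> z | \<sigma> z.
        \<sigma> \<in> W d \<and> z \<in> carrier (tensor_power K d M)})"

definition chi_power ::
  "('k, 'r) ring_scheme \<Rightarrow> (nat \<Rightarrow> (nat \<Rightarrow> nat) set) \<Rightarrow> (nat \<Rightarrow> (nat \<Rightarrow> nat) \<Rightarrow> 'k)
    \<Rightarrow> nat \<Rightarrow> ('k, 'a, 'm) module_scheme \<Rightarrow> ('k, ('a list \<Rightarrow> 'k) set set) module" where
  "chi_power K W chi d M = quot_module (tensor_power K d M)
     (gen_submodule K (tensor_power K d M) (chi_rels K W chi d M))"

definition chi_product ::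
  "('k, 'r) ring_scheme \<Rightarrow> (nat \<Rightarrow> (nat \<Rightarrow> nat) set) \<Rightarrow> (nat \<Rightarrow> (nat \<Rightarrow> nat) \<Rightarrow> 'k)
    \<Rightarrow> nat \<Rightarrow> ('k, 'a, 'm) module_scheme \<Rightarrow> 'a list \<Rightarrow> ('a list \<Rightarrow> 'k) set set" where
  "chi_product K W chi d M xs =
     gen_submodule K (tensor_power K d M) (chi_rels K W chi d M)
       +>\<^bsub>tensor_power K d M\<^esub> tensor K d M xs"

definition chi_power_map ::
  "('k, 'r) ring_scheme \<Rightarrow> (nat \<Rightarrow> (nat \<Rightarrow> nat) set) \<Rightarrow> (nat \<Rightarrow> (nat \<Rightarrow> nat) \<Rightarrow> 'k)
    \<Rightarrow> nat \<Rightarrow> ('k, 'a, 'm) module_scheme \<Rightarrow> ('k, 'b, 'n) module_scheme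
    \<Rightarrow> ('a \<Rightarrow> 'b) \<Rightarrow> ('a list \<Rightarrow> 'k) set set \<Rightarrow> ('b list \<Rightarrow> 'k) set set" where
  "chi_power_map K W chi d M N u = lin_ext K (chi_power K W chi d M) (chi_power K W chi d N)
     (words d M) (chi_product K W chi d M) (\<lambda>xs. chi_product K W chi d N (map u xs))"

definition semi_sym ::
  "('k, 'r) ring_scheme \<Rightarrow> (nat \<Rightarrow> (nat \<Rightarrow> nat) set) \<Rightarrow> (nat \<Rightarrow> (nat \<Rightarrow> nat) \<Rightarrow> 'k)
    \<Rightarrow> ('k, 'a, 'm) module_scheme \<Rightarrow> ('k, nat \<Rightarrow> ('a list \<Rightarrow> 'k) set set) module" where
  "semi_sym K W chi M = dsum UNIV (\<lambda>d. chi_power K W chi d M)"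

definition semi_sym_map ::
  "('k, 'r) ring_scheme \<Rightarrow> (nat \<Rightarrow> (nat \<Rightarrow> nat) set) \<Rightarrow> (nat \<Rightarrow> (nat \<Rightarrow> nat) \<Rightarrow> 'k)
    \<Rightarrow> ('k, 'a, 'm) module_scheme \<Rightarrow> ('k, 'b, 'n) module_scheme
    \<Rightarrow> ('a \<Rightarrow> 'b) \<Rightarrow> (nat \<Rightarrow> ('a list \<Rightarrow> 'k) set set) \<Rightarrow> (nat \<Rightarrow> ('b list \<Rightarrow> 'k) set set)" where
  "semi_sym_map K W chi M N u =
     dsum_map UNIV (\<lambda>d. chi_power K W chi d M) (\<lambda>d. chi_power_map K W chi d M N u)"

text \<open>
  The decomposable vector \<open>x\<^sub>1 \<chi> \<dots> \<chi> x\<^sub>r\<close>, as a homogeneous element of the semi-symmetric algebra.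
\<close>

definition decomp ::
  "('k, 'r) ring_scheme \<Rightarrow> (nat \<Rightarrow> (nat \<Rightarrow> nat) set) \<Rightarrow> (nat \<Rightarrow> (nat \<Rightarrow> nat) \<Rightarrow> 'k)
    \<Rightarrow> ('k, 'a, 'm) module_scheme \<Rightarrow> 'a list \<Rightarrow> (nat \<Rightarrow> ('a list \<Rightarrow> 'k) set set)" where
  "decomp K W chi M xs = dsum_inj UNIV (\<lambda>d. chi_power K W chi d M) (length xs)
     (chi_product K W chi (length xs) M xs)"


section \<open>The comparison map\<close>

definition d_chi ::
  "('k, 'r) ring_scheme \<Rightarrow> (nat \<Rightarrow> (nat \<Rightarrow> nat) set) \<Rightarrow> (nat \<Rightarrow> (nat \<Rightarrow> nat) \<Rightarrow> 'k)
    \<Rightarrow> nat \<Rightarrow> (nat \<Rightarrow> nat \<Rightarrow> 'k) \<Rightarrow> 'k" where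
  "d_chi K W chi r A =
     (\<Oplus>\<^bsub>K\<^esub>\<sigma>\<in>W r. chi r \<sigma> \<otimes>\<^bsub>K\<^esub> (\<Otimes>\<^bsub>K\<^esub>j\<in>{1..r}. A (inv' \<sigma> j) j))"

text \<open>Matrices are indexed from \<open>1\<close>, lists from \<open>0\<close>.\<close>

definition gram :: "'a list \<Rightarrow> ('a \<Rightarrow> 'k) list \<Rightarrow> nat \<Rightarrow> nat \<Rightarrow> 'k" where
  "gram xs ys = (\<lambda>i j. canon_form (xs ! (i - 1)) (ys ! (j - 1)))"

text \<open>
  In degree \<open>0\<close> both modules are generated by the empty product, and the bilinear map with value
  \<open>1\<close> at the pair of empty products is \<open>(k\<^sup>*, k) \<mapsto> k k\<^sup>*\<close>.
\<close>

definition iota_deg ::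
  "('k, 'r) ring_scheme \<Rightarrow> (nat \<Rightarrow> (nat \<Rightarrow> nat) set) \<Rightarrow> (nat \<Rightarrow> (nat \<Rightarrow> nat) \<Rightarrow> 'k)
    \<Rightarrow> nat \<Rightarrow> ('k, 'a, 'm) module_scheme
    \<Rightarrow> (('a \<Rightarrow> 'k) list \<Rightarrow> 'k) set set \<Rightarrow> (('a list \<Rightarrow> 'k) set set \<Rightarrow> 'k)" where
  "iota_deg K W chi d E =
     lin_ext K (chi_power K W chi d (dual K E)) (dual K (chi_power K W chi d E))
       (words d (dual K E)) (chi_product K W chi d (dual K E))
       (\<lambda>ys. lin_ext K (chi_power K W chi d E) (ring_module K)
          (words d E) (chi_product K W chi d E)
          (\<lambda>xs. if d = 0 then \<one>\<^bsub>K\<^esub> else d_chi K W chi d (gram xs ys)))"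

definition semi_sym_gr_dual ::
  "('k, 'r) ring_scheme \<Rightarrow> (nat \<Rightarrow> (nat \<Rightarrow> nat) set) \<Rightarrow> (nat \<Rightarrow> (nat \<Rightarrow> nat) \<Rightarrow> 'k)
    \<Rightarrow> ('k, 'a, 'm) module_scheme \<Rightarrow> ('k, nat \<Rightarrow> ('a list \<Rightarrow> 'k) set set \<Rightarrow> 'k) module" where
  "semi_sym_gr_dual K W chi E = gr_dual K (\<lambda>d. chi_power K W chi d E)"

definition semi_sym_gr_dual_map ::
  "('k, 'r) ring_scheme \<Rightarrow> (nat \<Rightarrow> (nat \<Rightarrow> nat) set) \<Rightarrow> (nat \<Rightarrow> (nat \<Rightarrow> nat) \<Rightarrow> 'k)
    \<Rightarrow> ('k, 'a, 'm) module_scheme \<Rightarrow> ('k, 'b, 'n) module_scheme \<Rightarrow> ('a \<Rightarrow> 'b)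
    \<Rightarrow> (nat \<Rightarrow> ('b list \<Rightarrow> 'k) set set \<Rightarrow> 'k) \<Rightarrow> (nat \<Rightarrow> ('a list \<Rightarrow> 'k) set set \<Rightarrow> 'k)" where
  "semi_sym_gr_dual_map K W chi M N u =
     dsum_map UNIV (\<lambda>d. dual K (chi_power K W chi d N))
       (\<lambda>d. transpose_map K (chi_power K W chi d M) (chi_power K W chi d N)
              (chi_power_map K W chi d M N u))"

definition iota ::
  "('k, 'r) ring_scheme \<Rightarrow> (nat \<Rightarrow> (nat \<Rightarrow> nat) set) \<Rightarrow> (nat \<Rightarrow> (nat \<Rightarrow> nat) \<Rightarrow> 'k)
    \<Rightarrow> ('k, 'a, 'm) module_scheme
    \<Rightarrow> (nat \<Rightarrow> (('a \<Rightarrow> 'k) list \<Rightarrow> 'k) set set) \<Rightarrow> (nat \<Rightarrow> ('a list \<Rightarrow> 'k) set set \<Rightarrow> 'k)" where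
  "iota K W chi E = dsum_map UNIV (\<lambda>d. chi_power K W chi d (dual K E)) (\<lambda>d. iota_deg K W chi d E)"

definition semi_sym_incl ::
  "('k, 'r) ring_scheme \<Rightarrow> (nat \<Rightarrow> (nat \<Rightarrow> nat) set) \<Rightarrow> (nat \<Rightarrow> (nat \<Rightarrow> nat) \<Rightarrow> 'k)
    \<Rightarrow> ('k, 'a, 'm) module_scheme
    \<Rightarrow> (nat \<Rightarrow> ('a list \<Rightarrow> 'k) set set \<Rightarrow> 'k) \<Rightarrow> ((nat \<Rightarrow> ('a list \<Rightarrow> 'k) set set) \<Rightarrow> 'k)" where
  "semi_sym_incl K W chi E = gr_dual_incl K (\<lambda>d. chi_power K W chi d E)"

text \<open>
  A form, and an element of a tensor power of the module of forms, regarded as a linear form on the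
  semi-symmetric algebra and on its tensor power.
\<close>

definition form_ident ::
  "('k, 'r) ring_scheme \<Rightarrow> (nat \<Rightarrow> (nat \<Rightarrow> nat) set) \<Rightarrow> (nat \<Rightarrow> (nat \<Rightarrow> nat) \<Rightarrow> 'k)
    \<Rightarrow> ('k, 'a, 'm) module_scheme
    \<Rightarrow> (nat \<Rightarrow> (('a \<Rightarrow> 'k) list \<Rightarrow> 'k) set set) \<Rightarrow> ((nat \<Rightarrow> ('a list \<Rightarrow> 'k) set set) \<Rightarrow> 'k)" where
  "form_ident K W chi E f = semi_sym_incl K W chi E (iota K W chi E f)"

definition tensor_form_ident ::
  "('k, 'r) ring_scheme \<Rightarrow> (nat \<Rightarrow> (nat \<Rightarrow> nat) set) \<Rightarrow> (nat \<Rightarrow> (nat \<Rightarrow> nat) \<Rightarrow> 'k)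
    \<Rightarrow> nat \<Rightarrow> ('k, 'a, 'm) module_scheme
    \<Rightarrow> ((nat \<Rightarrow> (('a \<Rightarrow> 'k) list \<Rightarrow> 'k) set set) list \<Rightarrow> 'k) set
    \<Rightarrow> ((nat \<Rightarrow> ('a list \<Rightarrow> 'k) set set) list \<Rightarrow> 'k) set \<Rightarrow> 'k" where
  "tensor_form_ident K W chi k E t =
     tensor_forms K k (semi_sym K W chi E) (semi_sym_gr_dual K W chi E) (semi_sym_incl K W chi E)
       (tensor_map K k (semi_sym K W chi (dual K E)) (semi_sym_gr_dual K W chi E)
          (iota K W chi E) t)"

end

theory Submission
  imports Defs
begin

text \<open>
  The relations and the comparison map are compatible only because \<open>\<chi>\<^sup>2 = 1\<close>. To see this, choose a shift of a
  permutation \<open>\<sigma> \<noteq> 1\<close> whose support meets that of \<open>\<sigma>\<close> in a single point; the commutator of the two is a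
  3-cycle in the kernel of the character. The points linked by such 3-cycles form classes that are
  periodic far out, hence are preserved by every finitary permutation \<open>\<sigma>\<close> of the system, and
  then \<open>\<sigma>\<^sup>2\<close> is a product of 3-cycles in the kernel.

  For the isomorphism, let \<open>e\<^sub>I\<close> and \<open>e\<^sub>J\<^sup>*\<close> be the decomposable vectors on a basis and on its dual basis,
  indexed by words. If \<open>v\<close> is any family with \<open>v\<^bsub>\<sigma>I\<^esub> = \<chi>(\<sigma>) v\<^sub>I\<close>, then
  \<open>\<Sum>\<^sub>J \<iota>(e\<^sub>J\<^sup>*)(e\<^sub>I) v\<^sub>J = |W\<^sub>d| v\<^sub>I\<close>. Hence \<open>f \<mapsto> |W\<^sub>d|\<^sup>-\<^sup>1 \<Sum>\<^sub>J f(e\<^sub>J) e\<^sub>J\<^sup>*\<close> is a two-sided inverse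
  of \<open>\<iota>\<close> in degree \<open>d\<close>.
\<close>

section \<open>Invariant characters have order at most two\<close>

text \<open>The order-two property is forced by the side of the forms. Translating the sum that
  defines the comparison map by a permutation t produces the factor \<chi>(t)^-1 on the vectors but
  \<chi>(t) on the forms, because a permutation carried over from vectors to forms turns into its
  inverse. The relations of both powers ask for \<chi>(t)^-1, so descent to the power of the dual
  rests on \<chi>(t) being its own inverse. The decomposable vectors on basis words generate the
  power but need not be a basis of it: words in one orbit give proportional vectors, and a word
  fixed by some permutation of weight -1 gives the vector 0. No orbit representatives are selected.
  In the sum over all words each permutation contributes exactly one copy of the vector it started
  from, its weight appearing squared; this accounts for orbits and stabilisers at once, explains the
  constant |W_d|, and confines division to that one integer.\<close>

definition cyc3 :: "nat \<Rightarrow> nat \<Rightarrow> nat \<Rightarrow> nat \<Rightarrow> nat" where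
  "cyc3 x y z = transpose x y \<circ> transpose y z"

lemma cyc3_apply [simp]:
  assumes "x \<noteq> y" "x \<noteq> z" "y \<noteq> z"
  shows "cyc3 x y z x = y" "cyc3 x y z y = z" "cyc3 x y z z = x"
  using assms by (auto simp: cyc3_def transpose_def)

lemma cyc3_other [simp]: "w \<noteq> x \<Longrightarrow> w \<noteq> y \<Longrightarrow> w \<noteq> z \<Longrightarrow> cyc3 x y z w = w"
  by (auto simp: cyc3_def transpose_def)

lemma cyc3_rotate:
  assumes "x \<noteq> y" "x \<noteq> z" "y \<noteq> z"
  shows "cyc3 y z x = cyc3 x y z"
  using assms by (auto simp: cyc3_def transpose_def fun_eq_iff)

lemma cyc3_square:
  assumes "x \<noteq> y" "x \<noteq> z" "y \<noteq> z"
  shows "cyc3 x y z \<circ> cyc3 x y z = cyc3 x z y"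
  using assms by (auto simp: cyc3_def transpose_def fun_eq_iff)

lemma cyc3_conj:
  assumes "bij g"
  shows "g \<circ> cyc3 x y z \<circ> inv' g = cyc3 (g x) (g y) (g z)"
proof -
  have "g \<circ> cyc3 x y z = cyc3 (g x) (g y) (g z) \<circ> g"
    using assms by (auto simp: fun_eq_iff cyc3_def transpose_def bij_def inj_eq)
  then show ?thesis
    using assms by (simp add: comp_assoc bij_is_surj surj_iff[THEN iffD1])
qed

text \<open>Apart from \<open>b\<close>, every point is moved by at most one of the two
  permutations, so they commute wherever \<open>b\<close> does not interfere, and only
  \<open>b\<close> and its two images feel the commutator.\<close>

lemma commutator_eq_cyc3:
  assumes g: "bij g" and h: "bij h" and b: "g b \<noteq> b" "h b \<noteq> b"
    and disj: "\<And>x. x \<noteq> b \<Longrightarrow> g x = x \<or> h x = x"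
  shows "g \<circ> h \<circ> inv' g \<circ> inv' h = cyc3 b (g b) (h b)"
proof -
  have gi: "g x = g y \<longleftrightarrow> x = y" and hi: "h x = h y \<longleftrightarrow> x = y" for x y
    using g h by (auto simp: bij_def inj_eq)
  have ne: "b \<noteq> g b" "b \<noteq> h b" "g b \<noteq> h b"
    using b disj gi hi by (auto, metis)
  have "g (h x) = cyc3 b (g b) (h b) (h (g x))" for x
  proof -
    \<comment> \<open>In the first three cases \<open>h (g x)\<close> is \<open>g b\<close>,
      \<open>h b\<close> and \<open>b\<close> respectively, so the 3-cycle acts; in the last one
      \<open>g\<close> and \<open>h\<close> commute at \<open>x\<close> and the 3-cycle fixes the
      common value.\<close>
    consider "x = b" | "g x = b" | "h x = b" | "x \<noteq> b" "g x \<noteq> b" "h x \<noteq> b" by blast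
    then show ?thesis
    proof cases
      case 1
      have "g (h b) = h b" "h (g b) = g b" using disj b gi hi by metis+
      then show ?thesis using 1 ne by simp
    next
      case 2
      then have "x \<noteq> b" using b by auto
      then have "h x = x" using disj 2 by metis
      then show ?thesis using 2 ne by simp
    next
      case 3
      then have "x \<noteq> b" using b by auto
      then have "g x = x" using disj 3 by metis
      then show ?thesis using 3 ne by simp
    next
      case 4
      consider "g x = x" | "h x = x" "g x \<noteq> x" using disj 4 by blast
      then show ?thesis
      proof cases
        case 1
        have "g (h x) = h x" using disj 4 1 hi by metis
        moreover have "h x \<noteq> h b" using 4 hi by simp
        moreover have "h x \<noteq> g b"
          using 4 1 disj[of "g b"] b gi hi by metis
        ultimately show ?thesis using 1 4 by simp
      next
        case 2
        have "h (g x) = g x" using disj 4 2 gi by metis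
        moreover have "g x \<noteq> g b" using 4 gi by simp
        moreover have "g x \<noteq> h b"
          using 4 2 disj[of "h b"] b gi hi by metis
        ultimately show ?thesis using 2 4 by simp
      qed
    qed
  qed
  then have "g \<circ> h = cyc3 b (g b) (h b) \<circ> h \<circ> g" by (simp add: fun_eq_iff)
  then show ?thesis
    using g h by (simp add: comp_assoc bij_is_surj surj_iff[THEN iffD1])
qed

section \<open>Shift-stable groups of finitary permutations\<close>

lemma omega_cyc3:
  assumes "x \<ge> 1" "y \<ge> 1" "z \<ge> 1"
  shows "omega (cyc3 x y z) = cyc3 (Suc x) (Suc y) (Suc z)"
proof
  fix t show "omega (cyc3 x y z) t = cyc3 (Suc x) (Suc y) (Suc z) t"
    using assms by (cases t) (auto simp: omega_def cyc3_def transpose_def)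
qed

lemma omega_funpow:
  assumes "\<sigma> permutes {1..d}"
  shows "(omega ^^ k) \<sigma> t = (if t > k then \<sigma> (t - k) + k else t)"
  using assms
proof (induction k arbitrary: t)
  \<comment> \<open>Without any shift the else branch concerns only \<open>t = 0\<close>, which
    represents no point and is fixed by \<sigma>.\<close>
  case 0
  then show ?case using permutes_not_in[OF 0] by auto
next
  case (Suc k)
  then show ?case by (auto simp: omega_def)
qed

text \<open>What the argument takes from the characters: \<open>G\<close> will be the union of the
  groups \<open>W d\<close>, and \<open>N\<close> the set of its elements of character value 1.
  \<open>N_commutator\<close> reflects that units of a commutative ring commute.
  \<open>N_omega\<close> is an equivalence, so membership in \<open>N\<close> can be shifted up and
  pulled back again.\<close>

locale omega_stable =
  fixes G N :: "(nat \<Rightarrow> nat) set"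
  assumes perm: "\<And>g. g \<in> G \<Longrightarrow> \<exists>d. g permutes {1..d}"
    and N_sub: "N \<subseteq> G"
    and G_comp: "\<And>g h. g \<in> G \<Longrightarrow> h \<in> G \<Longrightarrow> g \<circ> h \<in> G"
    and N_id: "id \<in> N"
    and N_comp: "\<And>g h. g \<in> N \<Longrightarrow> h \<in> N \<Longrightarrow> g \<circ> h \<in> N"
    and N_conj: "\<And>g h. g \<in> G \<Longrightarrow> h \<in> N \<Longrightarrow> g \<circ> h \<circ> inv' g \<in> N"
    and N_commutator: "\<And>g h. g \<in> G \<Longrightarrow> h \<in> G \<Longrightarrow> g \<circ> h \<circ> inv' g \<circ> inv' h \<in> N"
    and G_omega: "\<And>g. g \<in> G \<Longrightarrow> omega g \<in> G"
    and N_omega: "\<And>g. g \<in> G \<Longrightarrow> omega g \<in> N \<longleftrightarrow> g \<in> N"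
begin

lemma G_bij: "g \<in> G \<Longrightarrow> bij g"
  using perm permutes_bij by blast

text \<open>Equality is added by hand because \<open>cyc3\<close> is no 3-cycle at repeated points.
  The third point is left open here; \<open>linked_cyc3\<close> shows that it may be any further
  point of the class.\<close>

definition linked :: "nat \<Rightarrow> nat \<Rightarrow> bool" where
  "linked x y \<longleftrightarrow> x = y \<or> (\<exists>z. x \<noteq> y \<and> x \<noteq> z \<and> y \<noteq> z \<and> cyc3 x y z \<in> N)"

lemma cyc3_flip:
  assumes "cyc3 x y z \<in> N" "x \<noteq> y" "x \<noteq> z" "y \<noteq> z"
  shows "cyc3 x z y \<in> N"
  using N_comp[OF assms(1,1)] cyc3_square assms by simp

lemma N_conj_cyc3:
  assumes "g \<in> G" "cyc3 x y z \<in> N"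
  shows "cyc3 (g x) (g y) (g z) \<in> N"
  using N_conj[OF assms] cyc3_conj[OF G_bij[OF assms(1)]] by simp

text \<open>The third points \<open>u\<close> and \<open>v\<close> of the two given cycles are
  arbitrary. Normality removes them: conjugation by the given cycles moves the unwanted points until
  only \<open>x\<close>, \<open>y\<close> and \<open>z\<close> are left.\<close>

lemma linked_cyc3:
  assumes "linked x y" "linked y z" and ne: "x \<noteq> y" "x \<noteq> z" "y \<noteq> z"
  shows "cyc3 x y z \<in> N"
proof -
  obtain u v where u: "x \<noteq> u" "y \<noteq> u" "cyc3 x y u \<in> N" and v: "y \<noteq> v" "z \<noteq> v" "cyc3 y z v \<in> N"
    using assms by (auto simp: linked_def)
  have G: "cyc3 x y u \<in> G" "cyc3 y z v \<in> G" using u v N_sub by auto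
  consider "u = z" | "v = x" | "v = u" "u \<noteq> z" "v \<noteq> x" | "v \<noteq> u" "u \<noteq> z" "v \<noteq> x" by blast
  then show ?thesis
  proof cases
    case 1
    then show ?thesis using u by simp
  next
    case 2
    then show ?thesis using v cyc3_rotate ne by simp
  next
    case 3
    have "cyc3 u z x \<in> N"
      using N_conj_cyc3[OF G(1) v(3)] 3 u ne by simp
    from N_conj_cyc3[OF G(1) this] have "cyc3 x z y \<in> N"
      using 3 u ne by simp
    then show ?thesis using cyc3_flip ne by simp
  next
    case 4
    have "cyc3 x z u \<in> N"
      using N_conj_cyc3[OF G(2) u(3)] 4 u v ne by simp
    from N_conj_cyc3[OF G(1) this] have "cyc3 y z x \<in> N"
      using 4 u ne by simp
    then show ?thesis using cyc3_rotate ne by simp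
  qed
qed

lemma linked_sym: "linked x y \<Longrightarrow> linked y x"
  unfolding linked_def using cyc3_flip cyc3_rotate by metis

lemma linked_trans:
  assumes "linked x y" "linked y z"
  shows "linked x z"
proof (cases "x = y \<or> y = z \<or> x = z")
  case False
  then show ?thesis
    using linked_cyc3[OF assms] cyc3_flip unfolding linked_def by blast
qed (use assms in \<open>auto simp: linked_def\<close>)

lemma linked_image:
  assumes "g \<in> G" "linked x y"
  shows "linked (g x) (g y)"
  using assms N_conj_cyc3[OF assms(1)] G_bij[OF assms(1)]
  unfolding linked_def by (metis bij_pointE)

text \<open>Elements of \<open>G\<close> fix 0, so 0 cannot occur in a genuine 3-cycle. This
  supplies the positivity that \<open>omega_cyc3\<close> asks for.\<close>

lemma N_pos:
  assumes "cyc3 x y z \<in> N" "x \<noteq> y" "x \<noteq> z" "y \<noteq> z"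
  shows "x \<ge> 1" "y \<ge> 1" "z \<ge> 1"
proof -
  obtain d where "cyc3 x y z permutes {1..d}" using assms N_sub perm by blast
  then have "cyc3 x y z 0 = 0" by (simp add: permutes_not_in)
  then show "x \<ge> 1" "y \<ge> 1" "z \<ge> 1"
    using assms cyc3_apply[of x y z] by (metis less_one linorder_not_less)+
qed

lemma linked_Suc:
  assumes "linked x y"
  shows "linked (Suc x) (Suc y)"
proof (cases "x = y")
  case False
  then obtain z where z: "x \<noteq> z" "y \<noteq> z" "cyc3 x y z \<in> N"
    using assms by (auto simp: linked_def)
  then have "cyc3 (Suc x) (Suc y) (Suc z) \<in> N"
    using omega_cyc3 N_pos False N_omega[of "cyc3 x y z"] N_sub by (metis subsetD)
  then show ?thesis using z False unfolding linked_def by (metis nat.inject)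
qed (simp add: linked_def)

text \<open>Induction on the support: with \<open>y = \<sigma> x\<close>, split off the
  transposition of \<open>x\<close> and \<open>y\<close>, leaving a permutation
  \<open>\<sigma>'\<close> that fixes \<open>x\<close>. Squaring is what helps: the transposition
  then occurs twice, and moving one copy across \<open>\<sigma>'\<close> turns the two into a
  product of transpositions that share the point \<open>x\<close>. A single transposition could
  never be a product of 3-cycles.\<close>

lemma square_in_N_of_linked:
  assumes "bij \<sigma>" "finite {x. \<sigma> x \<noteq> x}" "\<And>x. linked x (\<sigma> x)"
  shows "\<sigma> \<circ> \<sigma> \<in> N"
  using assms
proof (induction "card {x. \<sigma> x \<noteq> x}" arbitrary: \<sigma> rule: less_induct)
  case (less \<sigma>)
  show ?case
  proof (cases "\<sigma> = id")
    case True
    then show ?thesis using N_id by simp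
  next
    case False
    then obtain x where x: "\<sigma> x \<noteq> x" by (auto simp: fun_eq_iff)
    define y where "y = \<sigma> x"
    define \<sigma>' where "\<sigma>' = transpose x y \<circ> \<sigma>"
    have inj: "\<sigma> a = \<sigma> b \<longleftrightarrow> a = b" for a b using less.prems(1) by (auto simp: bij_def inj_eq)
    have xy: "x \<noteq> y" using x y_def by simp
    have bij: "bij \<sigma>'" using less.prems(1) unfolding \<sigma>'_def by (intro bij_comp) simp_all
    have x': "\<sigma>' x = x" by (simp add: \<sigma>'_def y_def)
    have supp: "{z. \<sigma>' z \<noteq> z} \<subset> {z. \<sigma> z \<noteq> z}"
    proof
      show "{z. \<sigma>' z \<noteq> z} \<subseteq> {z. \<sigma> z \<noteq> z}"
        using inj x by (auto simp: \<sigma>'_def transpose_def y_def split: if_splits)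
      show "{z. \<sigma>' z \<noteq> z} \<noteq> {z. \<sigma> z \<noteq> z}" using x x' by blast
    qed
    have linked': "linked z (\<sigma>' z)" for z
    proof -
      consider "z = x" | "\<sigma> z = x" | "z \<noteq> x" "\<sigma> z \<noteq> x" by blast
      then show ?thesis
      proof cases
        case 1
        then show ?thesis using x' by (simp add: linked_def)
      next
        case 2
        then have "\<sigma>' z = y" by (simp add: \<sigma>'_def)
        then show ?thesis
          using linked_trans less.prems(3)[of z] less.prems(3)[of x] 2 y_def by metis
      next
        case 3
        then have "\<sigma> z \<noteq> y" using inj by (simp add: y_def)
        with 3 have "\<sigma>' z = \<sigma> z" by (simp add: \<sigma>'_def)
        then show ?thesis using less.prems(3)[of z] by simp
      qed
    qed
    have "\<sigma>' \<circ> \<sigma>' \<in> N"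
      using less.hyps[of \<sigma>'] psubset_card_mono[OF less.prems(2) supp] bij linked'
        finite_subset[OF psubset_imp_subset[OF supp] less.prems(2)] by simp
    \<comment> \<open>The two transpositions cancel if \<open>\<sigma>'\<close> fixes
      \<open>y\<close>; otherwise they form a 3-cycle on three linked points.\<close>
    moreover have "transpose x y \<circ> transpose x (\<sigma>' y) \<in> N"
    proof (cases "\<sigma>' y = y")
      case True
      then show ?thesis using N_id by simp
    next
      case False
      moreover have "\<sigma>' y \<noteq> x" using bij x' xy by (metis bij_pointE)
      moreover have "linked y x"
        using less.prems(3)[of x] y_def linked_sym by simp
      moreover have "linked x (\<sigma>' y)"
        using linked_trans[OF less.prems(3)[of x]] linked'[of y] y_def by simp
      ultimately have "cyc3 y x (\<sigma>' y) \<in> N"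
        using linked_cyc3 xy by metis
      then show ?thesis by (simp add: cyc3_def transpose_commute)
    qed
    moreover have "\<sigma> \<circ> \<sigma> = (transpose x y \<circ> transpose x (\<sigma>' y)) \<circ> (\<sigma>' \<circ> \<sigma>')"
    proof -
      have "\<sigma>' \<circ> transpose x y = transpose x (\<sigma>' y) \<circ> \<sigma>'"
        using bij x' by (auto simp: fun_eq_iff transpose_def bij_def inj_eq)
      moreover have "\<sigma> = transpose x y \<circ> \<sigma>'"
        by (simp add: \<sigma>'_def comp_assoc[symmetric])
      ultimately show ?thesis by (metis comp_assoc)
    qed
    ultimately show ?thesis using N_comp by simp
  qed
qed

lemma G_funpow: "g \<in> G \<Longrightarrow> (omega ^^ k) g \<in> G"
  by (induction k) (auto simp: G_omega)

lemma N_funpow: "g \<in> G \<Longrightarrow> (omega ^^ k) g \<in> N \<longleftrightarrow> g \<in> N"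
  by (induction k) (auto simp: N_omega G_funpow)

text \<open>The overlap of \<open>\<sigma>\<close> with a shift of itself is arranged to be a single point.\<close>

lemma exists_linked_shift:
  assumes "\<sigma> \<in> G" "\<sigma> \<noteq> id"
  shows "\<exists>p j. j \<ge> 1 \<and> (\<forall>x\<ge>p. linked x (x + j))"
proof -
  obtain d where d: "\<sigma> permutes {1..d}" using assms perm by blast
  define S where "S = {x. \<sigma> x \<noteq> x}"
  have fin: "finite S"
  proof (rule finite_subset)
    show "S \<subseteq> {1..d}" using permutes_not_in[OF d] unfolding S_def by blast
  qed simp
  have ne: "S \<noteq> {}" using assms by (auto simp: S_def fun_eq_iff)
  define a b where "a = Min S" and "b = Max S"
  have ab: "a \<in> S" "b \<in> S" "\<And>x. x \<in> S \<Longrightarrow> a \<le> x \<and> x \<le> b"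
    using fin ne by (auto simp: a_def b_def)
  have inj: "\<sigma> u = \<sigma> v \<longleftrightarrow> u = v" for u v
    using permutes_inj[OF d] by (auto simp: inj_eq)
  have S\<sigma>: "\<sigma> x \<in> S" if "x \<in> S" for x using that inj by (auto simp: S_def)
  have a1: "a \<ge> 1" using ab(1) permutes_not_in[OF d, of a] by (cases a) (auto simp: S_def)
  \<comment> \<open>Shifting by \<open>b - a\<close> carries the smallest moved point onto the
    largest one, so the support of \<sigma> ends where that of \<tau> begins.\<close>
  define n where "n = b - a"
  define \<tau> where "\<tau> = (omega ^^ n) \<sigma>"
  have \<tau>: "\<tau> t = (if t > n then \<sigma> (t - n) + n else t)" for t
    unfolding \<tau>_def using omega_funpow[OF d] by simp
  have bn: "b - n = a" "b = a + n" using ab by (auto simp: n_def)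
  \<comment> \<open>The last moved point can only go down and the first one only up. As the first
    one is shifted onto \<open>b\<close>, this gives \<open>\<sigma> b < b < \<tau> b\<close>, so
    the 3-cycle below has three distinct entries.\<close>
  have \<sigma>b: "\<sigma> b < b" using ab S\<sigma>[OF ab(2)] by (auto simp: S_def order.strict_iff_order)
  have "\<sigma> a > a" using ab S\<sigma>[OF ab(1)] by (auto simp: S_def order.strict_iff_order)
  then have \<tau>b: "\<tau> b > b" using \<tau> bn a1 by auto
  have "\<tau> \<in> G" using G_funpow assms by (simp add: \<tau>_def)
  moreover have "\<sigma> x = x \<or> \<tau> x = x" if "x \<noteq> b" for x
  proof (rule disjCI)
    assume "\<tau> x \<noteq> x"
    then have "x > n" "x - n \<in> S" using \<tau>[of x] by (auto simp: S_def split: if_splits)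
    then have "x \<notin> S" using ab(3)[of "x - n"] ab(3)[of x] that bn by auto
    then show "\<sigma> x = x" by (simp add: S_def)
  qed
  ultimately have "cyc3 b (\<sigma> b) (\<tau> b) \<in> N"
    using commutator_eq_cyc3[of \<sigma> \<tau> b] N_commutator[of \<sigma> \<tau>] assms G_bij \<sigma>b \<tau>b by simp
  then have "linked b (\<sigma> b)"
    using \<sigma>b \<tau>b unfolding linked_def by (intro disjI2 exI[of _ "\<tau> b"]) auto
  \<comment> \<open>The period is \<open>b - \<sigma> b\<close>: linking passes to successors, so
    this one link spreads to every later point.\<close>
  then have l: "linked (\<sigma> b) (\<sigma> b + (b - \<sigma> b))"
    using linked_sym \<sigma>b by simp
  have "linked (\<sigma> b + k) (\<sigma> b + k + (b - \<sigma> b))" for k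
    by (induction k) (use l linked_Suc in auto)
  then have "\<forall>x\<ge>\<sigma> b. linked x (x + (b - \<sigma> b))"
    by (metis le_add_diff_inverse)
  then show ?thesis using \<sigma>b by (intro exI[of _ "\<sigma> b"] exI[of _ "b - \<sigma> b"]) auto
qed

text \<open>Far out the classes are periodic, so each of them contains points beyond any bound. Once
  \<sigma> is shifted into that range, every moved point \<open>x\<close> is linked to some
  \<open>w\<close> fixed by \<tau>. Applying \<tau> shows that \<open>\<tau> x\<close> is linked to
  \<open>w\<close> too, hence to \<open>x\<close>. So \<tau> stays inside the classes, and
  \<open>N_funpow\<close> undoes the shift.\<close>

theorem square_in_N:
  assumes "\<sigma> \<in> G"
  shows "\<sigma> \<circ> \<sigma> \<in> N"
proof (cases "\<sigma> = id")
  case True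
  then show ?thesis using N_id by simp
next
  case False
  then obtain p j where j: "j \<ge> 1" "\<And>x. x \<ge> p \<Longrightarrow> linked x (x + j)"
    using exists_linked_shift assms by blast
  have lm: "linked x (x + m * j)" if "x \<ge> p" for x m
  proof (induction m)
    case (Suc m)
    then show ?case
      using linked_trans[OF Suc j(2)[of "x + m * j"]] that by (simp add: add.commute add.left_commute)
  qed (simp add: linked_def)
  define \<tau> where "\<tau> = (omega ^^ p) \<sigma>"
  obtain d where d: "\<sigma> permutes {1..d}" using assms perm by blast
  have \<tau>: "\<tau> t = (if t > p then \<sigma> (t - p) + p else t)" for t
    unfolding \<tau>_def using omega_funpow[OF d] by simp
  have \<tau>G: "\<tau> \<in> G" using G_funpow assms by (simp add: \<tau>_def)
  then obtain e where e: "\<tau> permutes {1..e}" using perm by blast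
  have "linked x (\<tau> x)" for x
  proof (cases "\<tau> x = x")
    case False
    then have xp: "x > p" using \<tau>[of x] by (auto split: if_splits)
    \<comment> \<open>\<open>Suc e\<close> periods suffice to leave the support of \<tau>, as the
      period is at least 1 and \<tau> fixes everything above \<open>e\<close>.\<close>
    define w where "w = x + Suc e * j"
    have "Suc e * 1 \<le> Suc e * j" using j(1) by (intro mult_le_mono2)
    then have "w > e" by (simp add: w_def)
    then have "\<tau> w = w" using permutes_not_in[OF e, of w] by simp
    moreover have "linked x w" using lm xp by (simp add: w_def del: mult_Suc)
    ultimately show ?thesis
      using linked_image[OF \<tau>G, of x w] linked_trans linked_sym by metis
  qed (simp add: linked_def)
  moreover have "finite {x. \<tau> x \<noteq> x}"
  proof (rule finite_subset)
    show "{x. \<tau> x \<noteq> x} \<subseteq> {1..e}" using permutes_not_in[OF e] by blast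
  qed simp
  ultimately have "\<tau> \<circ> \<tau> \<in> N"
    using square_in_N_of_linked G_bij \<tau>G by blast
  moreover have "\<tau> \<circ> \<tau> = (omega ^^ p) (\<sigma> \<circ> \<sigma>)"
    using \<tau> omega_funpow[OF permutes_compose[OF d d]] permutes_not_in[OF d]
      permutes_in_image[OF d]
    by (auto simp: fun_eq_iff)
  ultimately show ?thesis using N_funpow G_comp assms by simp
qed

end

section \<open>The characters of an invariant sequence\<close>

lemma char_hom:
  assumes K: "cring K" and "omega_invariant K W chi" "d \<ge> 1"
  shows char_perm: "\<And>\<sigma>. \<sigma> \<in> W d \<Longrightarrow> \<sigma> permutes {1..d}"
    and char_id: "id \<in> W d"
    and char_comp_closed: "\<And>\<sigma> \<tau>. \<sigma> \<in> W d \<Longrightarrow> \<tau> \<in> W d \<Longrightarrow> \<sigma> \<circ> \<tau> \<in> W d"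
    and char_inv_closed: "\<And>\<sigma>. \<sigma> \<in> W d \<Longrightarrow> inv' \<sigma> \<in> W d"
    and char_unit: "\<And>\<sigma>. \<sigma> \<in> W d \<Longrightarrow> chi d \<sigma> \<in> Units K"
    and char_comp: "\<And>\<sigma> \<tau>. \<sigma> \<in> W d \<Longrightarrow> \<tau> \<in> W d \<Longrightarrow> chi d (\<sigma> \<circ> \<tau>) = chi d \<sigma> \<otimes>\<^bsub>K\<^esub> chi d \<tau>"
    and char_one: "chi d id = \<one>\<^bsub>K\<^esub>"
    and char_inv: "\<And>\<sigma>. \<sigma> \<in> W d \<Longrightarrow> chi d \<sigma> \<otimes>\<^bsub>K\<^esub> chi d (inv' \<sigma>) = \<one>\<^bsub>K\<^esub>"
proof -
  interpret cring K by (rule K)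
  have sub: "subgroup (W d) (sym_group d)"
    and hom: "chi d \<in> hom (sym_group d\<lparr>carrier := W d\<rparr>) (units_of K)"
    using assms by (auto simp: omega_invariant_def)
  interpret S: subgroup "W d" "sym_group d" by (rule sub)
  show perm: "\<sigma> permutes {1..d}" if "\<sigma> \<in> W d" for \<sigma>
    using S.subset that sym_group_carrier by blast
  show id: "id \<in> W d" using S.one_closed by (simp add: sym_group_one)
  show comp: "\<sigma> \<circ> \<tau> \<in> W d" if "\<sigma> \<in> W d" "\<tau> \<in> W d" for \<sigma> \<tau>
    using S.m_closed[OF that] by (simp add: sym_group_mult)
  show inv: "inv' \<sigma> \<in> W d" if "\<sigma> \<in> W d" for \<sigma>
    using S.m_inv_closed[OF that] S.subset that by (simp add: subset_iff)
  show unit: "chi d \<sigma> \<in> Units K" if "\<sigma> \<in> W d" for \<sigma>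
    using hom that by (auto simp: hom_def units_of_def)
  show mult: "chi d (\<sigma> \<circ> \<tau>) = chi d \<sigma> \<otimes>\<^bsub>K\<^esub> chi d \<tau>" if "\<sigma> \<in> W d" "\<tau> \<in> W d" for \<sigma> \<tau>
    using hom that by (auto simp: hom_def units_of_def sym_group_mult)
  have "chi d id \<otimes>\<^bsub>K\<^esub> chi d id = chi d id" using mult[OF id id] by simp
  then show one: "chi d id = \<one>\<^bsub>K\<^esub>"
    using unit[OF id] by (metis Units_closed Units_l_cancel one_closed r_one)
  show "chi d \<sigma> \<otimes>\<^bsub>K\<^esub> chi d (inv' \<sigma>) = \<one>\<^bsub>K\<^esub>" if "\<sigma> \<in> W d" for \<sigma>
    using mult[OF that inv[OF that]] one permutes_inv_o(1)[OF perm[OF that]] by simp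
qed

lemma char_mono:
  assumes "omega_invariant K W chi" "1 \<le> d" "d \<le> e" "\<sigma> \<in> W d"
  shows "\<sigma> \<in> W e \<and> chi e \<sigma> = chi d \<sigma>"
  using assms(3)
proof (induction e rule: dec_induct)
  case (step n)
  have "W n \<subseteq> W (Suc n)" "\<forall>\<sigma>\<in>W n. chi (Suc n) \<sigma> = chi n \<sigma>"
    using assms(1,2) step(1) unfolding omega_invariant_def by auto
  then show ?case using step by auto
qed (use assms in simp)

text \<open>The argument leaves level \<open>d\<close>: shifted permutations and their commutators
  live in larger groups. It is therefore run in the union of all levels, and the compatibility of
  the characters lets the result be read off at level \<open>d\<close>.\<close>

lemma char_square:
  assumes K: "cring K" and inv: "omega_invariant K W chi" and d: "d \<ge> 1" and \<sigma>: "\<sigma> \<in> W d"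
  shows "chi d \<sigma> \<otimes>\<^bsub>K\<^esub> chi d \<sigma> = \<one>\<^bsub>K\<^esub>"
proof -
  interpret cring K by (rule K)
  note hom = char_hom[OF K inv]
  define G where "G = (\<Union>d\<in>{1..}. W d)"
  \<comment> \<open>An element of the union has no preferred level, so the condition is imposed at
    every level that contains it. \<open>N_iff\<close> shows that a single level decides.\<close>
  define N where "N = {g \<in> G. \<forall>d\<ge>1. g \<in> W d \<longrightarrow> chi d g = \<one>\<^bsub>K\<^esub>}"
  have N_iff: "g \<in> N \<longleftrightarrow> chi d g = \<one>\<^bsub>K\<^esub>" if "d \<ge> 1" "g \<in> W d" for d g
  proof -
    have "chi e g = \<one>\<^bsub>K\<^esub> \<longleftrightarrow> chi d g = \<one>\<^bsub>K\<^esub>" if "e \<ge> 1" "g \<in> W e" for e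
      using char_mono[OF inv \<open>d \<ge> 1\<close> _ \<open>g \<in> W d\<close>, of e] char_mono[OF inv \<open>e \<ge> 1\<close> _ \<open>g \<in> W e\<close>, of d]
      by (metis nle_le)
    moreover have "g \<in> G" using that by (auto simp: G_def)
    ultimately show ?thesis
      unfolding N_def using that by blast
  qed
  have common: "\<exists>d\<ge>1. g \<in> W d \<and> h \<in> W d" if gh: "g \<in> G" "h \<in> G" for g h
  proof -
    obtain a b where "a \<ge> 1" "b \<ge> 1" "g \<in> W a" "h \<in> W b" using gh by (auto simp: G_def)
    then show ?thesis
      using char_mono[OF inv, of a "max a b" g] char_mono[OF inv, of b "max a b" h]
      by (intro exI[of _ "max a b"]) (simp add: le_max_iff_disj)
  qed
  have G_memI: "g \<in> G" if "d \<ge> 1" "g \<in> W d" for d g using that by (auto simp: G_def)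
  have om: "omega g \<in> W (Suc d) \<and> chi (Suc d) (omega g) = chi d g" if "d \<ge> 1" "g \<in> W d" for d g
    using inv that unfolding omega_invariant_def by blast
  have NG: "N \<subseteq> G" by (auto simp: N_def)
  have "omega_stable G N"
  proof
    fix g assume g: "g \<in> G"
    then obtain d where d: "d \<ge> 1" "g \<in> W d" by (auto simp: G_def)
    show "\<exists>d. g permutes {1..d}" using hom(1)[OF d] by blast
    show "omega g \<in> G" using om[OF d] G_memI[of "Suc d"] by simp
    show "omega g \<in> N \<longleftrightarrow> g \<in> N" using om[OF d] N_iff[OF d] N_iff[of "Suc d" "omega g"] by simp
  next
    fix g h assume "g \<in> G" "h \<in> G"
    then obtain d where d: "d \<ge> 1" "g \<in> W d" "h \<in> W d" using common by blast
    show "g \<circ> h \<in> G" using hom(3)[OF d] G_memI[OF d(1)] by blast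
    have mem: "inv' g \<in> W d" "inv' h \<in> W d" "g \<circ> h \<in> W d" "g \<circ> h \<circ> inv' g \<in> W d"
        "g \<circ> h \<circ> inv' g \<circ> inv' h \<in> W d"
      by (intro hom(3,4) d)+
    have cl: "chi d g \<in> carrier K" "chi d h \<in> carrier K" "chi d (inv' g) \<in> carrier K"
        "chi d (inv' h) \<in> carrier K"
      by (intro Units_closed hom(5)[OF d(1)] d mem)+
    have "chi d (g \<circ> h \<circ> inv' g \<circ> inv' h) =
        chi d g \<otimes>\<^bsub>K\<^esub> chi d h \<otimes>\<^bsub>K\<^esub> chi d (inv' g) \<otimes>\<^bsub>K\<^esub> chi d (inv' h)"
      using hom(6)[OF d(1)] mem d by metis
    also have "\<dots> =
        (chi d g \<otimes>\<^bsub>K\<^esub> chi d (inv' g)) \<otimes>\<^bsub>K\<^esub> (chi d h \<otimes>\<^bsub>K\<^esub> chi d (inv' h))"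
      using cl by (simp add: m_ac)
    finally show "g \<circ> h \<circ> inv' g \<circ> inv' h \<in> N"
      using N_iff[OF d(1) mem(5)] hom(8)[OF d(1)] d by simp
  next
    show "N \<subseteq> G" by (rule NG)
    show "id \<in> N" using N_iff[of 1 id] hom(2)[of 1] hom(7)[of 1] by simp
  next
    fix g h assume gh: "g \<in> N" "h \<in> N"
    then obtain d where d: "d \<ge> 1" "g \<in> W d" "h \<in> W d" using common NG by blast
    then show "g \<circ> h \<in> N"
      using gh N_iff[OF d(1)] hom(3)[OF d(1)] hom(6)[OF d(1)] by simp
  next
    fix g h assume gh: "g \<in> G" "h \<in> N"
    then obtain d where d: "d \<ge> 1" "g \<in> W d" "h \<in> W d" using common NG by blast
    have mem: "inv' g \<in> W d" "g \<circ> h \<in> W d" "g \<circ> h \<circ> inv' g \<in> W d"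
      by (intro hom(3,4) d)+
    have "chi d (g \<circ> h \<circ> inv' g) = chi d g \<otimes>\<^bsub>K\<^esub> chi d h \<otimes>\<^bsub>K\<^esub> chi d (inv' g)"
      using hom(6)[OF d(1)] mem d by metis
    then show "g \<circ> h \<circ> inv' g \<in> N"
      using N_iff[OF d(1)] gh d mem hom(5)[OF d(1)] hom(8)[OF d(1)] by (simp add: Units_closed)
  qed
  then interpret omega_stable G N .
  have "\<sigma> \<circ> \<sigma> \<in> N" using square_in_N G_memI[OF d \<sigma>] by simp
  then show ?thesis using N_iff[OF d hom(3)[OF d \<sigma> \<sigma>]] hom(6)[OF d \<sigma> \<sigma>] by simp
qed

section \<open>Modules and linear maps\<close>

lemma module_abelian_group: "module K M \<Longrightarrow> abelian_group M"
  by (simp add: module_def)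

lemma lin_maps_closed: "f \<in> lin_maps K M N \<Longrightarrow> x \<in> carrier M \<Longrightarrow> f x \<in> carrier N"
  by (auto simp: lin_maps_def)

lemma lin_maps_add:
  "f \<in> lin_maps K M N \<Longrightarrow> x \<in> carrier M \<Longrightarrow> y \<in> carrier M \<Longrightarrow> f (x \<oplus>\<^bsub>M\<^esub> y) = f x \<oplus>\<^bsub>N\<^esub> f y"
  by (auto simp: lin_maps_def)

lemma lin_maps_smult:
  "f \<in> lin_maps K M N \<Longrightarrow> a \<in> carrier K \<Longrightarrow> x \<in> carrier M \<Longrightarrow> f (a \<odot>\<^bsub>M\<^esub> x) = a \<odot>\<^bsub>N\<^esub> f x"
  by (auto simp: lin_maps_def)

lemma lin_maps_restrictI:
  assumes "module K M"
    and "\<And>x. x \<in> carrier M \<Longrightarrow> f x \<in> carrier N"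
    and "\<And>x y. x \<in> carrier M \<Longrightarrow> y \<in> carrier M \<Longrightarrow> f (x \<oplus>\<^bsub>M\<^esub> y) = f x \<oplus>\<^bsub>N\<^esub> f y"
    and "\<And>a x. a \<in> carrier K \<Longrightarrow> x \<in> carrier M \<Longrightarrow> f (a \<odot>\<^bsub>M\<^esub> x) = a \<odot>\<^bsub>N\<^esub> f x"
  shows "restrict f (carrier M) \<in> lin_maps K M N"
proof -
  interpret module K M by fact
  show ?thesis using assms(2-) by (auto simp: lin_maps_def)
qed

lemma lin_maps_ext:
  assumes "f \<in> lin_maps K M N" "g \<in> lin_maps K M N" "\<And>x. x \<in> carrier M \<Longrightarrow> f x = g x"
  shows "f = g"
  using assms by (intro PiE_ext[of f "carrier M" "\<lambda>_. carrier N" g]) (auto simp: lin_maps_def)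

lemma lin_maps_compose:
  assumes "module K M" "f \<in> lin_maps K M N" "g \<in> lin_maps K N P"
  shows "(\<lambda>x\<in>carrier M. g (f x)) \<in> lin_maps K M P"
  using assms
  by (intro lin_maps_restrictI) (simp_all add: lin_maps_closed lin_maps_add lin_maps_smult)

lemma lin_maps_zero:
  assumes "module K M" "module K N" "f \<in> lin_maps K M N"
  shows "f \<zero>\<^bsub>M\<^esub> = \<zero>\<^bsub>N\<^esub>"
proof -
  interpret M: module K M by fact
  interpret N: module K N by fact
  have "f (\<zero>\<^bsub>K\<^esub> \<odot>\<^bsub>M\<^esub> \<zero>\<^bsub>M\<^esub>) = \<zero>\<^bsub>K\<^esub> \<odot>\<^bsub>N\<^esub> f \<zero>\<^bsub>M\<^esub>"
    by (rule lin_maps_smult[OF assms(3)]) simp_all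
  then show ?thesis using lin_maps_closed[OF assms(3)] by simp
qed

lemma lin_maps_minus:
  assumes "module K M" "module K N" "f \<in> lin_maps K M N" "x \<in> carrier M" "y \<in> carrier M"
  shows "f (x \<ominus>\<^bsub>M\<^esub> y) = f x \<ominus>\<^bsub>N\<^esub> f y"
proof -
  interpret M: module K M by fact
  interpret N: module K N by fact
  have "f (x \<ominus>\<^bsub>M\<^esub> y) \<oplus>\<^bsub>N\<^esub> f y = f (x \<ominus>\<^bsub>M\<^esub> y \<oplus>\<^bsub>M\<^esub> y)"
    using assms by (simp add: lin_maps_add)
  also have "x \<ominus>\<^bsub>M\<^esub> y \<oplus>\<^bsub>M\<^esub> y = x"
    using assms by (simp add: a_minus_def M.a_assoc M.l_neg)
  finally show ?thesis
    using assms lin_maps_closed[OF assms(3)] by (simp add: a_minus_def N.add.inv_solve_right)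
qed

lemma lin_maps_finsum:
  assumes "module K M" "module K N" "f \<in> lin_maps K M N" "finite A" "g \<in> A \<rightarrow> carrier M"
  shows "f (\<Oplus>\<^bsub>M\<^esub>a\<in>A. g a) = (\<Oplus>\<^bsub>N\<^esub>a\<in>A. f (g a))"
proof -
  interpret M: module K M by fact
  interpret N: module K N by fact
  show ?thesis
    using assms(4,5)
  proof (induction A rule: finite_induct)
    case empty
    then show ?case using lin_maps_zero[OF assms(1-3)] by simp
  next
    case (insert a A)
    then show ?case
      using lin_maps_add[OF assms(3)] lin_maps_closed[OF assms(3)] by (simp add: Pi_def)
  qed
qed

text \<open>Equalizers serve twice: linear maps that agree on generators agree everywhere, and, with
  the zero map as \<open>g\<close>, a map that kills relators kills the submodule generated by
  them.\<close>

lemma submodule_of_lin_eq: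
  assumes "module K M" "module K N" "f \<in> lin_maps K M N" "g \<in> lin_maps K M N"
  shows "submodule {x \<in> carrier M. f x = g x} K M"
proof -
  interpret M: module K M by fact
  interpret N: module K N by fact
  have inv: "h (\<ominus>\<^bsub>M\<^esub> x) = \<ominus>\<^bsub>N\<^esub> h x" if "h \<in> lin_maps K M N" "x \<in> carrier M" for h x
    using lin_maps_minus[OF assms(1,2) that(1) _ that(2), of "\<zero>\<^bsub>M\<^esub>"] that
      lin_maps_zero[OF assms(1,2) that(1)] lin_maps_closed[OF that]
    by (simp add: a_minus_def)
  note fg = lin_maps_add[OF assms(3)] lin_maps_add[OF assms(4)] lin_maps_smult[OF assms(3)]
    lin_maps_smult[OF assms(4)] inv[OF assms(3)] inv[OF assms(4)]
    lin_maps_zero[OF assms(1-3)] lin_maps_zero[OF assms(1,2,4)]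
  show ?thesis
    by (rule M.submoduleI) (auto simp: fg)
qed

subsection \<open>Generating sets\<close>

text \<open>Phrased through submodules instead of linear combinations, so that it applies directly
  to equalizers and matches the intersection in \<open>gen_submodule\<close>.\<close>

definition generates :: "('k, 'r) ring_scheme \<Rightarrow> ('k, 'a, 'm) module_scheme \<Rightarrow> 'a set \<Rightarrow> bool" where
  "generates K M S \<longleftrightarrow>
     S \<subseteq> carrier M \<and> (\<forall>N. submodule N K M \<longrightarrow> S \<subseteq> N \<longrightarrow> carrier M \<subseteq> N)"

lemma generatesD:
  assumes "generates K M S" "submodule N K M" "S \<subseteq> N"
  shows "carrier M \<subseteq> N"
  using assms by (simp add: generates_def)

lemma generates_lin_eq:
  assumes "module K M" "module K N" "generates K M S"
    and "f \<in> lin_maps K M N" "g \<in> lin_maps K M N" "\<And>x. x \<in> S \<Longrightarrow> f x = g x"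
  shows "f = g"
proof (rule lin_maps_ext[OF assms(4,5)])
  have "carrier M \<subseteq> {x \<in> carrier M. f x = g x}"
    using assms by (intro generatesD[OF assms(3) submodule_of_lin_eq]) (auto simp: generates_def)
  then show "f x = g x" if "x \<in> carrier M" for x using that by blast
qed

text \<open>Replaces the definite description by a map already constructed from a universal
  property. Every value of a \<open>lin_ext\<close> below is obtained in this way.\<close>

lemma lin_ext_eq:
  assumes "module K M" "module K N" "generates K M (g ` A)"
    and "f \<in> lin_maps K M N" "\<And>a. a \<in> A \<Longrightarrow> f (g a) = h a"
  shows "lin_ext K M N A g h = f"
  unfolding lin_ext_def
  using assms by (intro the_equality) (auto intro!: generates_lin_eq[OF assms(1-3)])

lemma submodule_zero: "submodule N K M \<Longrightarrow> \<zero>\<^bsub>M\<^esub> \<in> N"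
  using subgroup.one_closed[OF submodule.axioms(1), of N K M] by simp

lemma gen_submodule_submodule:
  assumes "module K M" "S \<subseteq> carrier M"
  shows "submodule (gen_submodule K M S) K M"
proof -
  interpret M: module K M by fact
  have "gen_submodule K M S \<subseteq> carrier M"
    using M.carrier_is_submodule assms(2) by (auto simp: gen_submodule_def)
  then show ?thesis
    unfolding gen_submodule_def
    by (rule M.submoduleI) (auto intro: submodule_zero M.submoduleE(3,5) submodule.smult_closed)
qed

lemma gen_submodule_incl: "S \<subseteq> gen_submodule K M S"
  by (auto simp: gen_submodule_def)

lemma gen_submodule_least: "submodule N K M \<Longrightarrow> S \<subseteq> N \<Longrightarrow> gen_submodule K M S \<subseteq> N"
  by (auto simp: gen_submodule_def)

subsection \<open>Quotients\<close>

context
  fixes K :: "('k, 'r) ring_scheme" and M :: "('k, 'a, 'm) module_scheme" and N :: "'a set"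
  assumes M: "module K M" and N: "submodule N K M"
begin

interpretation M: module K M by (rule M)

lemma submodule_abelian_subgroup: "abelian_subgroup N M"
  using submodule.axioms(1)[OF N] M.abelian_group_axioms
  by (simp add: abelian_subgroupI3 additive_subgroup_def)

interpretation N: abelian_subgroup N M by (rule submodule_abelian_subgroup)

lemma quot_carrier: "carrier (quot_module M N) = (\<lambda>x. N +>\<^bsub>M\<^esub> x) ` carrier M"
  by (auto simp: quot_module_def A_RCOSETS_def')

lemma quot_zero: "\<zero>\<^bsub>quot_module M N\<^esub> = N"
  by (simp add: quot_module_def)

lemma quot_add:
  assumes "x \<in> carrier M" "y \<in> carrier M"
  shows "(N +>\<^bsub>M\<^esub> x) \<oplus>\<^bsub>quot_module M N\<^esub> (N +>\<^bsub>M\<^esub> y) = N +>\<^bsub>M\<^esub> (x \<oplus>\<^bsub>M\<^esub> y)"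
  using N.a_rcos_sum[OF assms] by (simp add: quot_module_def)

lemma coset_eq_iff:
  assumes "x \<in> carrier M" "y \<in> carrier M"
  shows "N +>\<^bsub>M\<^esub> x = N +>\<^bsub>M\<^esub> y \<longleftrightarrow> x \<ominus>\<^bsub>M\<^esub> y \<in> N"
proof -
  have "N +>\<^bsub>M\<^esub> x = N +>\<^bsub>M\<^esub> y \<longleftrightarrow> x \<in> N +>\<^bsub>M\<^esub> y"
    using assms N.a_repr_independence'[of x y] N.a_repr_independenceD[of x y] by metis
  then show ?thesis using N.a_rcos_module[OF assms(2,1)] by (simp add: a_minus_def)
qed

text \<open>The union in \<open>quot_module\<close> runs over all representatives. It is a union of
  one repeated coset, because \<open>N\<close> is closed under scalars.\<close>

lemma quot_smult:
  assumes "a \<in> carrier K" "x \<in> carrier M"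
  shows "a \<odot>\<^bsub>quot_module M N\<^esub> (N +>\<^bsub>M\<^esub> x) = N +>\<^bsub>M\<^esub> (a \<odot>\<^bsub>M\<^esub> x)"
proof -
  have "N +>\<^bsub>M\<^esub> (a \<odot>\<^bsub>M\<^esub> y) = N +>\<^bsub>M\<^esub> (a \<odot>\<^bsub>M\<^esub> x)" if "y \<in> N +>\<^bsub>M\<^esub> x" for y
  proof -
    have y: "y \<in> carrier M" using N.a_elemrcos_carrier[OF assms(2) that] .
    then have "y \<ominus>\<^bsub>M\<^esub> x \<in> N"
      using N.a_repr_independence'[OF that assms(2)] coset_eq_iff[OF y assms(2)] by simp
    then have "a \<odot>\<^bsub>M\<^esub> (y \<ominus>\<^bsub>M\<^esub> x) \<in> N" using submodule.smult_closed[OF N] assms by simp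
    then show ?thesis
      using y assms by (simp add: coset_eq_iff a_minus_def M.smult_r_distr M.smult_r_minus)
  qed
  then have "(\<Union>y\<in>N +>\<^bsub>M\<^esub> x. N +>\<^bsub>M\<^esub> (a \<odot>\<^bsub>M\<^esub> y)) = (\<Union>y\<in>N +>\<^bsub>M\<^esub> x. N +>\<^bsub>M\<^esub> (a \<odot>\<^bsub>M\<^esub> x))"
    by (rule SUP_cong[OF refl])
  moreover have "x \<in> N +>\<^bsub>M\<^esub> x" using N.a_rcos_self assms by simp
  ultimately show ?thesis unfolding quot_module_def by (auto simp del: UN_simps)
qed

lemma quot_is_module: "module K (quot_module M N)"
proof (rule moduleI)
  let ?Q = "quot_module M N"
  note q = quot_carrier quot_add quot_smult quot_zero
  have Nz: "N = N +>\<^bsub>M\<^esub> \<zero>\<^bsub>M\<^esub>" using N.a_subset by simp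
  show "cring K" by unfold_locales
  show "abelian_group ?Q"
  proof (rule abelian_groupI)
    show "\<zero>\<^bsub>?Q\<^esub> \<in> carrier ?Q" unfolding q using Nz by blast
    show "\<exists>y\<in>carrier ?Q. y \<oplus>\<^bsub>?Q\<^esub> x = \<zero>\<^bsub>?Q\<^esub>" if x: "x \<in> carrier ?Q" for x
    proof -
      obtain u where u: "u \<in> carrier M" "x = N +>\<^bsub>M\<^esub> u" using x by (auto simp: q)
      then have "(N +>\<^bsub>M\<^esub> (\<ominus>\<^bsub>M\<^esub> u)) \<oplus>\<^bsub>?Q\<^esub> x = \<zero>\<^bsub>?Q\<^esub>"
        by (simp add: q M.l_neg Nz[symmetric])
      then show ?thesis using u by (auto simp: q)
    qed
    show "\<zero>\<^bsub>?Q\<^esub> \<oplus>\<^bsub>?Q\<^esub> x = x" if x: "x \<in> carrier ?Q" for x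
    proof -
      obtain u where u: "u \<in> carrier M" "x = N +>\<^bsub>M\<^esub> u" using x by (auto simp: q)
      have "(N +>\<^bsub>M\<^esub> \<zero>\<^bsub>M\<^esub>) \<oplus>\<^bsub>?Q\<^esub> x = x" using u by (simp add: quot_add del: M.a_coset_add_zero)
      then show ?thesis using Nz quot_zero by simp
    qed
  qed (auto simp: quot_carrier quot_add M.a_ac)
qed (auto simp: quot_carrier quot_add quot_smult M.smult_l_distr M.smult_r_distr M.smult_assoc1)

lemma quot_generates:
  assumes "generates K M S"
  shows "generates K (quot_module M N) ((\<lambda>x. N +>\<^bsub>M\<^esub> x) ` S)"
proof -
  interpret Q: module K "quot_module M N" by (rule quot_is_module)
  have "carrier (quot_module M N) \<subseteq> P"
    if P: "submodule P K (quot_module M N)" "(\<lambda>x. N +>\<^bsub>M\<^esub> x) ` S \<subseteq> P" for P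
  proof -
    have inv: "N +>\<^bsub>M\<^esub> (\<ominus>\<^bsub>M\<^esub> x) = \<ominus>\<^bsub>quot_module M N\<^esub> (N +>\<^bsub>M\<^esub> x)" if "x \<in> carrier M" for x
    proof -
      have "N +>\<^bsub>M\<^esub> ((\<ominus>\<^bsub>K\<^esub> \<one>\<^bsub>K\<^esub>) \<odot>\<^bsub>M\<^esub> x) = (\<ominus>\<^bsub>K\<^esub> \<one>\<^bsub>K\<^esub>) \<odot>\<^bsub>quot_module M N\<^esub> (N +>\<^bsub>M\<^esub> x)"
        using that by (simp add: quot_smult)
      moreover have "N +>\<^bsub>M\<^esub> x \<in> carrier (quot_module M N)" using that quot_carrier by blast
      ultimately show ?thesis using that by (simp add: M.smult_l_minus Q.smult_l_minus)
    qed
    have "submodule {x \<in> carrier M. N +>\<^bsub>M\<^esub> x \<in> P} K M"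
    proof (rule M.submoduleI)
      show "\<zero>\<^bsub>M\<^esub> \<in> {x \<in> carrier M. N +>\<^bsub>M\<^esub> x \<in> P}"
        using N.a_subset subgroup.one_closed[OF submodule.axioms(1)[OF P(1)]] quot_zero by simp
    qed (use Q.submoduleE[OF P(1)] in \<open>auto simp: inv quot_add[symmetric] quot_smult[symmetric]\<close>)
    then have "carrier M \<subseteq> {x \<in> carrier M. N +>\<^bsub>M\<^esub> x \<in> P}"
      using assms P(2) by (intro generatesD[OF assms]) (auto simp: generates_def)
    then show ?thesis by (auto simp: quot_carrier)
  qed
  then show ?thesis
    using assms by (auto simp: generates_def quot_carrier)
qed

text \<open>Representatives of one coset differ by an element of \<open>N\<close>, where
  \<open>f\<close> vanishes, so evaluating \<open>f\<close> at a chosen representative does not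
  depend on the choice.\<close>

lemma quot_factor:
  assumes P: "module K P" and f: "f \<in> lin_maps K M P" and z: "\<And>x. x \<in> N \<Longrightarrow> f x = \<zero>\<^bsub>P\<^esub>"
  shows "\<exists>g \<in> lin_maps K (quot_module M N) P. \<forall>x\<in>carrier M. g (N +>\<^bsub>M\<^esub> x) = f x"
proof -
  interpret P: module K P by fact
  define g where "g = (\<lambda>C\<in>carrier (quot_module M N). f (SOME x. x \<in> carrier M \<and> C = N +>\<^bsub>M\<^esub> x))"
  have g: "g (N +>\<^bsub>M\<^esub> x) = f x" if x: "x \<in> carrier M" for x
  proof -
    define y where "y = (SOME y. y \<in> carrier M \<and> N +>\<^bsub>M\<^esub> x = N +>\<^bsub>M\<^esub> y)"
    have y: "y \<in> carrier M \<and> N +>\<^bsub>M\<^esub> x = N +>\<^bsub>M\<^esub> y"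
      unfolding y_def by (rule someI[of _ x]) (use x in simp)
    then have "f (x \<ominus>\<^bsub>M\<^esub> y) = \<zero>\<^bsub>P\<^esub>" using coset_eq_iff x z by blast
    then have "f x = f y"
      using lin_maps_minus[OF M P f, of x y] x y lin_maps_closed[OF f]
      by (metis P.add.inv_closed P.minus_equality P.minus_minus a_minus_def)
    then show ?thesis using x by (simp add: g_def quot_carrier y_def)
  qed
  have "g \<in> extensional (carrier (quot_module M N))" by (simp add: g_def)
  then have "g \<in> lin_maps K (quot_module M N) P"
    using lin_maps_closed[OF f] lin_maps_add[OF f] lin_maps_smult[OF f]
    by (auto simp: lin_maps_def PiE_def quot_carrier quot_add quot_smult g)
  then show ?thesis using g by blast
qed

end

subsection \<open>The ring as a module, duals and direct sums\<close>

lemma ring_module_simps [simp]: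
  "carrier (ring_module K) = carrier K" "\<zero>\<^bsub>ring_module K\<^esub> = \<zero>\<^bsub>K\<^esub>"
  "x \<oplus>\<^bsub>ring_module K\<^esub> y = x \<oplus>\<^bsub>K\<^esub> y" "x \<odot>\<^bsub>ring_module K\<^esub> y = x \<otimes>\<^bsub>K\<^esub> y"
  by (simp_all add: ring_module_def)

text \<open>Sums read only the carrier, zero and addition, which the two records share. Sums taken
  in \<open>K\<close> as a module over itself thereby become sums in \<open>K\<close>.\<close>

lemma finsum_ring_module [simp]: "finsum (ring_module K) = finsum K"
  by (simp add: fun_eq_iff finsum_def finprod_def ring_module_def)

lemma ring_module_is_module:
  assumes "cring K"
  shows "module K (ring_module K)"
proof -
  interpret cring K by fact
  show ?thesis
    by (intro moduleI abelian_groupI)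
      (auto simp: a_ac m_ac l_distr r_distr intro: cring_axioms bexI[of _ "\<ominus>\<^bsub>K\<^esub> x" for x] l_neg)
qed

lemma dual_simps:
  "carrier (dual K M) = lin_maps K M (ring_module K)"
  "\<zero>\<^bsub>dual K M\<^esub> = (\<lambda>x\<in>carrier M. \<zero>\<^bsub>K\<^esub>)"
  "f \<oplus>\<^bsub>dual K M\<^esub> g = (\<lambda>x\<in>carrier M. f x \<oplus>\<^bsub>K\<^esub> g x)"
  "a \<odot>\<^bsub>dual K M\<^esub> f = (\<lambda>x\<in>carrier M. a \<otimes>\<^bsub>K\<^esub> f x)"
  by (simp_all add: dual_def)

lemma dual_closed: "f \<in> carrier (dual K M) \<Longrightarrow> x \<in> carrier M \<Longrightarrow> f x \<in> carrier K"
  using lin_maps_closed[of f K M "ring_module K"] by (simp add: dual_simps)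

lemma dual_is_module:
  assumes M: "module K M"
  shows "module K (dual K M)"
proof -
  interpret M: module K M by fact
  let ?R = "ring_module K"
  note c = lin_maps_closed[where N = ?R, simplified] lin_maps_add[where N = ?R, simplified]
    lin_maps_smult[where N = ?R, simplified]
  have E: "f \<in> lin_maps K M ?R \<Longrightarrow> f \<in> extensional (carrier M)" for f
    by (auto simp: lin_maps_def PiE_def)
  have cl: "(\<lambda>x\<in>carrier M. f x \<oplus>\<^bsub>K\<^esub> g x) \<in> lin_maps K M ?R"
    if "f \<in> lin_maps K M ?R" "g \<in> lin_maps K M ?R" for f g
    using that by (intro lin_maps_restrictI M) (simp_all add: c M.R.a_ac M.R.r_distr)
  have cs: "(\<lambda>x\<in>carrier M. a \<otimes>\<^bsub>K\<^esub> f x) \<in> lin_maps K M ?R"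
    if "f \<in> lin_maps K M ?R" "a \<in> carrier K" for f a
    using that by (intro lin_maps_restrictI M) (simp_all add: c M.R.m_ac M.R.r_distr)
  have cz: "(\<lambda>x\<in>carrier M. \<zero>\<^bsub>K\<^esub>) \<in> lin_maps K M ?R"
    by (intro lin_maps_restrictI M) simp_all
  show ?thesis
  proof (intro moduleI abelian_groupI)
    fix f assume f: "f \<in> carrier (dual K M)"
    \<comment> \<open>The additive inverse is produced as the scalar multiple by -1, whose linearity
      is already known from \<open>cs\<close>.\<close>
    have "(\<lambda>x\<in>carrier M. (\<ominus>\<^bsub>K\<^esub> \<one>\<^bsub>K\<^esub>) \<otimes>\<^bsub>K\<^esub> f x) \<in> carrier (dual K M)"
      using f by (simp add: dual_simps cs)
    moreover have "(\<lambda>x\<in>carrier M. (\<ominus>\<^bsub>K\<^esub> \<one>\<^bsub>K\<^esub>) \<otimes>\<^bsub>K\<^esub> f x) \<oplus>\<^bsub>dual K M\<^esub> f = \<zero>\<^bsub>dual K M\<^esub>"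
      using f by (auto simp: dual_simps c fun_eq_iff M.R.l_minus M.R.l_neg)
    ultimately show "\<exists>g\<in>carrier (dual K M). g \<oplus>\<^bsub>dual K M\<^esub> f = \<zero>\<^bsub>dual K M\<^esub>" by blast
  next
    show "cring K" by unfold_locales
  qed (auto simp: dual_simps cl cs cz c M.R.a_ac M.R.m_ac M.R.l_distr M.R.r_distr
      intro!: restrict_ext extensionalityI[OF restrict_extensional E])
qed

lemma dsum_simps:
  "carrier (dsum I M) = {f \<in> \<Pi>\<^sub>E i\<in>I. carrier (M i). finite {i\<in>I. f i \<noteq> \<zero>\<^bsub>M i\<^esub>}}"
  "\<zero>\<^bsub>dsum I M\<^esub> = (\<lambda>i\<in>I. \<zero>\<^bsub>M i\<^esub>)"
  "f \<oplus>\<^bsub>dsum I M\<^esub> g = (\<lambda>i\<in>I. f i \<oplus>\<^bsub>M i\<^esub> g i)"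
  "a \<odot>\<^bsub>dsum I M\<^esub> f = (\<lambda>i\<in>I. a \<odot>\<^bsub>M i\<^esub> f i)"
  by (simp_all add: dsum_def)

lemma dsum_carrierI:
  assumes "\<And>i. i \<in> I \<Longrightarrow> f i \<in> carrier (M i)" "\<And>i. i \<notin> I \<Longrightarrow> f i = undefined"
    and "finite {i\<in>I. f i \<noteq> \<zero>\<^bsub>M i\<^esub>}"
  shows "f \<in> carrier (dsum I M)"
  using assms by (auto simp: dsum_simps PiE_def extensional_def)

lemma dsum_mem: "f \<in> carrier (dsum I M) \<Longrightarrow> i \<in> I \<Longrightarrow> f i \<in> carrier (M i)"
  by (auto simp: dsum_simps)

lemma dsum_extensional: "f \<in> carrier (dsum I M) \<Longrightarrow> f \<in> extensional I"
  by (auto simp: dsum_simps PiE_def)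

lemma dsum_is_module:
  assumes "cring K" and M: "\<And>i. i \<in> I \<Longrightarrow> module K (M i)"
  shows "module K (dsum I M)"
proof -
  interpret K: cring K by fact
  have ab: "abelian_group (M i)" if "i \<in> I" for i
    using M[OF that] by (rule module_abelian_group)
  note am = abelian_group.axioms(1)[OF ab]
  note ag = abelian_monoid.a_closed[OF am] abelian_monoid.l_zero[OF am]
    abelian_monoid.r_zero[OF am] abelian_monoid.a_ac[OF am] abelian_monoid.zero_closed[OF am]
    module.smult_closed[OF M] module.smult_l_distr[OF M] module.smult_r_distr[OF M]
    module.smult_assoc1[OF M] module.smult_one[OF M] module.smult_r_null[OF M]
    module.smult_l_null[OF M]
  show ?thesis
  proof (intro moduleI abelian_groupI)
    fix f g assume f: "f \<in> carrier (dsum I M)" and g: "g \<in> carrier (dsum I M)"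
    then have "finite ({i\<in>I. f i \<noteq> \<zero>\<^bsub>M i\<^esub>} \<union> {i\<in>I. g i \<noteq> \<zero>\<^bsub>M i\<^esub>})"
      by (auto simp: dsum_simps)
    then have "finite {i\<in>I. (f \<oplus>\<^bsub>dsum I M\<^esub> g) i \<noteq> \<zero>\<^bsub>M i\<^esub>}"
      by (rule rev_finite_subset) (auto simp: dsum_simps ag)
    then show "f \<oplus>\<^bsub>dsum I M\<^esub> g \<in> carrier (dsum I M)"
      using dsum_mem[OF f] dsum_mem[OF g]
      by (intro dsum_carrierI) (simp_all add: dsum_simps(3) ag)
  next
    have sm: "a \<odot>\<^bsub>dsum I M\<^esub> f \<in> carrier (dsum I M)"
      if a: "a \<in> carrier K" and f: "f \<in> carrier (dsum I M)" for a f
    proof -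
      have "finite {i\<in>I. (a \<odot>\<^bsub>dsum I M\<^esub> f) i \<noteq> \<zero>\<^bsub>M i\<^esub>}"
      proof (rule finite_subset)
        show "{i\<in>I. (a \<odot>\<^bsub>dsum I M\<^esub> f) i \<noteq> \<zero>\<^bsub>M i\<^esub>} \<subseteq> {i\<in>I. f i \<noteq> \<zero>\<^bsub>M i\<^esub>}"
          by (auto simp: dsum_simps(4) ag a)
        show "finite {i\<in>I. f i \<noteq> \<zero>\<^bsub>M i\<^esub>}" using f by (simp add: dsum_simps)
      qed
      then show ?thesis
        using a dsum_mem[OF f] by (intro dsum_carrierI) (simp_all add: dsum_simps(4) ag)
    qed
    then show "a \<odot>\<^bsub>dsum I M\<^esub> f \<in> carrier (dsum I M)"
      if "a \<in> carrier K" and "f \<in> carrier (dsum I M)" for a f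
      using that by blast
    fix f assume f: "f \<in> carrier (dsum I M)"
    have "((\<ominus>\<^bsub>K\<^esub> \<one>\<^bsub>K\<^esub>) \<odot>\<^bsub>M i\<^esub> f i) \<oplus>\<^bsub>M i\<^esub> f i = \<zero>\<^bsub>M i\<^esub>" if "i \<in> I" for i
    proof -
      interpret Mi: module K "M i" using M that .
      show ?thesis using dsum_mem[OF f that] by (simp add: Mi.smult_l_minus Mi.l_neg)
    qed
    then have "(\<ominus>\<^bsub>K\<^esub> \<one>\<^bsub>K\<^esub>) \<odot>\<^bsub>dsum I M\<^esub> f \<oplus>\<^bsub>dsum I M\<^esub> f = \<zero>\<^bsub>dsum I M\<^esub>"
      by (auto simp: dsum_simps fun_eq_iff)
    then show "\<exists>g\<in>carrier (dsum I M). g \<oplus>\<^bsub>dsum I M\<^esub> f = \<zero>\<^bsub>dsum I M\<^esub>"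
      using sm[of "\<ominus>\<^bsub>K\<^esub> \<one>\<^bsub>K\<^esub>" f] f by auto
  next
    show "cring K" by unfold_locales
  next
    show "\<zero>\<^bsub>dsum I M\<^esub> \<in> carrier (dsum I M)"
      by (intro dsum_carrierI) (auto simp: dsum_simps ag)
  qed (auto simp: dsum_simps(2-4) dsum_mem[where I = I and M = M] ag
      intro!: restrict_ext extensionalityI[OF restrict_extensional dsum_extensional])
qed

lemma dsum_inj_closed:
  assumes "\<And>j. j \<in> I \<Longrightarrow> module K (M j)" "i \<in> I" "x \<in> carrier (M i)"
  shows "dsum_inj I M i x \<in> carrier (dsum I M)"
proof (rule dsum_carrierI)
  show "finite {j \<in> I. dsum_inj I M i x j \<noteq> \<zero>\<^bsub>M j\<^esub>}"
    by (rule finite_subset[of _ "{i}"]) (auto simp: dsum_inj_def)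
  show "dsum_inj I M i x j \<in> carrier (M j)" if "j \<in> I" for j
  proof -
    interpret module K "M j" using assms that by blast
    show ?thesis using assms that by (auto simp: dsum_inj_def)
  qed
qed (simp add: dsum_inj_def)

subsection \<open>Free modules\<close>

lemma free_is_module: "cring K \<Longrightarrow> module K (free_module K S)"
  unfolding free_module_def by (intro dsum_is_module ring_module_is_module)

lemma free_gen_closed: "cring K \<Longrightarrow> x \<in> S \<Longrightarrow> free_gen K S x \<in> carrier (free_module K S)"
  unfolding free_module_def free_gen_def
  by (rule dsum_inj_closed[where K = K]) (simp_all add: ring_module_is_module cring.cring_simprules)

lemma free_gen_apply: "y \<in> S \<Longrightarrow> free_gen K S x y = (if y = x then \<one>\<^bsub>K\<^esub> else \<zero>\<^bsub>K\<^esub>)"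
  by (simp add: free_gen_def dsum_inj_def)

lemma free_generates:
  assumes K: "cring K"
  shows "generates K (free_module K S) (free_gen K S ` S)"
proof -
  let ?F = "free_module K S"
  interpret K: cring K by (rule K)
  interpret F: module K ?F by (rule free_is_module[OF K])
  have "carrier ?F \<subseteq> N" if N: "submodule N K ?F" "free_gen K S ` S \<subseteq> N" for N
  proof -
    \<comment> \<open>Induction on a finite set outside which \<open>f\<close> vanishes, not on the
      exact support: removing one coordinate then just shrinks this set.\<close>
    have *: "f \<in> N" if "finite A" "f \<in> carrier ?F" "\<And>x. x \<in> S - A \<Longrightarrow> f x = \<zero>\<^bsub>K\<^esub>" for A f
      using that
    proof (induction A arbitrary: f rule: finite_induct)
      case empty
      then have "f = \<zero>\<^bsub>?F\<^esub>"
        by (intro extensionalityI[of _ S]) (auto simp: free_module_def dsum_simps PiE_def)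
      then show ?case using submodule_zero[OF N(1)] by simp
    next
      case (insert x A)
      show ?case
      proof (cases "x \<in> S")
        case False
        then show ?thesis using insert.IH[OF insert.prems(1)] insert.prems(2) by blast
      next
        case True
        have fc: "f y \<in> carrier K" if "y \<in> S" for y
          using dsum_mem[of f S "\<lambda>_. ring_module K" y] insert.prems(1) that by (simp add: free_module_def)
        define f' where "f' = (\<lambda>y\<in>S. if y = x then \<zero>\<^bsub>K\<^esub> else f y)"
        have "{y \<in> S. f' y \<noteq> \<zero>\<^bsub>K\<^esub>} \<subseteq> {y \<in> S. f y \<noteq> \<zero>\<^bsub>K\<^esub>}"
          by (auto simp: f'_def)
        moreover have "finite {y \<in> S. f y \<noteq> \<zero>\<^bsub>K\<^esub>}"
          using insert.prems(1) by (simp add: free_module_def dsum_simps)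
        ultimately have "finite {y \<in> S. f' y \<noteq> \<zero>\<^bsub>K\<^esub>}" by (rule finite_subset)
        then have f': "f' \<in> carrier ?F"
          unfolding free_module_def by (intro dsum_carrierI) (auto simp: fc f'_def)
        have "f' \<in> N"
          by (rule insert.IH[OF f']) (use insert.prems(2) in \<open>auto simp: f'_def\<close>)
        moreover have "f x \<odot>\<^bsub>?F\<^esub> free_gen K S x \<in> N"
          using submodule.smult_closed[OF N(1) fc[OF True]] N(2) True by auto
        moreover have "f = f' \<oplus>\<^bsub>?F\<^esub> (f x \<odot>\<^bsub>?F\<^esub> free_gen K S x)"
          using insert.prems(1) fc True dsum_extensional[of f S]
          by (intro extensionalityI[of _ S])
            (auto simp: free_module_def dsum_simps(3,4) f'_def free_gen_apply)
        ultimately show ?thesis using F.submoduleE(5)[OF N(1)] by metis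
      qed
    qed
    show ?thesis
    proof
      fix f assume f: "f \<in> carrier ?F"
      then have "finite {x \<in> S. f x \<noteq> \<zero>\<^bsub>K\<^esub>}" by (simp add: free_module_def dsum_simps)
      from *[OF this f] show "f \<in> N" by blast
    qed
  qed
  then show ?thesis using free_gen_closed[OF K] by (auto simp: generates_def)
qed

lemma free_lift:
  assumes K: "cring K" and N: "module K N" and h: "\<And>x. x \<in> S \<Longrightarrow> h x \<in> carrier N"
  shows "\<exists>g \<in> lin_maps K (free_module K S) N. \<forall>x\<in>S. g (free_gen K S x) = h x"
proof -
  let ?F = "free_module K S"
  interpret N: module K N by (rule N)
  define supp where "supp f = {x \<in> S. f x \<noteq> \<zero>\<^bsub>K\<^esub>}" for f
  define g where "g = (\<lambda>f\<in>carrier ?F. \<Oplus>\<^bsub>N\<^esub>x\<in>supp f. f x \<odot>\<^bsub>N\<^esub> h x)"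
  have fc: "f x \<in> carrier K" if "f \<in> carrier ?F" "x \<in> S" for f x
    using dsum_mem[of f S "\<lambda>_. ring_module K" x] that by (simp add: free_module_def)
  have fin: "finite (supp f)" if "f \<in> carrier ?F" for f
    using that by (simp add: supp_def free_module_def dsum_simps)
  \<comment> \<open>Supports change under addition and scaling. Allowing any finite superset of the
    support lets all sums in the linearity proof run over a common index set.\<close>
  have geq: "g f = (\<Oplus>\<^bsub>N\<^esub>x\<in>A. f x \<odot>\<^bsub>N\<^esub> h x)"
    if "f \<in> carrier ?F" "finite A" "supp f \<subseteq> A" "A \<subseteq> S" for f A
  proof -
    have "(\<Oplus>\<^bsub>N\<^esub>x\<in>supp f. f x \<odot>\<^bsub>N\<^esub> h x) = (\<Oplus>\<^bsub>N\<^esub>x\<in>A. f x \<odot>\<^bsub>N\<^esub> h x)"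
      using that fc[OF that(1)] h
      by (intro N.add.finprod_mono_neutral_cong_left) (auto simp: supp_def)
    then show ?thesis using that(1) by (simp add: g_def)
  qed
  have sub: "supp f \<subseteq> S" for f by (auto simp: supp_def)
  have F: "module K ?F" by (rule free_is_module[OF K])
  interpret F: module K ?F by (rule F)
  have "restrict (\<lambda>f. \<Oplus>\<^bsub>N\<^esub>x\<in>supp f. f x \<odot>\<^bsub>N\<^esub> h x) (carrier ?F) \<in> lin_maps K ?F N"
  proof (rule lin_maps_restrictI[OF F])
    fix f assume f: "f \<in> carrier ?F"
    show "(\<Oplus>\<^bsub>N\<^esub>x\<in>supp f. f x \<odot>\<^bsub>N\<^esub> h x) \<in> carrier N"
      using fc[OF f] h sub[of f] by (intro N.finsum_closed) auto
    {
      fix f' assume f': "f' \<in> carrier ?F"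
      let ?A = "supp f \<union> supp f'"
      have A: "finite ?A" "?A \<subseteq> S" using fin f f' sub by auto
      have c: "x \<in> carrier K \<and> y \<in> carrier K \<and> z \<in> carrier N"
        if "a \<in> ?A" "x = f a" "y = f' a" "z = h a" for a x y z
        using that fc[OF f] fc[OF f'] h A by blast
      have "supp (f \<oplus>\<^bsub>?F\<^esub> f') \<subseteq> ?A"
        by (auto simp: supp_def free_module_def dsum_simps(3))
      then have "g (f \<oplus>\<^bsub>?F\<^esub> f') = (\<Oplus>\<^bsub>N\<^esub>x\<in>?A. (f \<oplus>\<^bsub>?F\<^esub> f') x \<odot>\<^bsub>N\<^esub> h x)"
        using f f' A by (intro geq) auto
      also have "\<dots> = (\<Oplus>\<^bsub>N\<^esub>x\<in>?A. f x \<odot>\<^bsub>N\<^esub> h x \<oplus>\<^bsub>N\<^esub> f' x \<odot>\<^bsub>N\<^esub> h x)"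
        using A c
        by (intro N.finsum_cong') (auto simp: free_module_def dsum_simps(3) N.smult_l_distr subset_iff)
      also have "\<dots> = (\<Oplus>\<^bsub>N\<^esub>x\<in>?A. f x \<odot>\<^bsub>N\<^esub> h x) \<oplus>\<^bsub>N\<^esub> (\<Oplus>\<^bsub>N\<^esub>x\<in>?A. f' x \<odot>\<^bsub>N\<^esub> h x)"
        using c by (intro N.finsum_addf) auto
      also have "\<dots> = g f \<oplus>\<^bsub>N\<^esub> g f'"
        using A f f' by (simp add: geq[OF f, of ?A] geq[OF f', of ?A])
      finally show "(\<Oplus>\<^bsub>N\<^esub>x\<in>supp (f \<oplus>\<^bsub>?F\<^esub> f'). (f \<oplus>\<^bsub>?F\<^esub> f') x \<odot>\<^bsub>N\<^esub> h x) =
          (\<Oplus>\<^bsub>N\<^esub>x\<in>supp f. f x \<odot>\<^bsub>N\<^esub> h x) \<oplus>\<^bsub>N\<^esub> (\<Oplus>\<^bsub>N\<^esub>x\<in>supp f'. f' x \<odot>\<^bsub>N\<^esub> h x)"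
        using f f' by (simp add: g_def)
    }
    {
      fix a assume a: "a \<in> carrier K"
      have "supp (a \<odot>\<^bsub>?F\<^esub> f) \<subseteq> supp f"
        using a by (auto simp: supp_def free_module_def dsum_simps(4))
      then have "g (a \<odot>\<^bsub>?F\<^esub> f) = (\<Oplus>\<^bsub>N\<^esub>x\<in>supp f. (a \<odot>\<^bsub>?F\<^esub> f) x \<odot>\<^bsub>N\<^esub> h x)"
        using f a sub fin by (intro geq) auto
      also have "\<dots> = (\<Oplus>\<^bsub>N\<^esub>x\<in>supp f. a \<odot>\<^bsub>N\<^esub> (f x \<odot>\<^bsub>N\<^esub> h x))"
        using a fc[OF f] h sub[of f]
        by (intro N.finsum_cong')
          (auto simp: free_module_def dsum_simps(4) N.smult_assoc1 subset_iff)
      also have "\<dots> = a \<odot>\<^bsub>N\<^esub> g f"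
        using a f fin fc[OF f] h sub[of f]
        by (simp add: g_def N.finsum_smult_ldistr Pi_def subset_iff)
      finally show "(\<Oplus>\<^bsub>N\<^esub>x\<in>supp (a \<odot>\<^bsub>?F\<^esub> f). (a \<odot>\<^bsub>?F\<^esub> f) x \<odot>\<^bsub>N\<^esub> h x) =
          a \<odot>\<^bsub>N\<^esub> (\<Oplus>\<^bsub>N\<^esub>x\<in>supp f. f x \<odot>\<^bsub>N\<^esub> h x)"
        using f a by (simp add: g_def)
    }
  qed
  moreover have "g (free_gen K S x) = h x" if x: "x \<in> S" for x
  proof -
    have "g (free_gen K S x) = (\<Oplus>\<^bsub>N\<^esub>y\<in>{x}. free_gen K S x y \<odot>\<^bsub>N\<^esub> h y)"
      using x by (intro geq free_gen_closed[OF K]) (auto simp: supp_def free_gen_apply split: if_splits)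
    then show ?thesis using x h by (simp add: free_gen_apply)
  qed
  ultimately show ?thesis unfolding g_def by blast
qed

subsection \<open>Multilinear maps and tensor powers\<close>

text \<open>The list updates mirror the relators in \<open>tensor_rels\<close>, so that each relator
  is killed by one rewrite in \<open>tensor_lift\<close>.\<close>

definition multilinear ::
  "('k, 'r) ring_scheme \<Rightarrow> nat \<Rightarrow> ('k, 'a, 'm) module_scheme \<Rightarrow> ('k, 'b, 'n) module_scheme
    \<Rightarrow> ('a list \<Rightarrow> 'b) \<Rightarrow> bool" where
  "multilinear K d M N f \<longleftrightarrow>
     (\<forall>xs\<in>words d M. f xs \<in> carrier N) \<and>
     (\<forall>xs\<in>words d M. \<forall>i<d. \<forall>x\<in>carrier M. \<forall>y\<in>carrier M.
        f (xs[i := x \<oplus>\<^bsub>M\<^esub> y]) = f (xs[i := x]) \<oplus>\<^bsub>N\<^esub> f (xs[i := y])) \<and>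
     (\<forall>xs\<in>words d M. \<forall>i<d. \<forall>a\<in>carrier K. \<forall>x\<in>carrier M.
        f (xs[i := a \<odot>\<^bsub>M\<^esub> x]) = a \<odot>\<^bsub>N\<^esub> f (xs[i := x]))"

lemma multilinearI:
  assumes "\<And>xs. xs \<in> words d M \<Longrightarrow> f xs \<in> carrier N"
    and "\<And>xs i x y. xs \<in> words d M \<Longrightarrow> i < d \<Longrightarrow> x \<in> carrier M \<Longrightarrow> y \<in> carrier M \<Longrightarrow>
        f (xs[i := x \<oplus>\<^bsub>M\<^esub> y]) = f (xs[i := x]) \<oplus>\<^bsub>N\<^esub> f (xs[i := y])"
    and "\<And>xs i a x. xs \<in> words d M \<Longrightarrow> i < d \<Longrightarrow> a \<in> carrier K \<Longrightarrow> x \<in> carrier M \<Longrightarrow>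
        f (xs[i := a \<odot>\<^bsub>M\<^esub> x]) = a \<odot>\<^bsub>N\<^esub> f (xs[i := x])"
  shows "multilinear K d M N f"
  using assms by (simp add: multilinear_def)

lemma multilinear_closed: "multilinear K d M N f \<Longrightarrow> xs \<in> words d M \<Longrightarrow> f xs \<in> carrier N"
  by (simp add: multilinear_def)

lemma multilinear_add:
  "multilinear K d M N f \<Longrightarrow> xs \<in> words d M \<Longrightarrow> i < d \<Longrightarrow> x \<in> carrier M \<Longrightarrow> y \<in> carrier M \<Longrightarrow>
    f (xs[i := x \<oplus>\<^bsub>M\<^esub> y]) = f (xs[i := x]) \<oplus>\<^bsub>N\<^esub> f (xs[i := y])"
  by (simp add: multilinear_def)

lemma multilinear_smult:
  "multilinear K d M N f \<Longrightarrow> xs \<in> words d M \<Longrightarrow> i < d \<Longrightarrow> a \<in> carrier K \<Longrightarrow> x \<in> carrier M \<Longrightarrow>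
    f (xs[i := a \<odot>\<^bsub>M\<^esub> x]) = a \<odot>\<^bsub>N\<^esub> f (xs[i := x])"
  by (simp add: multilinear_def)

lemma words_update: "xs \<in> words d M \<Longrightarrow> x \<in> carrier M \<Longrightarrow> xs[i := x] \<in> words d M"
  using set_update_subset_insert[of xs i x] by (auto simp: words_def)

lemma words_nth: "xs \<in> words d M \<Longrightarrow> i < d \<Longrightarrow> xs ! i \<in> carrier M"
  by (auto simp: words_def)

lemma words_length: "xs \<in> words d M \<Longrightarrow> length xs = d"
  by (simp add: words_def)

lemma multilinear_lin_comp:
  assumes "multilinear K d M N f" "g \<in> lin_maps K N P"
  shows "multilinear K d M P (\<lambda>xs. g (f xs))"
  using assms
  by (intro multilinearI)
    (simp_all add: multilinear_closed[OF assms(1)] multilinear_add[OF assms(1)] words_update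
      multilinear_smult[OF assms(1)] lin_maps_closed lin_maps_add lin_maps_smult)

lemma multilinear_slot:
  assumes "module K M" "multilinear K d M N f" "xs \<in> words d M" "i < d"
  shows "(\<lambda>x\<in>carrier M. f (xs[i := x])) \<in> lin_maps K M N"
  using assms
  by (intro lin_maps_restrictI)
    (simp_all add: multilinear_closed words_update multilinear_add multilinear_smult)

text \<open>Slot by slot: with the other slots frozen, both sides are linear in slot
  \<open>n\<close> and agree on generators. In the induction the slots from \<open>n\<close> on
  already hold generators.\<close>

lemma multilinear_eq:
  assumes M: "module K M" and N: "module K N" and f: "multilinear K d M N f" and g: "multilinear K d M N g"
    and S: "generates K M S"
    and eq: "\<And>xs. length xs = d \<Longrightarrow> set xs \<subseteq> S \<Longrightarrow> f xs = g xs"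
    and xs: "xs \<in> words d M"
  shows "f xs = g xs"
proof -
  have SM: "S \<subseteq> carrier M" using S by (simp add: generates_def)
  have "f xs = g xs" if "n \<le> d" "xs \<in> words d M" "\<forall>i\<in>{n..<d}. xs ! i \<in> S" for n xs
    using that
  proof (induction n arbitrary: xs)
    case 0
    then have "set xs \<subseteq> S" by (auto simp: words_def in_set_conv_nth)
    then show ?case using eq words_length[OF 0(2)] by blast
  next
    case (Suc n)
    let ?f = "\<lambda>x\<in>carrier M. f (xs[n := x])" and ?g = "\<lambda>x\<in>carrier M. g (xs[n := x])"
    have n: "n < d" and len: "length xs = d" using Suc.prems words_length by auto
    have "?f = ?g"
    proof (rule generates_lin_eq[OF M N S])
      show "?f \<in> lin_maps K M N" "?g \<in> lin_maps K M N"
        by (rule multilinear_slot[OF M _ Suc.prems(2) n], fact)+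
      fix x assume x: "x \<in> S"
      then have "f (xs[n := x]) = g (xs[n := x])"
        using Suc.prems n len SM
        by (intro Suc.IH) (auto simp: words_update nth_list_update)
      then show "?f x = ?g x" using x SM by auto
    qed
    from fun_cong[OF this, of "xs ! n"] show ?case
      using words_nth[OF Suc.prems(2) n] by simp
  qed
  from this[of d] show ?thesis using xs by simp
qed

context
  fixes K :: "('k, 'r) ring_scheme" and d :: nat and M :: "('k, 'a, 'm) module_scheme"
  assumes M: "module K M"
begin

interpretation M: module K M by (rule M)

private abbreviation "F \<equiv> free_module K (words d M)"
private abbreviation "e \<equiv> free_gen K (words d M)"
private abbreviation "R \<equiv> gen_submodule K F (tensor_rels K d M)"

private lemma F: "module K F" by (rule free_is_module) unfold_locales

interpretation F: module K F by (rule F)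

private lemma e_closed: "xs \<in> words d M \<Longrightarrow> e xs \<in> carrier F"
  by (rule free_gen_closed) unfold_locales

private lemma rels: "tensor_rels K d M \<subseteq> carrier F"
  by (auto simp: tensor_rels_def Let_def words_update intro!: F.minus_closed F.a_closed e_closed)

private lemma R: "submodule R K F" by (rule gen_submodule_submodule[OF F rels])

lemma tensor_power_is_module: "module K (tensor_power K d M)"
  unfolding tensor_power_def by (rule quot_is_module[OF F R])

lemma tensor_closed: "xs \<in> words d M \<Longrightarrow> tensor K d M xs \<in> carrier (tensor_power K d M)"
  unfolding tensor_def tensor_power_def quot_carrier[OF F R] by (intro imageI e_closed)

lemma tensor_generates: "generates K (tensor_power K d M) (tensor K d M ` words d M)"
proof -
  have "tensor K d M ` words d M = (\<lambda>x. R +>\<^bsub>F\<^esub> x) ` e ` words d M"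
    by (auto simp: tensor_def)
  then show ?thesis
    unfolding tensor_power_def
    using quot_generates[OF F R free_generates] M.R.is_cring by simp
qed

lemma tensor_multilinear: "multilinear K d M (tensor_power K d M) (tensor K d M)"
proof (rule multilinearI)
  fix xs i x assume xs: "xs \<in> words d M" and i: "i < d" and x: "x \<in> carrier M"
  have c: "e (xs[i := y]) \<in> carrier F" if "y \<in> carrier M" for y
    using words_update[OF xs that] by (rule e_closed)
  {
    fix y assume y: "y \<in> carrier M"
    have "e (xs[i := x \<oplus>\<^bsub>M\<^esub> y]) \<ominus>\<^bsub>F\<^esub> (e (xs[i := x]) \<oplus>\<^bsub>F\<^esub> e (xs[i := y])) \<in> R"
      using xs i x y
      unfolding tensor_rels_def Let_def
      by (intro subsetD[OF gen_submodule_incl] UnI1 CollectI exI conjI) (rule refl | assumption)+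
    then show "tensor K d M (xs[i := x \<oplus>\<^bsub>M\<^esub> y]) =
        tensor K d M (xs[i := x]) \<oplus>\<^bsub>tensor_power K d M\<^esub> tensor K d M (xs[i := y])"
      using x y by (simp add: tensor_def tensor_power_def quot_add[OF F R c c] coset_eq_iff[OF F R] c)
  }
  {
    fix a assume a: "a \<in> carrier K"
    have "e (xs[i := a \<odot>\<^bsub>M\<^esub> x]) \<ominus>\<^bsub>F\<^esub> (a \<odot>\<^bsub>F\<^esub> e (xs[i := x])) \<in> R"
      using xs i x a
      unfolding tensor_rels_def Let_def
      by (intro subsetD[OF gen_submodule_incl] UnI2 CollectI exI conjI) (rule refl | assumption)+
    then show "tensor K d M (xs[i := a \<odot>\<^bsub>M\<^esub> x]) = a \<odot>\<^bsub>tensor_power K d M\<^esub> tensor K d M (xs[i := x])"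
      using x a by (simp add: tensor_def tensor_power_def quot_smult[OF F R a c] coset_eq_iff[OF F R] c)
  }
qed (rule tensor_closed)

lemma tensor_lift:
  assumes P: "module K P" and h: "multilinear K d M P h"
  shows "\<exists>g \<in> lin_maps K (tensor_power K d M) P. \<forall>xs\<in>words d M. g (tensor K d M xs) = h xs"
proof -
  interpret P: module K P by (rule P)
  obtain f where f: "f \<in> lin_maps K F P" and fe: "\<And>xs. xs \<in> words d M \<Longrightarrow> f (e xs) = h xs"
    using free_lift[OF M.R.is_cring P, of "words d M" h] multilinear_closed[OF h] by blast
  \<comment> \<open>The zero map, kept as a linear map so that the kernel of \<open>f\<close> is an
    equalizer and hence a submodule.\<close>
  define z where "z = (\<lambda>x\<in>carrier F. \<zero>\<^bsub>P\<^esub>)"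
  have z: "z \<in> lin_maps K F P"
    unfolding z_def by (rule lin_maps_restrictI[OF F]) auto
  have diff: "x \<ominus>\<^bsub>P\<^esub> x = \<zero>\<^bsub>P\<^esub>" if "x \<in> carrier P" for x
    using that by (simp add: a_minus_def P.r_neg)
  have "f r = \<zero>\<^bsub>P\<^esub>" if "r \<in> tensor_rels K d M" for r
    using that multilinear_closed[OF h] multilinear_add[OF h] multilinear_smult[OF h]
    by (auto simp: tensor_rels_def Let_def lin_maps_minus[OF F P f] lin_maps_add[OF f]
        lin_maps_smult[OF f] fe e_closed words_update diff)
  then have "R \<subseteq> {x \<in> carrier F. f x = z x}"
    using rels by (intro gen_submodule_least submodule_of_lin_eq[OF F P f z]) (auto simp: z_def)
  then have "\<exists>g \<in> lin_maps K (quot_module F R) P. \<forall>x\<in>carrier F. g (R +>\<^bsub>F\<^esub> x) = f x"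
    by (intro quot_factor[OF F R P f]) (auto simp: z_def)
  then show ?thesis
    unfolding tensor_power_def tensor_def using fe e_closed by metis
qed

end

subsection \<open>Sums and products of linear maps\<close>

lemma (in abelian_monoid) finsum_swap:
  assumes "finite A" "finite B" "\<And>a b. a \<in> A \<Longrightarrow> b \<in> B \<Longrightarrow> f a b \<in> carrier G"
  shows "(\<Oplus>a\<in>A. \<Oplus>b\<in>B. f a b) = (\<Oplus>b\<in>B. \<Oplus>a\<in>A. f a b)"
  using assms(1,3)
proof (induction A rule: finite_induct)
  case (insert a A)
  have "(\<Oplus>a\<in>insert a A. \<Oplus>b\<in>B. f a b) = (\<Oplus>b\<in>B. f a b) \<oplus> (\<Oplus>a\<in>A. \<Oplus>b\<in>B. f a b)"
    using insert by (intro finsum_insert) auto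
  also have "\<dots> = (\<Oplus>b\<in>B. f a b) \<oplus> (\<Oplus>b\<in>B. \<Oplus>a\<in>A. f a b)"
    using insert by simp
  also have "\<dots> = (\<Oplus>b\<in>B. f a b \<oplus> (\<Oplus>a\<in>A. f a b))"
    using insert by (intro finsum_addf[symmetric]) auto
  also have "\<dots> = (\<Oplus>b\<in>B. \<Oplus>a\<in>insert a A. f a b)"
    using insert by (intro finsum_cong') (auto simp: Pi_def)
  finally show ?case .
qed simp

lemma (in module) finsum_smult_rdistr:
  assumes "finite A" "f \<in> A \<rightarrow> carrier R" "x \<in> carrier M"
  shows "(\<Oplus>\<^bsub>R\<^esub>a\<in>A. f a) \<odot>\<^bsub>M\<^esub> x = (\<Oplus>\<^bsub>M\<^esub>a\<in>A. f a \<odot>\<^bsub>M\<^esub> x)"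
  using assms(1,2)
proof (induction A rule: finite_induct)
  case (insert a A)
  then show ?case using assms(3) by (simp add: Pi_def smult_l_distr)
qed (simp add: assms)

lemma (in module) finsum_delta:
  assumes "finite A" "a \<in> A" "f \<in> A \<rightarrow> carrier M"
  shows "(\<Oplus>\<^bsub>M\<^esub>b\<in>A. if b = a then f b else \<zero>\<^bsub>M\<^esub>) = f a"
  using M.finsum_singleton[OF assms(2,1,3)] by (simp add: eq_commute[of a])

lemma (in cring) finprod_zero_factor:
  assumes "finite A" "a \<in> A" "f \<in> A \<rightarrow> carrier R" "f a = \<zero>"
  shows "(\<Otimes>i\<in>A. f i) = \<zero>"
proof -
  have "(\<Otimes>i\<in>insert a (A - {a}). f i) = f a \<otimes> (\<Otimes>i\<in>A - {a}. f i)"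
    using assms by (intro finprod_insert) auto
  also have "\<dots> = \<zero>"
    unfolding assms(4) using assms(3) by (intro l_null finprod_closed) auto
  finally show ?thesis using assms(2) by (simp add: insert_absorb)
qed

lemma submodule_finsum:
  assumes M: "module K M" and N: "submodule N K M" and "finite A" "\<And>a. a \<in> A \<Longrightarrow> f a \<in> N"
  shows "(\<Oplus>\<^bsub>M\<^esub>a\<in>A. f a) \<in> N"
proof -
  interpret module K M by (rule M)
  show ?thesis
    using assms(3,4)
  proof (induction A rule: finite_induct)
    case empty
    then show ?case using submodule_zero[OF N] by simp
  next
    case (insert a A)
    then show ?case using submoduleE(1,5)[OF N] by (subst finsum_insert) auto
  qed
qed

lemma lin_maps_sum:
  assumes M: "module K M" and N: "module K N" and A: "finite A"
    and f: "\<And>a. a \<in> A \<Longrightarrow> f a \<in> lin_maps K M N"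
  shows "(\<lambda>x\<in>carrier M. \<Oplus>\<^bsub>N\<^esub>a\<in>A. f a x) \<in> lin_maps K M N"
proof -
  interpret N: module K N by (rule N)
  interpret M: module K M by (rule M)
  note c = lin_maps_closed[OF f]
  show ?thesis
  proof (rule lin_maps_restrictI[OF M])
    show "(\<Oplus>\<^bsub>N\<^esub>a\<in>A. f a x) \<in> carrier N" if "x \<in> carrier M" for x
      using c that by (intro N.finsum_closed) auto
    show "(\<Oplus>\<^bsub>N\<^esub>a\<in>A. f a (x \<oplus>\<^bsub>M\<^esub> y)) = (\<Oplus>\<^bsub>N\<^esub>a\<in>A. f a x) \<oplus>\<^bsub>N\<^esub> (\<Oplus>\<^bsub>N\<^esub>a\<in>A. f a y)"
      if "x \<in> carrier M" "y \<in> carrier M" for x y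
    proof -
      have "(\<Oplus>\<^bsub>N\<^esub>a\<in>A. f a (x \<oplus>\<^bsub>M\<^esub> y)) = (\<Oplus>\<^bsub>N\<^esub>a\<in>A. f a x \<oplus>\<^bsub>N\<^esub> f a y)"
        using c that by (intro N.finsum_cong') (auto simp: lin_maps_add[OF f])
      then show ?thesis using c that by (simp add: N.finsum_addf Pi_def)
    qed
    show "(\<Oplus>\<^bsub>N\<^esub>a\<in>A. f a (k \<odot>\<^bsub>M\<^esub> x)) = k \<odot>\<^bsub>N\<^esub> (\<Oplus>\<^bsub>N\<^esub>a\<in>A. f a x)"
      if "k \<in> carrier K" "x \<in> carrier M" for k x
    proof -
      have "(\<Oplus>\<^bsub>N\<^esub>a\<in>A. f a (k \<odot>\<^bsub>M\<^esub> x)) = (\<Oplus>\<^bsub>N\<^esub>a\<in>A. k \<odot>\<^bsub>N\<^esub> f a x)"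
        using c that by (intro N.finsum_cong') (auto simp: lin_maps_smult[OF f])
      then show ?thesis using c that A by (simp add: N.finsum_smult_ldistr Pi_def)
    qed
  qed
qed

lemma lin_maps_scale:
  assumes M: "module K M" and a: "a \<in> carrier K"
  shows "(\<lambda>x\<in>carrier M. a \<odot>\<^bsub>M\<^esub> x) \<in> lin_maps K M M"
proof -
  interpret module K M by (rule M)
  show ?thesis
    using a by (intro lin_maps_restrictI M) (simp_all add: smult_r_distr smult_assoc1[symmetric] R.m_ac)
qed

lemma lin_maps_smult_vector:
  assumes M: "module K M" and N: "module K N" and f: "f \<in> lin_maps K M (ring_module K)" and v: "v \<in> carrier N"
  shows "(\<lambda>x\<in>carrier M. f x \<odot>\<^bsub>N\<^esub> v) \<in> lin_maps K M N"
proof -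
  interpret N: module K N by (rule N)
  show ?thesis
    using lin_maps_closed[OF f] v
    by (intro lin_maps_restrictI[OF M])
      (simp_all add: lin_maps_add[OF f] lin_maps_smult[OF f] N.smult_l_distr N.smult_assoc1)
qed

lemma dual_eval_lin:
  assumes M: "module K M" and x: "x \<in> carrier M"
  shows "(\<lambda>f\<in>carrier (dual K M). f x) \<in> lin_maps K (dual K M) (ring_module K)"
  using x dual_closed[of _ K M x]
  by (intro lin_maps_restrictI[OF dual_is_module[OF M]]) (simp_all add: dual_simps(3,4))

lemma dual_finsum_apply:
  assumes M: "module K M" and A: "finite A" and f: "\<And>a. a \<in> A \<Longrightarrow> f a \<in> carrier (dual K M)"
    and x: "x \<in> carrier M"
  shows "(\<Oplus>\<^bsub>dual K M\<^esub>a\<in>A. f a) x = (\<Oplus>\<^bsub>K\<^esub>a\<in>A. f a x)"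
proof -
  interpret D: module K "dual K M" by (rule dual_is_module[OF M])
  have "(\<Oplus>\<^bsub>dual K M\<^esub>a\<in>A. f a) \<in> carrier (dual K M)" using f by (intro D.finsum_closed) auto
  then have "(\<Oplus>\<^bsub>dual K M\<^esub>a\<in>A. f a) x = (\<Oplus>\<^bsub>K\<^esub>a\<in>A. (\<lambda>f\<in>carrier (dual K M). f x) (f a))"
    using lin_maps_finsum[OF dual_is_module[OF M] ring_module_is_module dual_eval_lin[OF M x] A, of f] f
    by (simp add: D.R.is_cring Pi_def)
  also have "\<dots> = (\<Oplus>\<^bsub>K\<^esub>a\<in>A. f a x)"
    using f dual_closed[OF f x] by (intro D.R.finsum_cong') auto
  finally show ?thesis .
qed

lemma prod_multilinear:
  assumes M: "module K M" and h: "\<And>i. i < d \<Longrightarrow> h i \<in> lin_maps K M (ring_module K)"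
  shows "multilinear K d M (ring_module K) (\<lambda>xs. \<Otimes>\<^bsub>K\<^esub>i\<in>{..<d}. h i (xs ! i))"
proof -
  interpret M: module K M by (rule M)
  have c: "h i x \<in> carrier K" if "i < d" "x \<in> carrier M" for i x
    using lin_maps_closed[OF h[OF that(1)] that(2)] by simp
  \<comment> \<open>Isolates the factor of slot \<open>i\<close>, the only one that an update in
    this slot affects.\<close>
  have split: "(\<Otimes>\<^bsub>K\<^esub>j\<in>{..<d}. h j (xs[i := x] ! j)) = h i x \<otimes>\<^bsub>K\<^esub> (\<Otimes>\<^bsub>K\<^esub>j\<in>{..<d} - {i}. h j (xs ! j))"
    if "xs \<in> words d M" "i < d" "x \<in> carrier M" for xs i x
  proof -
    have "(\<Otimes>\<^bsub>K\<^esub>j\<in>{..<d}. h j (xs[i := x] ! j)) = (\<Otimes>\<^bsub>K\<^esub>j\<in>insert i ({..<d} - {i}). h j (xs[i := x] ! j))"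
      using that by (simp add: insert_absorb)
    also have "\<dots> = h i (xs[i := x] ! i) \<otimes>\<^bsub>K\<^esub> (\<Otimes>\<^bsub>K\<^esub>j\<in>{..<d} - {i}. h j (xs[i := x] ! j))"
      using that words_update[OF that(1,3), of i] words_nth
      by (intro M.R.finprod_insert) (auto intro!: c)
    also have "(\<Otimes>\<^bsub>K\<^esub>j\<in>{..<d} - {i}. h j (xs[i := x] ! j)) = (\<Otimes>\<^bsub>K\<^esub>j\<in>{..<d} - {i}. h j (xs ! j))"
      using that words_nth[OF that(1)] by (intro M.R.finprod_cong') (auto intro!: c)
    finally show ?thesis using that by (simp add: words_length)
  qed
  have cl: "(\<Otimes>\<^bsub>K\<^esub>j\<in>A. h j (xs ! j)) \<in> carrier K" if "xs \<in> words d M" "A \<subseteq> {..<d}" for A xs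
    using that words_nth[OF that(1)] by (intro M.R.finprod_closed) (auto intro!: c)
  show ?thesis
  proof (rule multilinearI)
    fix xs i x assume xs: "xs \<in> words d M" and i: "i < d" and x: "x \<in> carrier M"
    note h' = lin_maps_add[OF h[OF i]] lin_maps_smult[OF h[OF i]]
    note cl' = cl[OF xs, of "{..<d} - {i}"]
    show "(\<Otimes>\<^bsub>K\<^esub>j\<in>{..<d}. h j (xs[i := x \<oplus>\<^bsub>M\<^esub> y] ! j)) =
        (\<Otimes>\<^bsub>K\<^esub>j\<in>{..<d}. h j (xs[i := x] ! j)) \<oplus>\<^bsub>ring_module K\<^esub> (\<Otimes>\<^bsub>K\<^esub>j\<in>{..<d}. h j (xs[i := y] ! j))"
      if y: "y \<in> carrier M" for y
      using i x y cl' by (simp add: split[OF xs i] h' c M.R.l_distr)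
    show "(\<Otimes>\<^bsub>K\<^esub>j\<in>{..<d}. h j (xs[i := a \<odot>\<^bsub>M\<^esub> x] ! j)) =
        a \<odot>\<^bsub>ring_module K\<^esub> (\<Otimes>\<^bsub>K\<^esub>j\<in>{..<d}. h j (xs[i := x] ! j))"
      if a: "a \<in> carrier K" for a
      using i x a cl' by (simp add: split[OF xs i] h' c M.R.m_assoc)
  qed (use cl in simp)
qed

lemma multilinear_sum:
  assumes M: "module K M" and A: "finite A" and k: "\<And>a. a \<in> A \<Longrightarrow> k a \<in> carrier K"
    and f: "\<And>a. a \<in> A \<Longrightarrow> multilinear K d M (ring_module K) (f a)"
  shows "multilinear K d M (ring_module K) (\<lambda>xs. \<Oplus>\<^bsub>K\<^esub>a\<in>A. k a \<otimes>\<^bsub>K\<^esub> f a xs)"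
proof -
  interpret M: module K M by (rule M)
  have c: "f a xs \<in> carrier K" if "a \<in> A" "xs \<in> words d M" for a xs
    using multilinear_closed[OF f] that by simp
  show ?thesis
  proof (rule multilinearI)
    show "(\<Oplus>\<^bsub>K\<^esub>a\<in>A. k a \<otimes>\<^bsub>K\<^esub> f a xs) \<in> carrier (ring_module K)" if "xs \<in> words d M" for xs
      using c k that by (auto intro!: M.R.finsum_closed)
    fix xs i x assume xs: "xs \<in> words d M" and i: "i < d" and x: "x \<in> carrier M"
    note w = words_update[OF xs]
    show "(\<Oplus>\<^bsub>K\<^esub>a\<in>A. k a \<otimes>\<^bsub>K\<^esub> f a (xs[i := x \<oplus>\<^bsub>M\<^esub> y])) =
        (\<Oplus>\<^bsub>K\<^esub>a\<in>A. k a \<otimes>\<^bsub>K\<^esub> f a (xs[i := x])) \<oplus>\<^bsub>ring_module K\<^esub> (\<Oplus>\<^bsub>K\<^esub>a\<in>A. k a \<otimes>\<^bsub>K\<^esub> f a (xs[i := y]))"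
      if y: "y \<in> carrier M" for y
    proof -
      have "(\<Oplus>\<^bsub>K\<^esub>a\<in>A. k a \<otimes>\<^bsub>K\<^esub> f a (xs[i := x \<oplus>\<^bsub>M\<^esub> y])) =
          (\<Oplus>\<^bsub>K\<^esub>a\<in>A. k a \<otimes>\<^bsub>K\<^esub> f a (xs[i := x]) \<oplus>\<^bsub>K\<^esub> k a \<otimes>\<^bsub>K\<^esub> f a (xs[i := y]))"
        using c k w x y
        by (intro M.R.finsum_cong') (auto simp: multilinear_add[OF f xs i x y] M.R.r_distr)
      then show ?thesis using c k w x y by (simp add: M.R.finsum_addf Pi_def)
    qed
    show "(\<Oplus>\<^bsub>K\<^esub>a\<in>A. k a \<otimes>\<^bsub>K\<^esub> f a (xs[i := b \<odot>\<^bsub>M\<^esub> x])) =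
        b \<odot>\<^bsub>ring_module K\<^esub> (\<Oplus>\<^bsub>K\<^esub>a\<in>A. k a \<otimes>\<^bsub>K\<^esub> f a (xs[i := x]))"
      if b: "b \<in> carrier K" for b
    proof -
      have "(\<Oplus>\<^bsub>K\<^esub>a\<in>A. k a \<otimes>\<^bsub>K\<^esub> f a (xs[i := b \<odot>\<^bsub>M\<^esub> x])) =
          (\<Oplus>\<^bsub>K\<^esub>a\<in>A. b \<otimes>\<^bsub>K\<^esub> (k a \<otimes>\<^bsub>K\<^esub> f a (xs[i := x])))"
        using c k w x b
        by (intro M.R.finsum_cong') (auto simp: multilinear_smult[OF f xs i b x] M.R.m_ac)
      then show ?thesis using c k w x b A by (simp add: M.R.finsum_rdistr Pi_def)
    qed
  qed
qed

text \<open>Linear forms that agree on generators are equal, so multilinearity of a map into a dual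
  can be tested after evaluation at generators. In both nested constructions below the values are
  known only there.\<close>

lemma multilinear_into_dual:
  assumes M: "module K M" and Q: "module K Q" and gen: "generates K Q (g ` A)"
    and cl: "\<And>ys. ys \<in> words d M \<Longrightarrow> \<Phi> ys \<in> carrier (dual K Q)"
    and ml: "\<And>a. a \<in> A \<Longrightarrow> multilinear K d M (ring_module K) (\<lambda>ys. \<Phi> ys (g a))"
  shows "multilinear K d M (dual K Q) \<Phi>"
proof -
  interpret M: module K M by (rule M)
  interpret D: module K "dual K Q" by (rule dual_is_module[OF Q])
  have eqI: "f = f'" if "f \<in> carrier (dual K Q)" "f' \<in> carrier (dual K Q)"
      "\<And>a. a \<in> A \<Longrightarrow> f (g a) = f' (g a)" for f f'
    using that generates_lin_eq[OF Q ring_module_is_module gen, of f f'] M.R.is_cring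
    by (auto simp: dual_simps(1))
  have gX: "g a \<in> carrier Q" if "a \<in> A" for a using gen that by (auto simp: generates_def)
  show ?thesis
  proof (rule multilinearI)
    fix xs i x assume xs: "xs \<in> words d M" and i: "i < d" and x: "x \<in> carrier M"
    note w = words_update[OF xs]
    show "\<Phi> (xs[i := x \<oplus>\<^bsub>M\<^esub> y]) = \<Phi> (xs[i := x]) \<oplus>\<^bsub>dual K Q\<^esub> \<Phi> (xs[i := y])" if y: "y \<in> carrier M" for y
    proof (rule eqI)
      fix a assume a: "a \<in> A"
      show "\<Phi> (xs[i := x \<oplus>\<^bsub>M\<^esub> y]) (g a) = (\<Phi> (xs[i := x]) \<oplus>\<^bsub>dual K Q\<^esub> \<Phi> (xs[i := y])) (g a)"
        using multilinear_add[OF ml[OF a] xs i x y] gX[OF a] by (simp add: dual_simps)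
    qed (use x y w cl in auto)
    show "\<Phi> (xs[i := b \<odot>\<^bsub>M\<^esub> x]) = b \<odot>\<^bsub>dual K Q\<^esub> \<Phi> (xs[i := x])" if b: "b \<in> carrier K" for b
    proof (rule eqI)
      fix a assume a: "a \<in> A"
      show "\<Phi> (xs[i := b \<odot>\<^bsub>M\<^esub> x]) (g a) = (b \<odot>\<^bsub>dual K Q\<^esub> \<Phi> (xs[i := x])) (g a)"
        using multilinear_smult[OF ml[OF a] xs i b x] gX[OF a] by (simp add: dual_simps)
    qed (use x b w cl in auto)
  qed (rule cl)
qed

subsection \<open>Dual bases\<close>

text \<open>Coordinates are linear because sums and multiples of expansions are again expansions,
  and expansions are unique.\<close>

lemma dual_basis:
  assumes E: "module K E" and fb: "has_finite_basis K E"
  obtains B s where "finite B" "B \<subseteq> carrier E" "\<And>b. b \<in> B \<Longrightarrow> s b \<in> carrier (dual K E)"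
    "\<And>b c. b \<in> B \<Longrightarrow> c \<in> B \<Longrightarrow> s b c = (if b = c then \<one>\<^bsub>K\<^esub> else \<zero>\<^bsub>K\<^esub>)"
    "\<And>x. x \<in> carrier E \<Longrightarrow> x = (\<Oplus>\<^bsub>E\<^esub>b\<in>B. s b x \<odot>\<^bsub>E\<^esub> b)"
proof -
  interpret E: module K E by (rule E)
  obtain B where *: "finite B \<and> B \<subseteq> carrier E \<and>
      (\<forall>x\<in>carrier E. \<exists>!c. c \<in> B \<rightarrow>\<^sub>E carrier K \<and> x = (\<Oplus>\<^bsub>E\<^esub>b\<in>B. c b \<odot>\<^bsub>E\<^esub> b))"
    using fb unfolding has_finite_basis_def by (rule exE)
  then have B: "finite B" "B \<subseteq> carrier E" by simp_all
  have ex1: "\<exists>!c. c \<in> B \<rightarrow>\<^sub>E carrier K \<and> x = (\<Oplus>\<^bsub>E\<^esub>b\<in>B. c b \<odot>\<^bsub>E\<^esub> b)" if "x \<in> carrier E" for x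
    using * that by (elim conjE) (rule bspec)
  define c where "c x = (THE c. c \<in> B \<rightarrow>\<^sub>E carrier K \<and> x = (\<Oplus>\<^bsub>E\<^esub>b\<in>B. c b \<odot>\<^bsub>E\<^esub> b))" for x
  have c: "c x \<in> B \<rightarrow>\<^sub>E carrier K" "x = (\<Oplus>\<^bsub>E\<^esub>b\<in>B. c x b \<odot>\<^bsub>E\<^esub> b)" if "x \<in> carrier E" for x
    using theI'[OF ex1[OF that]] unfolding c_def by auto
  have uniq: "c x b = f b"
    if "x \<in> carrier E" "b \<in> B" "\<And>b. b \<in> B \<Longrightarrow> f b \<in> carrier K" "x = (\<Oplus>\<^bsub>E\<^esub>b\<in>B. f b \<odot>\<^bsub>E\<^esub> b)" for x f b
  proof -
    \<comment> \<open>Uniqueness is stated for extensional coefficient functions, so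
      \<open>f\<close> is first restricted to \<open>B\<close>.\<close>
    have "x = (\<Oplus>\<^bsub>E\<^esub>b\<in>B. restrict f B b \<odot>\<^bsub>E\<^esub> b)"
      unfolding that(4) using that(3) B by (intro E.finsum_cong') auto
    moreover have "restrict f B \<in> B \<rightarrow>\<^sub>E carrier K" using that(3) by auto
    ultimately have "c x = restrict f B" using ex1[OF that(1)] c[OF that(1)] by blast
    then show ?thesis using that(2) by simp
  qed
  have cc: "c x b \<in> carrier K" if "x \<in> carrier E" "b \<in> B" for x b
    using c(1)[OF that(1)] that(2) by auto
  define s where "s b = (\<lambda>x\<in>carrier E. c x b)" for b
  have "s b \<in> lin_maps K E (ring_module K)" if b: "b \<in> B" for b
    unfolding s_def
  proof (rule lin_maps_restrictI[OF E])
    fix x assume x: "x \<in> carrier E"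
    show "c x b \<in> carrier (ring_module K)" using cc x b by simp
    show "c (x \<oplus>\<^bsub>E\<^esub> y) b = c x b \<oplus>\<^bsub>ring_module K\<^esub> c y b" if y: "y \<in> carrier E" for y
    proof -
      have "(\<Oplus>\<^bsub>E\<^esub>b\<in>B. (c x b \<oplus>\<^bsub>K\<^esub> c y b) \<odot>\<^bsub>E\<^esub> b) =
          (\<Oplus>\<^bsub>E\<^esub>b\<in>B. c x b \<odot>\<^bsub>E\<^esub> b \<oplus>\<^bsub>E\<^esub> c y b \<odot>\<^bsub>E\<^esub> b)"
        using B cc x y by (intro E.finsum_cong') (auto simp: E.smult_l_distr subset_iff)
      also have "\<dots> = (\<Oplus>\<^bsub>E\<^esub>b\<in>B. c x b \<odot>\<^bsub>E\<^esub> b) \<oplus>\<^bsub>E\<^esub> (\<Oplus>\<^bsub>E\<^esub>b\<in>B. c y b \<odot>\<^bsub>E\<^esub> b)"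
        using B cc x y by (intro E.finsum_addf) auto
      finally have eq: "x \<oplus>\<^bsub>E\<^esub> y = (\<Oplus>\<^bsub>E\<^esub>b\<in>B. (c x b \<oplus>\<^bsub>K\<^esub> c y b) \<odot>\<^bsub>E\<^esub> b)"
        using c(2)[OF x] c(2)[OF y] by simp
      then show ?thesis
        using uniq[OF E.a_closed[OF x y] b _ eq] cc x y by simp
    qed
    show "c (a \<odot>\<^bsub>E\<^esub> x) b = a \<odot>\<^bsub>ring_module K\<^esub> c x b" if a: "a \<in> carrier K" for a
    proof -
      have "(\<Oplus>\<^bsub>E\<^esub>b\<in>B. (a \<otimes>\<^bsub>K\<^esub> c x b) \<odot>\<^bsub>E\<^esub> b) = (\<Oplus>\<^bsub>E\<^esub>b\<in>B. a \<odot>\<^bsub>E\<^esub> (c x b \<odot>\<^bsub>E\<^esub> b))"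
        using B cc x a by (intro E.finsum_cong') (auto simp: E.smult_assoc1 subset_iff)
      also have "\<dots> = a \<odot>\<^bsub>E\<^esub> (\<Oplus>\<^bsub>E\<^esub>b\<in>B. c x b \<odot>\<^bsub>E\<^esub> b)"
        using B cc x a by (intro E.finsum_smult_ldistr[symmetric]) auto
      finally have eq: "a \<odot>\<^bsub>E\<^esub> x = (\<Oplus>\<^bsub>E\<^esub>b\<in>B. (a \<otimes>\<^bsub>K\<^esub> c x b) \<odot>\<^bsub>E\<^esub> b)"
        using c(2)[OF x] by simp
      then show ?thesis
        using uniq[OF E.smult_closed[OF a x] b _ eq] cc x a by simp
    qed
  qed
  moreover have "s b x = (if b = x then \<one>\<^bsub>K\<^esub> else \<zero>\<^bsub>K\<^esub>)" if b: "b \<in> B" and x: "x \<in> B" for b x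
  proof -
    have "(\<Oplus>\<^bsub>E\<^esub>b\<in>B. (if b = x then \<one>\<^bsub>K\<^esub> else \<zero>\<^bsub>K\<^esub>) \<odot>\<^bsub>E\<^esub> b) = (\<Oplus>\<^bsub>E\<^esub>b\<in>B. if b = x then b else \<zero>\<^bsub>E\<^esub>)"
      using B by (intro E.finsum_cong') auto
    also have "\<dots> = x" using E.finsum_delta[OF B(1) x, of "\<lambda>b. b"] B by auto
    finally have "x = (\<Oplus>\<^bsub>E\<^esub>b\<in>B. (if b = x then \<one>\<^bsub>K\<^esub> else \<zero>\<^bsub>K\<^esub>) \<odot>\<^bsub>E\<^esub> b)" ..
    from uniq[OF _ b _ this] show ?thesis using x B by (auto simp: s_def)
  qed
  moreover have "x = (\<Oplus>\<^bsub>E\<^esub>b\<in>B. s b x \<odot>\<^bsub>E\<^esub> b)" if "x \<in> carrier E" for x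
    using c(2)[OF that] that by (simp add: s_def)
  ultimately show thesis using that[OF B, of s] by (simp add: dual_simps)
qed

lemma basis_generates:
  assumes E: "module K E" and B: "finite B" "B \<subseteq> carrier E"
    and s: "\<And>b. b \<in> B \<Longrightarrow> s b \<in> carrier (dual K E)"
    and expand: "\<And>x. x \<in> carrier E \<Longrightarrow> x = (\<Oplus>\<^bsub>E\<^esub>b\<in>B. s b x \<odot>\<^bsub>E\<^esub> b)"
  shows "generates K E B"
  unfolding generates_def
proof (intro conjI allI impI subsetI)
  fix N x assume N: "submodule N K E" "B \<subseteq> N" and x: "x \<in> carrier E"
  have "(\<Oplus>\<^bsub>E\<^esub>b\<in>B. s b x \<odot>\<^bsub>E\<^esub> b) \<in> N"
    using N(2) by (intro submodule_finsum[OF E N(1) B(1)] submodule.smult_closed[OF N(1)] dual_closed[OF s x]) auto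
  then show "x \<in> N" using expand[OF x] by simp
qed (use B in auto)

text \<open>A form \<open>y\<close> is the combination of the coordinate forms with its own values
  \<open>y b\<close> as coefficients, a finite sum since \<open>B\<close> is finite.\<close>

lemma dual_basis_generates:
  assumes E: "module K E" and B: "finite B" "B \<subseteq> carrier E"
    and s: "\<And>b. b \<in> B \<Longrightarrow> s b \<in> carrier (dual K E)"
    and expand: "\<And>x. x \<in> carrier E \<Longrightarrow> x = (\<Oplus>\<^bsub>E\<^esub>b\<in>B. s b x \<odot>\<^bsub>E\<^esub> b)"
  shows "generates K (dual K E) (s ` B)"
  unfolding generates_def
proof (intro conjI allI impI subsetI)
  interpret E: module K E by (rule E)
  interpret D: module K "dual K E" by (rule dual_is_module[OF E])
  fix N y assume N: "submodule N K (dual K E)" "s ` B \<subseteq> N" and y: "y \<in> carrier (dual K E)"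
  note yc = dual_closed[OF y]
  have yl: "y \<in> lin_maps K E (ring_module K)" using y by (simp add: dual_simps)
  have "y = (\<Oplus>\<^bsub>dual K E\<^esub>b\<in>B. y b \<odot>\<^bsub>dual K E\<^esub> s b)"
  proof (rule lin_maps_ext[OF yl])
    show "(\<Oplus>\<^bsub>dual K E\<^esub>b\<in>B. y b \<odot>\<^bsub>dual K E\<^esub> s b) \<in> lin_maps K E (ring_module K)"
      unfolding dual_simps(1)[symmetric] using s yc B by (intro D.finsum_closed) auto
    fix x assume x: "x \<in> carrier E"
    have sx: "s b x \<in> carrier K" if "b \<in> B" for b by (rule dual_closed[OF s[OF that] x])
    have "y x = y (\<Oplus>\<^bsub>E\<^esub>b\<in>B. s b x \<odot>\<^bsub>E\<^esub> b)" using expand[OF x] by simp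
    also have "\<dots> = (\<Oplus>\<^bsub>K\<^esub>b\<in>B. y (s b x \<odot>\<^bsub>E\<^esub> b))"
      using lin_maps_finsum[OF E ring_module_is_module yl B(1), of "\<lambda>b. s b x \<odot>\<^bsub>E\<^esub> b"] sx B E.R.is_cring
      by (auto simp: Pi_def)
    also have "\<dots> = (\<Oplus>\<^bsub>K\<^esub>b\<in>B. (y b \<odot>\<^bsub>dual K E\<^esub> s b) x)"
      using sx B x yc by (intro E.R.finsum_cong') (auto simp: lin_maps_smult[OF yl] dual_simps(4) E.R.m_comm subset_iff)
    also have "\<dots> = (\<Oplus>\<^bsub>dual K E\<^esub>b\<in>B. y b \<odot>\<^bsub>dual K E\<^esub> s b) x"
      using s yc B by (intro dual_finsum_apply[symmetric] E x) auto
    finally show "y x = (\<Oplus>\<^bsub>dual K E\<^esub>b\<in>B. y b \<odot>\<^bsub>dual K E\<^esub> s b) x" .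
  qed
  also have "\<dots> \<in> N"
    using N(2) B by (intro submodule_finsum[OF dual_is_module[OF E] N(1) B(1)] submodule.smult_closed[OF N(1)] yc) auto
  finally show "y \<in> N" .
qed (use s in auto)

section \<open>Semi-symmetric powers\<close>

lemma permute_word_length [simp]: "length (permute_word \<sigma> xs) = length xs"
  by (simp add: permute_word_def del: upt_Suc)

lemma permute_word_nth: "i < length xs \<Longrightarrow> permute_word \<sigma> xs ! i = xs ! (inv' \<sigma> (Suc i) - 1)"
  by (simp add: permute_word_def del: upt_Suc)

text \<open>Permutations count positions from 1 and lists from 0. As \<sigma> preserves
  \<open>{1..d}\<close>, the subtraction of 1 never truncates.\<close>

lemma permutes_index:
  assumes "\<sigma> permutes {1..d}" "i < d"
  shows "\<sigma> (Suc i) - 1 < d" "Suc (\<sigma> (Suc i) - 1) = \<sigma> (Suc i)"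
proof -
  have "\<sigma> (Suc i) \<in> {1..d}" using permutes_in_image[OF assms(1), of "Suc i"] assms(2) by simp
  then show "\<sigma> (Suc i) - 1 < d" "Suc (\<sigma> (Suc i) - 1) = \<sigma> (Suc i)" by auto
qed

lemma permute_word_words:
  assumes "\<sigma> permutes {1..d}" "xs \<in> words d M"
  shows "permute_word \<sigma> xs \<in> words d M"
  using assms words_nth[OF assms(2)] permutes_index[OF permutes_inv[OF assms(1)]]
  by (auto simp: words_def in_set_conv_nth permute_word_nth)

text \<open>Changing one slot before permuting changes exactly one slot afterwards. Hence
  precomposition with a permutation preserves multilinearity.\<close>

lemma permute_word_update:
  assumes \<sigma>: "\<sigma> permutes {1..length xs}" and i: "i < length xs"
  shows "permute_word \<sigma> (xs[i := x]) = (permute_word \<sigma> xs)[\<sigma> (Suc i) - 1 := x]"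
proof (rule nth_equalityI)
  fix j assume "j < length (permute_word \<sigma> (xs[i := x]))"
  then have j: "j < length xs" by simp
  let ?j = "inv' \<sigma> (Suc j) - 1"
  have "?j < length xs" "Suc ?j = inv' \<sigma> (Suc j)"
    using permutes_index[OF permutes_inv[OF \<sigma>] j] by auto
  moreover have "i = ?j \<longleftrightarrow> \<sigma> (Suc i) - 1 = j"
    using permutes_index[OF permutes_inv[OF \<sigma>] j] permutes_index[OF \<sigma> i] permutes_inverses[OF \<sigma>]
    by (metis diff_Suc_1)
  ultimately show "permute_word \<sigma> (xs[i := x]) ! j = (permute_word \<sigma> xs)[\<sigma> (Suc i) - 1 := x] ! j"
    using i j by (auto simp: permute_word_nth nth_list_update)
qed simp

lemma permute_word_comp:
  assumes "\<sigma> permutes {1..length xs}" "\<tau> permutes {1..length xs}"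
  shows "permute_word \<sigma> (permute_word \<tau> xs) = permute_word (\<sigma> \<circ> \<tau>) xs"
proof (rule nth_equalityI)
  fix i assume "i < length (permute_word \<sigma> (permute_word \<tau> xs))"
  then show "permute_word \<sigma> (permute_word \<tau> xs) ! i = permute_word (\<sigma> \<circ> \<tau>) xs ! i"
    using permutes_index[OF permutes_inv[OF assms(1)], of i]
    by (simp add: permute_word_nth o_inv_distrib[OF permutes_bij permutes_bij, OF assms])
qed simp

lemma permute_word_id [simp]: "permute_word id xs = xs"
  by (rule nth_equalityI) (simp_all add: permute_word_nth)

lemma permute_word_map:
  assumes "\<sigma> permutes {1..length xs}"
  shows "permute_word \<sigma> (map f xs) = map f (permute_word \<sigma> xs)"
  using permutes_index[OF permutes_inv[OF assms]]
  by (intro nth_equalityI) (simp_all add: permute_word_nth)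

lemma multilinear_permute_word:
  assumes \<sigma>: "\<sigma> permutes {1..d}" and h: "multilinear K d M P h"
  shows "multilinear K d M P (\<lambda>xs. h (permute_word \<sigma> xs))"
  using permutes_index[OF \<sigma>] \<sigma>
  by (intro multilinearI)
    (simp_all add: permute_word_update words_length permute_word_words multilinear_closed[OF h]
      multilinear_add[OF h] multilinear_smult[OF h])

lemma perm_action:
  assumes M: "module K M" and \<sigma>: "\<sigma> permutes {1..d}"
  shows perm_action_lin: "perm_action K d M \<sigma> \<in> lin_maps K (tensor_power K d M) (tensor_power K d M)"
    and perm_action_tensor:
      "\<And>xs. xs \<in> words d M \<Longrightarrow> perm_action K d M \<sigma> (tensor K d M xs) = tensor K d M (permute_word \<sigma> xs)"
proof -
  note T = tensor_power_is_module[OF M]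
  obtain g where g: "g \<in> lin_maps K (tensor_power K d M) (tensor_power K d M)"
    "\<forall>xs\<in>words d M. g (tensor K d M xs) = tensor K d M (permute_word \<sigma> xs)"
    using tensor_lift[OF M T multilinear_permute_word[OF \<sigma> tensor_multilinear[OF M]]] by blast
  then have "perm_action K d M \<sigma> = g"
    unfolding perm_action_def by (intro lin_ext_eq[OF T T tensor_generates[OF M]]) auto
  then show "perm_action K d M \<sigma> \<in> lin_maps K (tensor_power K d M) (tensor_power K d M)"
    and "\<And>xs. xs \<in> words d M \<Longrightarrow> perm_action K d M \<sigma> (tensor K d M xs) = tensor K d M (permute_word \<sigma> xs)"
    using g by auto
qed

section \<open>The universal property of the semi-symmetric power\<close>

locale weight = cring K for K :: "('k, 'r) ring_scheme" (structure) +
  fixes W :: "nat \<Rightarrow> (nat \<Rightarrow> nat) set" and chi :: "nat \<Rightarrow> (nat \<Rightarrow> nat) \<Rightarrow> 'k"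
  assumes omega_inv: "omega_invariant K W chi"
begin

text \<open>The multilinear maps of this kind are those that factor through
  \<open>chi_power\<close>. The guard on \<open>d\<close> follows \<open>chi_rels\<close>, which is
  empty in degree 0.\<close>

definition skew :: "nat \<Rightarrow> ('k, 'a, 'm) module_scheme \<Rightarrow> ('k, 'b, 'n) module_scheme
    \<Rightarrow> ('a list \<Rightarrow> 'b) \<Rightarrow> bool" where
  "skew d M P h \<longleftrightarrow> (d \<noteq> 0 \<longrightarrow> (\<forall>\<sigma>\<in>W d. \<forall>xs\<in>words d M.
     h (permute_word \<sigma> xs) = inv (chi d \<sigma>) \<odot>\<^bsub>P\<^esub> h xs))"

context
  fixes d :: nat and M :: "('k, 'a, 'm) module_scheme"
  assumes M: "module K M"
begin

interpretation M: module K M by (rule M)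

private abbreviation "T \<equiv> tensor_power K d M"
private abbreviation "N \<equiv> gen_submodule K T (chi_rels K W chi d M)"

private lemma T: "module K T" by (rule tensor_power_is_module[OF M])

interpretation T: module K T by (rule T)

private lemma weight_perm: "d \<noteq> 0 \<Longrightarrow> s \<in> W d \<Longrightarrow> s permutes {1..d}"
  using char_perm[OF is_cring omega_inv, of d s] by simp

private lemma weight_inv: "d \<noteq> 0 \<Longrightarrow> s \<in> W d \<Longrightarrow> inv (chi d s) \<in> carrier K"
  using char_unit[OF is_cring omega_inv, of d s] by simp

private lemma rels: "chi_rels K W chi d M \<subseteq> carrier T"
  using lin_maps_closed[OF perm_action_lin[OF M weight_perm]] weight_inv
  by (auto simp: chi_rels_def split: if_splits)

private lemma N: "submodule N K T" by (rule gen_submodule_submodule[OF T rels])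

lemma chi_power_is_module: "module K (chi_power K W chi d M)"
  unfolding chi_power_def by (rule quot_is_module[OF T N])

lemma chi_product_eq: "chi_product K W chi d M xs = N +>\<^bsub>T\<^esub> tensor K d M xs"
  by (simp add: chi_product_def)

private lemma proj: "(\<lambda>z\<in>carrier T. N +>\<^bsub>T\<^esub> z) \<in> lin_maps K T (chi_power K W chi d M)"
  unfolding chi_power_def
  by (rule lin_maps_restrictI[OF T])
    (simp_all add: quot_carrier[OF T N] quot_add[OF T N] quot_smult[OF T N])

lemma chi_product_multilinear: "multilinear K d M (chi_power K W chi d M) (chi_product K W chi d M)"
proof -
  have m: "multilinear K d M (chi_power K W chi d M) (\<lambda>xs. (\<lambda>z\<in>carrier T. N +>\<^bsub>T\<^esub> z) (tensor K d M xs))"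
    by (rule multilinear_lin_comp[OF tensor_multilinear[OF M] proj])
  show ?thesis
    using multilinear_closed[OF m] multilinear_add[OF m] multilinear_smult[OF m]
    by (intro multilinearI) (simp_all add: chi_product_eq tensor_closed[OF M] words_update)
qed

lemma chi_product_closed:
  "xs \<in> words d M \<Longrightarrow> chi_product K W chi d M xs \<in> carrier (chi_power K W chi d M)"
  by (rule multilinear_closed[OF chi_product_multilinear])

lemma chi_product_generates: "generates K (chi_power K W chi d M) (chi_product K W chi d M ` words d M)"
proof -
  have "chi_product K W chi d M ` words d M = (\<lambda>z. N +>\<^bsub>T\<^esub> z) ` tensor K d M ` words d M"
    by (auto simp: chi_product_eq)
  then show ?thesis
    unfolding chi_power_def using quot_generates[OF T N tensor_generates[OF M]] by simp
qed

lemma chi_product_skew: "skew d M (chi_power K W chi d M) (chi_product K W chi d M)"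
  unfolding skew_def
proof (intro impI ballI)
  fix \<sigma> xs assume d: "d \<noteq> 0" and \<sigma>: "\<sigma> \<in> W d" and xs: "xs \<in> words d M"
  note p = weight_perm[OF d \<sigma>]
  have "(inv (chi d \<sigma>) \<odot>\<^bsub>T\<^esub> tensor K d M xs) \<ominus>\<^bsub>T\<^esub> perm_action K d M \<sigma> (tensor K d M xs)
      \<in> chi_rels K W chi d M"
    unfolding chi_rels_def using d \<sigma> tensor_closed[OF M xs] by auto
  then have "(inv (chi d \<sigma>) \<odot>\<^bsub>T\<^esub> tensor K d M xs) \<ominus>\<^bsub>T\<^esub> tensor K d M (permute_word \<sigma> xs) \<in> N"
    unfolding perm_action_tensor[OF M p xs] by (rule subsetD[OF gen_submodule_incl])
  then have "N +>\<^bsub>T\<^esub> (inv (chi d \<sigma>) \<odot>\<^bsub>T\<^esub> tensor K d M xs) = N +>\<^bsub>T\<^esub> tensor K d M (permute_word \<sigma> xs)"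
    using coset_eq_iff[OF T N] weight_inv[OF d \<sigma>] tensor_closed[OF M] xs permute_word_words[OF p xs]
    by simp
  then show "chi_product K W chi d M (permute_word \<sigma> xs) =
      inv (chi d \<sigma>) \<odot>\<^bsub>chi_power K W chi d M\<^esub> chi_product K W chi d M xs"
    using quot_smult[OF T N weight_inv[OF d \<sigma>] tensor_closed[OF M xs]]
    by (simp add: chi_product_eq chi_power_def)
qed

lemma chi_power_lift:
  assumes P: "module K P" and h: "multilinear K d M P h" and sk: "skew d M P h"
  shows "\<exists>g \<in> lin_maps K (chi_power K W chi d M) P. \<forall>xs\<in>words d M. g (chi_product K W chi d M xs) = h xs"
proof -
  interpret P: module K P by (rule P)
  obtain f where f: "f \<in> lin_maps K T P" and fe: "\<And>xs. xs \<in> words d M \<Longrightarrow> f (tensor K d M xs) = h xs"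
    using tensor_lift[OF M P h] by blast
  define z where "z = (\<lambda>x\<in>carrier T. \<zero>\<^bsub>P\<^esub>)"
  have z: "z \<in> lin_maps K T P"
    unfolding z_def by (rule lin_maps_restrictI[OF T]) auto
  have diff: "x \<ominus>\<^bsub>P\<^esub> x = \<zero>\<^bsub>P\<^esub>" if "x \<in> carrier P" for x
    using that by (simp add: a_minus_def P.r_neg)
  have "f (inv (chi d \<sigma>) \<odot>\<^bsub>T\<^esub> y \<ominus>\<^bsub>T\<^esub> perm_action K d M \<sigma> y) = \<zero>\<^bsub>P\<^esub>"
    if d: "d \<noteq> 0" and \<sigma>: "\<sigma> \<in> W d" and y: "y \<in> carrier T" for \<sigma> y
  proof -
    note p = weight_perm[OF d \<sigma>] and i = weight_inv[OF d \<sigma>]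
    note pl = perm_action_lin[OF M p]
    let ?f = "\<lambda>y\<in>carrier T. f ((\<lambda>y\<in>carrier T. inv (chi d \<sigma>) \<odot>\<^bsub>T\<^esub> y) y)"
    let ?g = "\<lambda>y\<in>carrier T. f (perm_action K d M \<sigma> y)"
    \<comment> \<open>The relators range over all tensors, whereas \<open>sk\<close> speaks of
      decomposable ones. Both sides are linear in the tensor, so agreement on decomposables is
      enough.\<close>
    have "?f = ?g"
    proof (rule generates_lin_eq[OF T P tensor_generates[OF M]])
      show "?f \<in> lin_maps K T P" by (rule lin_maps_compose[OF T lin_maps_scale[OF T i] f])
      show "?g \<in> lin_maps K T P" by (rule lin_maps_compose[OF T pl f])
      fix x assume "x \<in> tensor K d M ` words d M"
      then show "?f x = ?g x"
        using sk d \<sigma> i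
        by (auto simp: tensor_closed[OF M] perm_action_tensor[OF M p] fe permute_word_words[OF p]
            lin_maps_smult[OF f] skew_def)
    qed
    from fun_cong[OF this, of y] have "f (inv (chi d \<sigma>) \<odot>\<^bsub>T\<^esub> y) = f (perm_action K d M \<sigma> y)"
      using y by simp
    then show ?thesis
      using y i lin_maps_closed[OF pl y] lin_maps_closed[OF f] by (simp add: lin_maps_minus[OF T P f] diff)
  qed
  then have "f r = \<zero>\<^bsub>P\<^esub>" if "r \<in> chi_rels K W chi d M" for r
    using that by (auto simp: chi_rels_def split: if_splits)
  then have "N \<subseteq> {x \<in> carrier T. f x = z x}"
    using rels by (intro gen_submodule_least submodule_of_lin_eq[OF T P f z]) (auto simp: z_def)
  then have "\<exists>g \<in> lin_maps K (quot_module T N) P. \<forall>x\<in>carrier T. g (N +>\<^bsub>T\<^esub> x) = f x"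
    by (intro quot_factor[OF T N P f]) (auto simp: z_def)
  then show ?thesis
    unfolding chi_power_def chi_product_eq using fe tensor_closed[OF M] by metis
qed

end

end

section \<open>The comparison map\<close>

lemma multilinear_cong:
  assumes M: "module K M" and f: "multilinear K d M N f"
    and eq: "\<And>xs. xs \<in> words d M \<Longrightarrow> f xs = g xs"
  shows "multilinear K d M N g"
proof -
  interpret module K M by (rule M)
  show ?thesis
    using multilinear_closed[OF f] multilinear_add[OF f] multilinear_smult[OF f]
    by (intro multilinearI) (simp_all add: words_update eq[symmetric])
qed

subsection \<open>The pairing of decomposable tensors\<close>

text \<open>The unweighted pairing of two decomposable tensors. For the Gram matrix, the terms of
  \<open>d_chi\<close> are such products with the vectors permuted.\<close>

definition eval_prod :: "('k, 'r) ring_scheme \<Rightarrow> nat \<Rightarrow> 'a list \<Rightarrow> ('a \<Rightarrow> 'k) list \<Rightarrow> 'k" where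
  "eval_prod K d xs ys = (\<Otimes>\<^bsub>K\<^esub>i\<in>{..<d}. (ys ! i) (xs ! i))"

lemma eval_prod_closed:
  assumes "cring K" "xs \<in> words d M" "ys \<in> words d (dual K M)"
  shows "eval_prod K d xs ys \<in> carrier K"
proof -
  interpret cring K by fact
  show ?thesis
    using dual_closed[OF words_nth[OF assms(3)] words_nth[OF assms(2)]]
    by (auto simp: eval_prod_def intro!: finprod_closed)
qed

lemma eval_prod_permute:
  assumes K: "cring K" and t: "t permutes {1..d}" and xs: "xs \<in> words d M" and ys: "ys \<in> words d (dual K M)"
  shows "eval_prod K d (permute_word t xs) (permute_word t ys) = eval_prod K d xs ys"
proof -
  interpret cring K by fact
  let ?f = "\<lambda>i. inv' t (Suc i) - 1" and ?g = "\<lambda>i. t (Suc i) - 1"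
  note i = permutes_index[OF permutes_inv[OF t]]
  have fg: "?g (?f a) = a" if "a < d" for a
    using i[OF that] permutes_inverses[OF t] by simp
  have "inj_on ?f {..<d}" by (rule inj_on_inverseI[of _ ?g]) (use fg in simp)
  moreover have "?f ` {..<d} \<subseteq> {..<d}" using i(1) by blast
  ultimately have bij: "?f ` {..<d} = {..<d}" "inj_on ?f {..<d}"
    using endo_inj_surj[of "{..<d}" ?f] by auto
  have "eval_prod K d (permute_word t xs) (permute_word t ys) = (\<Otimes>\<^bsub>K\<^esub>i\<in>{..<d}. (ys ! ?f i) (xs ! ?f i))"
    unfolding eval_prod_def
    using dual_closed[OF words_nth[OF ys] words_nth[OF xs]] i(1) words_length[OF xs] words_length[OF ys]
    by (intro finprod_cong') (auto simp: permute_word_nth)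
  also have "\<dots> = (\<Otimes>\<^bsub>K\<^esub>i\<in>?f ` {..<d}. (ys ! i) (xs ! i))"
    using dual_closed[OF words_nth[OF ys] words_nth[OF xs]] bij
    by (intro finprod_reindex[symmetric]) (auto simp: bij(1) simp del: One_nat_def)
  finally show ?thesis by (simp only: bij(1) eval_prod_def)
qed

text \<open>A simultaneous permutation of vectors and forms only reorders the factors, so a
  permutation of the vectors can be traded for its inverse on the forms.\<close>

lemma eval_prod_swap:
  assumes K: "cring K" and t: "t permutes {1..d}" and xs: "xs \<in> words d M" and ys: "ys \<in> words d (dual K M)"
  shows "eval_prod K d (permute_word t xs) ys = eval_prod K d xs (permute_word (inv' t) ys)"
proof -
  note t' = permutes_inv[OF t]
  have "permute_word t (permute_word (inv' t) ys) = ys"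
    using permute_word_comp[of t ys "inv' t"] t t' words_length[OF ys] permutes_inv_o(1)[OF t] by simp
  then show ?thesis
    using eval_prod_permute[OF K t xs permute_word_words[OF t' ys]] by simp
qed

lemma eval_prod_multilinear_left:
  assumes "module K M" "ys \<in> words d (dual K M)"
  shows "multilinear K d M (ring_module K) (\<lambda>xs. eval_prod K d xs ys)"
  unfolding eval_prod_def
  using words_nth[OF assms(2)] by (intro prod_multilinear assms(1)) (simp add: dual_simps)

lemma eval_prod_multilinear_right:
  assumes M: "module K M" and xs: "xs \<in> words d M"
  shows "multilinear K d (dual K M) (ring_module K) (\<lambda>ys. eval_prod K d xs ys)"
proof (rule multilinear_cong[OF dual_is_module[OF M]])
  interpret module K M by (rule M)
  show "multilinear K d (dual K M) (ring_module K)
      (\<lambda>ys. \<Otimes>\<^bsub>K\<^esub>i\<in>{..<d}. (\<lambda>f\<in>carrier (dual K M). f (xs ! i)) (ys ! i))"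
    by (intro prod_multilinear dual_is_module M dual_eval_lin words_nth[OF xs])
  show "(\<Otimes>\<^bsub>K\<^esub>i\<in>{..<d}. (\<lambda>f\<in>carrier (dual K M). f (xs ! i)) (ys ! i)) = eval_prod K d xs ys"
    if ys: "ys \<in> words d (dual K M)" for ys
    unfolding eval_prod_def using words_nth[OF ys] dual_closed[OF words_nth[OF ys] words_nth[OF xs]]
    by (intro R.finprod_cong') auto
qed

lemma eval_prod_basis:
  assumes K: "cring K" and "length xs = d" "set xs \<subseteq> B" "length ys = d" "set ys \<subseteq> B"
    and s: "\<And>b c. b \<in> B \<Longrightarrow> c \<in> B \<Longrightarrow> s b c = (if b = c then \<one>\<^bsub>K\<^esub> else \<zero>\<^bsub>K\<^esub>)"
  shows "eval_prod K d xs (map s ys) = (if xs = ys then \<one>\<^bsub>K\<^esub> else \<zero>\<^bsub>K\<^esub>)"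
proof -
  interpret cring K by fact
  have B: "xs ! i \<in> B" "ys ! i \<in> B" if "i < d" for i using assms that by auto
  show ?thesis
  proof (cases "xs = ys")
    case True
    have "eval_prod K d xs (map s ys) = (\<Otimes>\<^bsub>K\<^esub>i\<in>{..<d}. \<one>\<^bsub>K\<^esub>)"
      unfolding eval_prod_def using assms B True by (intro finprod_cong') auto
    then show ?thesis using True by simp
  next
    case False
    then obtain i where i: "i < d" "xs ! i \<noteq> ys ! i" using assms nth_equalityI[of xs ys] by auto
    have "eval_prod K d xs (map s ys) = \<zero>\<^bsub>K\<^esub>"
      unfolding eval_prod_def using i assms B by (intro finprod_zero_factor[of _ i]) auto
    then show ?thesis using False by simp
  qed
qed

section \<open>Weighted sums over the permutations of one degree\<close>

context weight
begin

text \<open>The conventions in degree \<open>0\<close>, where \<open>W\<close> and \<open>chi\<close> are unconstrained, make all degrees uniform.\<close>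

definition perms :: "nat \<Rightarrow> (nat \<Rightarrow> nat) set" where
  "perms d = (if d = 0 then {id} else W d)"

definition wt :: "nat \<Rightarrow> (nat \<Rightarrow> nat) \<Rightarrow> 'k" where
  "wt d p = (if d = 0 then \<one> else chi d p)"

lemma perms_permutes: "p \<in> perms d \<Longrightarrow> p permutes {1..d}"
  using char_perm[OF is_cring omega_inv, of d p] by (auto simp: perms_def permutes_id split: if_splits)

lemma perms_id: "id \<in> perms d"
  using char_id[OF is_cring omega_inv, of d] by (simp add: perms_def)

lemma perms_comp: "p \<in> perms d \<Longrightarrow> t \<in> perms d \<Longrightarrow> p \<circ> t \<in> perms d"
  using char_comp_closed[OF is_cring omega_inv, of d p t] by (auto simp: perms_def)

lemma perms_inv: "p \<in> perms d \<Longrightarrow> inv' p \<in> perms d"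
  using char_inv_closed[OF is_cring omega_inv, of d p] by (auto simp: perms_def)

lemma perms_finite: "finite (perms d)"
  using perms_permutes by (intro finite_subset[OF _ finite_permutations[of "{1..d}"]]) auto

lemma wt_closed: "p \<in> perms d \<Longrightarrow> wt d p \<in> carrier K"
  using char_unit[OF is_cring omega_inv, of d p] by (auto simp: perms_def wt_def)

lemma wt_comp: "p \<in> perms d \<Longrightarrow> t \<in> perms d \<Longrightarrow> wt d (p \<circ> t) = wt d p \<otimes> wt d t"
  using char_comp[OF is_cring omega_inv, of d p t] by (auto simp: perms_def wt_def)

lemma wt_square: "p \<in> perms d \<Longrightarrow> wt d p \<otimes> wt d p = \<one>"
  using char_square[OF is_cring omega_inv, of d p] by (auto simp: perms_def wt_def)

text \<open>Both \<open>wt d p\<close> and \<open>wt d (inv' p)\<close> are inverse to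
  \<open>wt d p\<close>.\<close>

lemma wt_inv:
  assumes "p \<in> perms d"
  shows "wt d (inv' p) = wt d p"
proof -
  have "wt d p \<otimes> wt d (inv' p) = \<one>"
    using char_inv[OF is_cring omega_inv, of d p] assms by (auto simp: perms_def wt_def)
  then show ?thesis
    using wt_square[OF assms] wt_closed[OF assms] wt_closed[OF perms_inv[OF assms]]
    by (metis comm_inv_char)
qed

lemma skew_iff:
  assumes P: "module K P" and h: "\<And>xs. xs \<in> words d M \<Longrightarrow> h xs \<in> carrier P"
  shows "skew d M P h \<longleftrightarrow>
    (\<forall>p\<in>perms d. \<forall>xs\<in>words d M. h (permute_word p xs) = wt d p \<odot>\<^bsub>P\<^esub> h xs)"
proof (cases "d = 0")
  case True
  then show ?thesis using h module.smult_one[OF P] by (simp add: skew_def perms_def wt_def)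
next
  case False
  have "inv (chi d p) = chi d p" if "p \<in> W d" for p
    using that False wt_square[of p d] wt_closed[of p d] by (simp add: perms_def wt_def comm_inv_char)
  then show ?thesis using False by (simp add: skew_def perms_def wt_def)
qed

text \<open>Right translation by \<open>t\<close> permutes the index set, and since the weight of
  \<open>t\<close> squares to 1, \<open>wt d p\<close> can be rewritten as \<open>wt d t\<close>
  times the weight of \<open>p \<circ> t\<close>.\<close>

lemma sum_wt_shift:
  assumes t: "t \<in> perms d" and f: "\<And>p. p \<in> perms d \<Longrightarrow> f p \<in> carrier K"
  shows "(\<Oplus>p\<in>perms d. wt d p \<otimes> f (p \<circ> t)) = wt d t \<otimes> (\<Oplus>p\<in>perms d. wt d p \<otimes> f p)"
proof -
  note tp = perms_permutes[OF t]
  have inj: "inj_on (\<lambda>p. p \<circ> t) (perms d)"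
    using permutes_surj[OF tp] by (auto intro!: inj_onI simp: fun_eq_iff) (metis surj_def)
  have img: "(\<lambda>p. p \<circ> t) ` perms d = perms d"
    using perms_comp t inj by (intro endo_inj_surj perms_finite) auto
  have "(\<Oplus>p\<in>perms d. wt d p \<otimes> f (p \<circ> t)) = (\<Oplus>p\<in>perms d. wt d t \<otimes> (wt d (p \<circ> t) \<otimes> f (p \<circ> t)))"
  proof (intro finsum_cong' refl)
    fix p assume p: "p \<in> perms d"
    note c = wt_closed[OF p] wt_closed[OF t] f[OF perms_comp[OF p t]]
    have "wt d t \<otimes> (wt d (p \<circ> t) \<otimes> f (p \<circ> t)) = (wt d t \<otimes> wt d t) \<otimes> (wt d p \<otimes> f (p \<circ> t))"
      using c by (simp add: wt_comp[OF p t] m_ac)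
    then show "wt d p \<otimes> f (p \<circ> t) = wt d t \<otimes> (wt d (p \<circ> t) \<otimes> f (p \<circ> t))"
      using c wt_square[OF t] by simp
  qed (use t f wt_closed perms_comp in auto)
  also have "\<dots> = wt d t \<otimes> (\<Oplus>p\<in>perms d. wt d (p \<circ> t) \<otimes> f (p \<circ> t))"
    using t f wt_closed perms_comp by (intro finsum_rdistr[symmetric] perms_finite) auto
  also have "(\<Oplus>p\<in>perms d. wt d (p \<circ> t) \<otimes> f (p \<circ> t)) = (\<Oplus>p\<in>(\<lambda>p. p \<circ> t) ` perms d. wt d p \<otimes> f p)"
  proof (rule finsum_reindex[OF _ inj, symmetric])
    show "(\<lambda>p. wt d p \<otimes> f p) \<in> (\<lambda>p. p \<circ> t) ` perms d \<rightarrow> carrier K"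
      unfolding img using f wt_closed by auto
  qed
  finally show ?thesis by (simp only: img)
qed

text \<open>Inversion permutes the index set and, by \<open>wt_inv\<close>, does not change the
  weights.\<close>

lemma sum_wt_inv:
  assumes f: "\<And>p. p \<in> perms d \<Longrightarrow> f p \<in> carrier K"
  shows "(\<Oplus>p\<in>perms d. wt d p \<otimes> f (inv' p)) = (\<Oplus>p\<in>perms d. wt d p \<otimes> f p)"
proof -
  have ii: "inv' (inv' p) = p" if "p \<in> perms d" for p
    using permutes_inv_inv[OF perms_permutes[OF that]] .
  have inj: "inj_on inv' (perms d)" by (rule inj_on_inverseI[of _ inv']) (rule ii)
  have img: "inv' ` perms d = perms d"
    using perms_inv inj by (intro endo_inj_surj perms_finite) auto
  have "(\<Oplus>p\<in>perms d. wt d p \<otimes> f (inv' p)) = (\<Oplus>p\<in>perms d. wt d (inv' p) \<otimes> f (inv' p))"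
    using f wt_closed perms_inv by (intro finsum_cong') (auto simp: wt_inv)
  also have "\<dots> = (\<Oplus>p\<in>inv' ` perms d. wt d p \<otimes> f p)"
    using inj f wt_closed by (intro finsum_reindex[symmetric]) (auto simp: img)
  finally show ?thesis by (simp only: img)
qed

definition pairing :: "nat \<Rightarrow> 'a list \<Rightarrow> ('a \<Rightarrow> 'k) list \<Rightarrow> 'k" where
  "pairing d xs ys = (\<Oplus>p\<in>perms d. wt d p \<otimes> eval_prod K d (permute_word p xs) ys)"

text \<open>In the term of \<open>p\<close>, column \<open>j\<close> meets row
  \<open>inv' p j\<close>, which is where the permuted word takes its letter \<open>j\<close> from;
  the rest is the passage from positions counted from 1 to positions counted from 0. In degree 0 the
  only term is an empty product.\<close>

lemma pairing_d_chi:
  assumes xs: "xs \<in> words d M" and ys: "ys \<in> words d (dual K M)"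
  shows "pairing d xs ys = (if d = 0 then \<one> else d_chi K W chi d (gram xs ys))"
proof (cases "d = 0")
  case True
  then show ?thesis by (simp add: pairing_def perms_def wt_def eval_prod_def)
next
  case False
  have "(\<Otimes>j\<in>{1..d}. gram xs ys (inv' p j) j) = eval_prod K d (permute_word p xs) ys" if p: "p \<in> W d" for p
  proof -
    have pp: "p permutes {1..d}" using perms_permutes p False by (simp add: perms_def)
    note i = permutes_index[OF permutes_inv[OF pp]]
    have c: "(ys ! i) (xs ! (inv' p (Suc i) - 1)) \<in> carrier K" if "i < d" for i
      by (rule dual_closed[OF words_nth[OF ys that] words_nth[OF xs i(1)[OF that]]])
    have "{1..d} = Suc ` {..<d}" by (auto simp: image_iff Suc_le_eq gr0_conv_Suc)
    then have "(\<Otimes>j\<in>{1..d}. gram xs ys (inv' p j) j) = (\<Otimes>i\<in>{..<d}. gram xs ys (inv' p (Suc i)) (Suc i))"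
      using c by (simp only:, intro finprod_reindex) (auto simp: gram_def canon_form_def)
    also have "\<dots> = eval_prod K d (permute_word p xs) ys"
      unfolding eval_prod_def using c words_length[OF xs]
      by (intro finprod_cong') (auto simp: gram_def canon_form_def permute_word_nth)
    finally show ?thesis .
  qed
  moreover have "eval_prod K d (permute_word p xs) ys \<in> carrier K" if "p \<in> W d" for p
    using perms_permutes[of p d] that False
    by (intro eval_prod_closed[OF is_cring _ ys] permute_word_words xs) (auto simp: perms_def)
  ultimately show ?thesis
    using False wt_closed[of _ d]
    by (auto simp: pairing_def d_chi_def perms_def wt_def intro!: finsum_cong')
qed

context
  fixes d :: nat and M :: "('k, 'a, 'm) module_scheme"
  assumes M: "module K M"
begin

interpretation M: module K M by (rule M)

private lemma D: "module K (dual K M)" by (rule dual_is_module[OF M])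

private lemma ep_closed:
  assumes "xs \<in> words d M" "ys \<in> words d (dual K M)" "p \<in> perms d"
  shows "eval_prod K d (permute_word p xs) ys \<in> carrier K"
    and "eval_prod K d xs (permute_word p ys) \<in> carrier K"
  using assms permute_word_words[OF perms_permutes[OF assms(3)]]
  by (auto intro: eval_prod_closed[OF is_cring, where M = M])

lemma pairing_closed:
  assumes "xs \<in> words d M" "ys \<in> words d (dual K M)"
  shows "pairing d xs ys \<in> carrier K"
  unfolding pairing_def using ep_closed[OF assms] wt_closed by (intro finsum_closed) auto

text \<open>Restores the symmetry between vectors and forms: carrying \<open>p\<close> over to the
  forms inverts it, and the weighted sum does not notice inversion.\<close>

lemma pairing_alt:
  assumes xs: "xs \<in> words d M" and ys: "ys \<in> words d (dual K M)"
  shows "pairing d xs ys = (\<Oplus>p\<in>perms d. wt d p \<otimes> eval_prod K d xs (permute_word p ys))"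
proof -
  have "pairing d xs ys = (\<Oplus>p\<in>perms d. wt d p \<otimes> eval_prod K d xs (permute_word (inv' p) ys))"
    unfolding pairing_def using ep_closed[OF xs ys] wt_closed perms_inv
    by (intro finsum_cong') (auto simp: eval_prod_swap[OF is_cring perms_permutes xs ys])
  also have "\<dots> = (\<Oplus>p\<in>perms d. wt d p \<otimes> eval_prod K d xs (permute_word p ys))"
    by (rule sum_wt_inv) (rule ep_closed[OF xs ys])
  finally show ?thesis .
qed

lemma pairing_multilinear_left:
  assumes ys: "ys \<in> words d (dual K M)"
  shows "multilinear K d M (ring_module K) (\<lambda>xs. pairing d xs ys)"
  unfolding pairing_def
  by (intro multilinear_sum[OF M perms_finite wt_closed]
      multilinear_permute_word[OF perms_permutes eval_prod_multilinear_left[OF M ys]])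

lemma pairing_multilinear_right:
  assumes xs: "xs \<in> words d M"
  shows "multilinear K d (dual K M) (ring_module K) (\<lambda>ys. pairing d xs ys)"
  unfolding pairing_def
  by (intro multilinear_sum[OF D perms_finite wt_closed] eval_prod_multilinear_right[OF M]
      permute_word_words[OF perms_permutes xs])

lemma pairing_skew_left:
  assumes ys: "ys \<in> words d (dual K M)"
  shows "skew d M (ring_module K) (\<lambda>xs. pairing d xs ys)"
proof (subst skew_iff)
  show "\<forall>p\<in>perms d. \<forall>xs\<in>words d M. pairing d (permute_word p xs) ys = wt d p \<odot>\<^bsub>ring_module K\<^esub> pairing d xs ys"
  proof (intro ballI)
    fix t xs assume t: "t \<in> perms d" and xs: "xs \<in> words d M"
    have "pairing d (permute_word t xs) ys = (\<Oplus>p\<in>perms d. wt d p \<otimes> eval_prod K d (permute_word (p \<circ> t) xs) ys)"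
      unfolding pairing_def
      using ep_closed(1)[OF xs ys] wt_closed perms_comp t perms_permutes words_length[OF xs]
      by (intro finsum_cong') (auto simp: permute_word_comp)
    also have "\<dots> = wt d t \<otimes> pairing d xs ys"
      unfolding pairing_def by (rule sum_wt_shift[OF t]) (rule ep_closed(1)[OF xs ys])
    finally show "pairing d (permute_word t xs) ys = wt d t \<odot>\<^bsub>ring_module K\<^esub> pairing d xs ys" by simp
  qed
qed (use pairing_closed ys ring_module_is_module[OF is_cring] in auto)

text \<open>After \<open>pairing_alt\<close> the translation argument for vectors applies verbatim
  to forms. This is the compatibility with the relations for which the order-two property was
  established.\<close>

lemma pairing_skew_right:
  assumes xs: "xs \<in> words d M"
  shows "skew d (dual K M) (ring_module K) (\<lambda>ys. pairing d xs ys)"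
proof (subst skew_iff)
  show "\<forall>p\<in>perms d. \<forall>ys\<in>words d (dual K M).
      pairing d xs (permute_word p ys) = wt d p \<odot>\<^bsub>ring_module K\<^esub> pairing d xs ys"
  proof (intro ballI)
    fix t ys assume t: "t \<in> perms d" and ys: "ys \<in> words d (dual K M)"
    have "pairing d xs (permute_word t ys) = (\<Oplus>p\<in>perms d. wt d p \<otimes> eval_prod K d xs (permute_word (p \<circ> t) ys))"
      unfolding pairing_alt[OF xs permute_word_words[OF perms_permutes[OF t] ys]]
      using ep_closed(2)[OF xs ys] wt_closed perms_comp t perms_permutes words_length[OF ys]
      by (intro finsum_cong') (auto simp: permute_word_comp)
    also have "\<dots> = wt d t \<otimes> pairing d xs ys"
      unfolding pairing_alt[OF xs ys] by (rule sum_wt_shift[OF t]) (rule ep_closed(2)[OF xs ys])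
    finally show "pairing d xs (permute_word t ys) = wt d t \<odot>\<^bsub>ring_module K\<^esub> pairing d xs ys" by simp
  qed
qed (use pairing_closed xs ring_module_is_module[OF is_cring] in auto)

private abbreviation "P \<equiv> chi_power K W chi d M"
private abbreviation "P' \<equiv> chi_power K W chi d (dual K M)"

private lemma P: "module K P" "module K P'"
  by (intro chi_power_is_module M D)+

private lemma form:
  assumes ys: "ys \<in> words d (dual K M)"
  defines "f \<equiv> lin_ext K P (ring_module K) (words d M) (chi_product K W chi d M)
    (\<lambda>xs. if d = 0 then \<one> else d_chi K W chi d (gram xs ys))"
  shows form_dual: "f \<in> carrier (dual K P)"
    and form_apply: "\<And>xs. xs \<in> words d M \<Longrightarrow> f (chi_product K W chi d M xs) = pairing d xs ys"
proof -
  note R = ring_module_is_module[OF is_cring]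
  obtain g where g: "g \<in> lin_maps K P (ring_module K)"
    "\<And>xs. xs \<in> words d M \<Longrightarrow> g (chi_product K W chi d M xs) = pairing d xs ys"
    using chi_power_lift[OF M R pairing_multilinear_left[OF ys] pairing_skew_left[OF ys]] by blast
  have "f = g"
    unfolding f_def
    by (rule lin_ext_eq[OF P(1) R chi_product_generates[OF M] g(1)])
      (use g(2) pairing_d_chi[OF _ ys] in metis)
  then show "f \<in> carrier (dual K P)"
    "\<And>xs. xs \<in> words d M \<Longrightarrow> f (chi_product K W chi d M xs) = pairing d xs ys"
    using g by (auto simp: dual_simps)
qed

text \<open>Two lifts are nested. For fixed forms the pairing descends to a linear form on the power
  of \<open>M\<close>; this linear form depends multilinearly and skewly on the given forms, so the
  assignment descends again. Both properties of the outer map are tested on decomposable vectors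
  only.\<close>

lemma iota_deg:
  shows iota_deg_lin: "iota_deg K W chi d M \<in> lin_maps K P' (dual K P)"
    and iota_deg_apply: "\<And>xs ys. xs \<in> words d M \<Longrightarrow> ys \<in> words d (dual K M) \<Longrightarrow>
      iota_deg K W chi d M (chi_product K W chi d (dual K M) ys) (chi_product K W chi d M xs) =
        pairing d xs ys"
proof -
  define F where "F ys = lin_ext K P (ring_module K) (words d M) (chi_product K W chi d M)
    (\<lambda>xs. if d = 0 then \<one> else d_chi K W chi d (gram xs ys))" for ys
  note F = form[folded F_def]
  note R = ring_module_is_module[OF is_cring] and DP = dual_is_module[OF P(1)]
  interpret DP: module K "dual K P" by (rule DP)
  have ml: "multilinear K d (dual K M) (dual K P) F"
  proof (rule multilinear_into_dual[OF D P(1) chi_product_generates[OF M]])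
    show "multilinear K d (dual K M) (ring_module K) (\<lambda>ys. F ys (chi_product K W chi d M xs))"
      if "xs \<in> words d M" for xs
      by (rule multilinear_cong[OF D pairing_multilinear_right[OF that]]) (simp add: F(2) that)
  qed (rule F(1))
  have sk: "skew d (dual K M) (dual K P) F"
  proof (subst skew_iff[OF DP])
    show "\<forall>p\<in>perms d. \<forall>ys\<in>words d (dual K M). F (permute_word p ys) = wt d p \<odot>\<^bsub>dual K P\<^esub> F ys"
    proof (intro ballI)
      fix p ys assume p: "p \<in> perms d" and ys: "ys \<in> words d (dual K M)"
      note ys' = permute_word_words[OF perms_permutes[OF p] ys]
      show "F (permute_word p ys) = wt d p \<odot>\<^bsub>dual K P\<^esub> F ys"
      proof (rule generates_lin_eq[OF P(1) R chi_product_generates[OF M]])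
        show "F (permute_word p ys) \<in> lin_maps K P (ring_module K)"
          using F(1)[OF ys'] by (simp add: dual_simps)
        show "wt d p \<odot>\<^bsub>dual K P\<^esub> F ys \<in> lin_maps K P (ring_module K)"
          using DP.smult_closed[OF wt_closed[OF p] F(1)[OF ys]] by (simp add: dual_simps(1))
        fix z assume "z \<in> chi_product K W chi d M ` words d M"
        then obtain xs where xs: "xs \<in> words d M" "z = chi_product K W chi d M xs" by blast
        have "pairing d xs (permute_word p ys) = wt d p \<otimes> pairing d xs ys"
          using pairing_skew_right[OF xs(1)] skew_iff[OF R, of d "dual K M" "\<lambda>ys. pairing d xs ys"]
            pairing_closed[OF xs(1)] p ys by simp
        then show "F (permute_word p ys) z = (wt d p \<odot>\<^bsub>dual K P\<^esub> F ys) z"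
          using xs F(2) ys ys' chi_product_closed[OF M] by (simp add: dual_simps(4))
      qed
    qed
  qed (rule F(1))
  obtain g where g: "g \<in> lin_maps K P' (dual K P)"
    "\<And>ys. ys \<in> words d (dual K M) \<Longrightarrow> g (chi_product K W chi d (dual K M) ys) = F ys"
    using chi_power_lift[OF D DP ml sk] by blast
  have "iota_deg K W chi d M = g"
    unfolding iota_deg_def F_def[symmetric]
    by (rule lin_ext_eq[OF P(2) DP chi_product_generates[OF D] g])
  then show "iota_deg K W chi d M \<in> lin_maps K P' (dual K P)"
    "\<And>xs ys. xs \<in> words d M \<Longrightarrow> ys \<in> words d (dual K M) \<Longrightarrow>
      iota_deg K W chi d M (chi_product K W chi d (dual K M) ys) (chi_product K W chi d M xs) =
        pairing d xs ys"
    using g F(2) by auto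
qed

text \<open>Reduces identities between linear maps on the power to words over a generating set,
  later a basis or its dual basis. Other decomposable vectors follow by multilinearity.\<close>

lemma chi_power_lin_eq:
  assumes S: "generates K M S" and N: "module K N" and f: "f \<in> lin_maps K P N" and g: "g \<in> lin_maps K P N"
    and eq: "\<And>xs. length xs = d \<Longrightarrow> set xs \<subseteq> S \<Longrightarrow> f (chi_product K W chi d M xs) = g (chi_product K W chi d M xs)"
  shows "f = g"
proof (rule generates_lin_eq[OF P(1) N chi_product_generates[OF M] f g])
  fix z assume "z \<in> chi_product K W chi d M ` words d M"
  then show "f z = g z"
    using multilinear_eq[OF M N multilinear_lin_comp[OF chi_product_multilinear[OF M] f]
        multilinear_lin_comp[OF chi_product_multilinear[OF M] g] S eq]
    by blast
qed

end

end

section \<open>Inverting the comparison map in one degree\<close>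

lemma Q_ring_sum_one_unit:
  assumes K: "cring K" and Q: "Q_ring K" and A: "finite A" "A \<noteq> {}"
  shows "(\<Oplus>\<^bsub>K\<^esub>a\<in>A. \<one>\<^bsub>K\<^esub>) \<in> Units K"
proof -
  interpret cring K by (rule K)
  obtain h where h: "h \<in> ring_hom rat_ring K" using Q by (auto simp: Q_ring_def)
  have hc: "h x \<in> carrier K" and hm: "h (x * y) = h x \<otimes>\<^bsub>K\<^esub> h y" and ha: "h (x + y) = h x \<oplus>\<^bsub>K\<^esub> h y"
    and h1: "h 1 = \<one>\<^bsub>K\<^esub>" for x y
    using h by (auto simp: ring_hom_def rat_ring_def)
  have h0: "h 0 = \<zero>\<^bsub>K\<^esub>" using ha[of 0 0] hc[of 0] by (simp add: add.r_cancel_one)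
  have "(\<Oplus>\<^bsub>K\<^esub>a\<in>A. \<one>\<^bsub>K\<^esub>) = h (of_nat (card A))"
    using A(1)
  proof (induction A rule: finite_induct)
    case (insert a A)
    then show ?case using ha[of 1 "of_nat (card A)"] h1 by simp
  qed (simp add: h0)
  \<comment> \<open>The inverse is the image of the reciprocal rational number, available because
    \<open>A\<close> is nonempty.\<close>
  moreover have "h (of_nat (card A)) \<otimes>\<^bsub>K\<^esub> h (1 / of_nat (card A)) = \<one>\<^bsub>K\<^esub>"
    using A hm[of "of_nat (card A)" "1 / of_nat (card A)"] h1 by simp
  ultimately show ?thesis
    using hc unfolding Units_def
    by (auto simp: m_comm intro!: bexI[of _ "h (1 / of_nat (card A))"])
qed

context weight
begin

text \<open>The coefficient of \<open>v J\<close> adds up the weights of all permutations carrying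
  \<open>I\<close> to \<open>J\<close>. After exchanging the sums, each \<open>p\<close> selects the
  single word \<open>permute_word p I\<close> and contributes the squared weight of \<open>p\<close>
  times \<open>v I\<close>, that is, one copy of \<open>v I\<close>.\<close>

lemma orbit_sum:
  fixes B :: "'a set" and d :: nat
  defines "T \<equiv> {I. length I = d \<and> set I \<subseteq> B}"
  assumes P: "module K P" and B: "finite B" and I: "I \<in> T"
    and v: "\<And>J. J \<in> T \<Longrightarrow> v J \<in> carrier P"
    and sk: "\<And>p. p \<in> perms d \<Longrightarrow> v (permute_word p I) = wt d p \<odot>\<^bsub>P\<^esub> v I"
  shows "(\<Oplus>\<^bsub>P\<^esub>J\<in>T. (\<Oplus>p\<in>perms d. wt d p \<otimes> (if permute_word p I = J then \<one> else \<zero>)) \<odot>\<^bsub>P\<^esub> v J) =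
    (\<Oplus>p\<in>perms d. \<one>) \<odot>\<^bsub>P\<^esub> v I"
proof -
  interpret P: module K P by (rule P)
  have T: "finite T" using finite_lists_length_eq[OF B, of d] by (simp add: T_def conj_commute)
  have pT: "permute_word p I \<in> T" if "p \<in> perms d" for p
    using I permutes_index[OF permutes_inv[OF perms_permutes[OF that]]]
    by (fastforce simp: T_def in_set_conv_nth permute_word_nth)
  have "(\<Oplus>\<^bsub>P\<^esub>J\<in>T. (\<Oplus>p\<in>perms d. wt d p \<otimes> (if permute_word p I = J then \<one> else \<zero>)) \<odot>\<^bsub>P\<^esub> v J)
      = (\<Oplus>\<^bsub>P\<^esub>J\<in>T. \<Oplus>\<^bsub>P\<^esub>p\<in>perms d. if J = permute_word p I then wt d p \<odot>\<^bsub>P\<^esub> v J else \<zero>\<^bsub>P\<^esub>)"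
  proof (intro P.M.finsum_cong' refl)
    fix J assume J: "J \<in> T"
    have "(\<Oplus>p\<in>perms d. wt d p \<otimes> (if permute_word p I = J then \<one> else \<zero>)) \<odot>\<^bsub>P\<^esub> v J =
        (\<Oplus>\<^bsub>P\<^esub>p\<in>perms d. (wt d p \<otimes> (if permute_word p I = J then \<one> else \<zero>)) \<odot>\<^bsub>P\<^esub> v J)"
      using wt_closed v[OF J] by (intro P.finsum_smult_rdistr perms_finite) auto
    also have "\<dots> = (\<Oplus>\<^bsub>P\<^esub>p\<in>perms d. if J = permute_word p I then wt d p \<odot>\<^bsub>P\<^esub> v J else \<zero>\<^bsub>P\<^esub>)"
      using wt_closed v[OF J] by (intro P.M.finsum_cong') auto
    finally show "(\<Oplus>p\<in>perms d. wt d p \<otimes> (if permute_word p I = J then \<one> else \<zero>)) \<odot>\<^bsub>P\<^esub> v J =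
      (\<Oplus>\<^bsub>P\<^esub>p\<in>perms d. if J = permute_word p I then wt d p \<odot>\<^bsub>P\<^esub> v J else \<zero>\<^bsub>P\<^esub>)" .
  qed (use wt_closed v in \<open>auto intro!: P.M.finsum_closed\<close>)
  also have "\<dots> = (\<Oplus>\<^bsub>P\<^esub>p\<in>perms d. \<Oplus>\<^bsub>P\<^esub>J\<in>T. if J = permute_word p I then wt d p \<odot>\<^bsub>P\<^esub> v J else \<zero>\<^bsub>P\<^esub>)"
    using wt_closed v by (intro P.M.finsum_swap T perms_finite) auto
  also have "\<dots> = (\<Oplus>\<^bsub>P\<^esub>p\<in>perms d. \<one> \<odot>\<^bsub>P\<^esub> v I)"
  proof (intro P.M.finsum_cong' refl)
    fix p assume p: "p \<in> perms d"
    have "(\<Oplus>\<^bsub>P\<^esub>J\<in>T. if J = permute_word p I then wt d p \<odot>\<^bsub>P\<^esub> v J else \<zero>\<^bsub>P\<^esub>) =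
        wt d p \<odot>\<^bsub>P\<^esub> v (permute_word p I)"
      using wt_closed[OF p] v by (intro P.finsum_delta[OF T pT[OF p]]) auto
    also have "\<dots> = (wt d p \<otimes> wt d p) \<odot>\<^bsub>P\<^esub> v I"
      using wt_closed[OF p] v[OF I] by (simp add: sk[OF p] P.smult_assoc1)
    finally show "(\<Oplus>\<^bsub>P\<^esub>J\<in>T. if J = permute_word p I then wt d p \<odot>\<^bsub>P\<^esub> v J else \<zero>\<^bsub>P\<^esub>) = \<one> \<odot>\<^bsub>P\<^esub> v I"
      by (simp only: wt_square[OF p])
  qed (use v I in auto)
  also have "\<dots> = (\<Oplus>p\<in>perms d. \<one>) \<odot>\<^bsub>P\<^esub> v I"
    using v[OF I] by (intro P.finsum_smult_rdistr[symmetric] perms_finite) auto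
  finally show ?thesis .
qed

lemma iota_deg_bij:
  fixes E :: "('k, 'e, 'm) module_scheme"
  assumes Q: "Q_ring K" and E: "module K E" and fb: "has_finite_basis K E"
  shows "bij_betw (iota_deg K W chi d E) (carrier (chi_power K W chi d (dual K E)))
    (carrier (dual K (chi_power K W chi d E)))"
proof -
  obtain B s where B: "finite B" "B \<subseteq> carrier E" and s: "\<And>b. b \<in> B \<Longrightarrow> s b \<in> carrier (dual K E)"
    and s_delta: "\<And>b c. b \<in> B \<Longrightarrow> c \<in> B \<Longrightarrow> s b c = (if b = c then \<one> else \<zero>)"
    and expand: "\<And>x. x \<in> carrier E \<Longrightarrow> x = (\<Oplus>\<^bsub>E\<^esub>b\<in>B. s b x \<odot>\<^bsub>E\<^esub> b)"
    by (rule dual_basis[OF E fb]) (rule that, assumption+)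
  define T where "T = {I. length I = d \<and> set I \<subseteq> B}"
  have T: "finite T" using finite_lists_length_eq[OF B(1), of d] by (simp add: T_def conj_commute)
  note E' = dual_is_module[OF E] and R = ring_module_is_module[OF is_cring]
  define P P' where "P = chi_power K W chi d E" and "P' = chi_power K W chi d (dual K E)"
  define e e' where "e = chi_product K W chi d E" and "e' = chi_product K W chi d (dual K E)"
  define \<iota> where "\<iota> = iota_deg K W chi d E"
  have P: "module K P" "module K P'" "module K (dual K P)"
    unfolding P_def P'_def by (intro chi_power_is_module dual_is_module E E')+
  interpret P': module K P' by (rule P)
  interpret DP: module K "dual K P" by (rule P)
  have Tw: "J \<in> words d E" "map s J \<in> words d (dual K E)" if "J \<in> T" for J
    using that B(2) s by (auto simp: T_def words_def)
  have ec: "e J \<in> carrier P" "e' (map s J) \<in> carrier P'" if "J \<in> T" for J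
    unfolding e_def P_def e'_def P'_def using Tw[OF that] chi_product_closed E E' by blast+
  have \<iota>: "\<iota> \<in> lin_maps K P' (dual K P)" unfolding \<iota>_def P_def P'_def by (rule iota_deg_lin[OF E])
  have \<iota>e: "\<iota> (e' ys) (e xs) = pairing d xs ys" if "xs \<in> words d E" "ys \<in> words d (dual K E)" for xs ys
    unfolding \<iota>_def e_def e'_def by (rule iota_deg_apply[OF E that])
  define n where "n = (\<Oplus>p\<in>perms d. \<one>)"
  have n: "n \<in> Units K"
    unfolding n_def using perms_id by (intro Q_ring_sum_one_unit is_cring Q perms_finite) auto
  define q where "q I J = (\<Oplus>p\<in>perms d. wt d p \<otimes> (if permute_word p I = J then \<one> else \<zero>))" for I J :: "'e list"
  have pT: "permute_word p I \<in> T" if "p \<in> perms d" "I \<in> T" for p I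
    using that(2) permutes_index[OF permutes_inv[OF perms_permutes[OF that(1)]]]
    by (fastforce simp: T_def in_set_conv_nth permute_word_nth)
  have ep: "eval_prod K d I (map s J) = (if I = J then \<one> else \<zero>)" if "I \<in> T" "J \<in> T" for I J
    by (rule eval_prod_basis[OF is_cring, where B = B]) (use that s_delta in \<open>auto simp: T_def\<close>)
  have pair_q: "pairing d I (map s J) = q I J" if "I \<in> T" "J \<in> T" for I J
    unfolding pairing_def q_def
    using that pT wt_closed by (intro finsum_cong') (auto simp: ep)
  \<comment> \<open>Together with \<open>pair_q\<close> this shows that the matrix of the pairing on
    basis words is symmetric. The two readings let \<open>orbit_sum\<close> handle both composites,
    one with a fixed vector word and one with a fixed form word.\<close>
  have pair_q': "pairing d I (map s J) = q J I" if "I \<in> T" "J \<in> T" for I J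
  proof -
    have "permute_word p (map s J) = map s (permute_word p J)" if "p \<in> perms d" for p
      using permute_word_map[of p J s] perms_permutes[OF that] \<open>J \<in> T\<close> by (simp add: T_def)
    then show ?thesis
      unfolding pairing_alt[OF E Tw(1)[OF that(1)] Tw(2)[OF that(2)]] q_def
      using that pT wt_closed by (intro finsum_cong') (auto simp: ep)
  qed
  have sk: "e (permute_word p J) = wt d p \<odot>\<^bsub>P\<^esub> e J" if "p \<in> perms d" "J \<in> words d E" for p J
    using chi_product_skew[OF E, of d] skew_iff[OF P(1), of d E e] chi_product_closed[OF E] that
    by (simp add: e_def P_def)
  have sk': "e' (permute_word p J) = wt d p \<odot>\<^bsub>P'\<^esub> e' J" if "p \<in> perms d" "J \<in> words d (dual K E)" for p J
    using chi_product_skew[OF E', of d] skew_iff[OF P(2), of d "dual K E" e'] chi_product_closed[OF E'] that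
    by (simp add: e'_def P'_def)
  have genE: "generates K E B" by (rule basis_generates[OF E B s expand])
  have genE': "generates K (dual K E) (s ` B)" by (rule dual_basis_generates[OF E B s expand])
  have eqP: "f = g"
    if "f \<in> lin_maps K P (ring_module K)" "g \<in> lin_maps K P (ring_module K)"
      "\<And>xs. length xs = d \<Longrightarrow> set xs \<subseteq> B \<Longrightarrow> f (e xs) = g (e xs)" for f g
    using that unfolding P_def e_def by (rule chi_power_lin_eq[OF E genE R])
  have eqP': "f = g"
    if "f \<in> lin_maps K P' P'" "g \<in> lin_maps K P' P'"
      "\<And>ys. length ys = d \<Longrightarrow> set ys \<subseteq> s ` B \<Longrightarrow> f (e' ys) = g (e' ys)" for f g
    using that(1,2,3) chi_power_lin_eq[OF E' genE' P(2), of f d g] by (simp add: P'_def[symmetric] e'_def[symmetric])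
  \<comment> \<open>The inverse up to the factor \<open>n\<close>, so that the division can wait
    until both composites are known.\<close>
  define r where "r f = (\<Oplus>\<^bsub>P'\<^esub>J\<in>T. f (e J) \<odot>\<^bsub>P'\<^esub> e' (map s J))" for f
  have fc: "f (e J) \<in> carrier K" if "f \<in> carrier (dual K P)" "J \<in> T" for f J
    by (rule dual_closed[OF that(1) ec(1)[OF that(2)]])
  have rc: "r f \<in> carrier P'" if "f \<in> carrier (dual K P)" for f
    unfolding r_def using fc[OF that] ec(2) by (intro P'.M.finsum_closed) auto
  have r\<iota>: "r (\<iota> y) = n \<odot>\<^bsub>P'\<^esub> y" if y: "y \<in> carrier P'" for y
  proof -
    \<comment> \<open>The composite of \<open>r\<close> and \<open>\<iota>\<close> is assembled from
      evaluations, scalings of a fixed vector and finite sums. Its linearity is then automatic, and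
      \<open>eqP'\<close> reduces the claim to words in the dual basis.\<close>
    let ?h = "\<lambda>J. \<lambda>y\<in>carrier P'. (\<lambda>y\<in>carrier P'. (\<lambda>f\<in>carrier (dual K P). f (e J)) (\<iota> y)) y \<odot>\<^bsub>P'\<^esub> e' (map s J)"
    let ?f = "\<lambda>y\<in>carrier P'. \<Oplus>\<^bsub>P'\<^esub>J\<in>T. ?h J y" and ?g = "\<lambda>y\<in>carrier P'. n \<odot>\<^bsub>P'\<^esub> y"
    have f: "?f \<in> lin_maps K P' P'"
      by (intro lin_maps_sum[OF P(2,2) T] lin_maps_smult_vector[OF P(2,2)] lin_maps_compose[OF P(2) \<iota>]
          dual_eval_lin P(1) ec)
    have g: "?g \<in> lin_maps K P' P'" by (intro lin_maps_scale P(2) Units_closed n)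
    have fr: "?f y = r (\<iota> y)" if "y \<in> carrier P'" for y
      unfolding r_def using that fc[OF lin_maps_closed[OF \<iota> that]] ec lin_maps_closed[OF \<iota> that]
      by (auto intro!: P'.M.finsum_cong')
    have "?f = ?g"
    proof (rule eqP'[OF f g])
      fix ys assume ys: "length ys = d" "set ys \<subseteq> s ` B"
      \<comment> \<open>Words over the dual basis are pulled back to words over \<open>B\<close>,
        since \<open>T\<close> and \<open>q\<close> are indexed by the latter.\<close>
      then have "ys \<in> map s ` lists B" by (simp add: lists_image[symmetric] in_lists_conv_set subset_iff)
      then obtain I where "ys = map s I" "I \<in> lists B" by (rule imageE)
      then have I: "I \<in> T" "ys = map s I" using ys(1) by (auto simp: T_def in_lists_conv_set)
      note eI = ec(2)[OF I(1)]
      have "r (\<iota> (e' (map s I))) = (\<Oplus>\<^bsub>P'\<^esub>J\<in>T. q I J \<odot>\<^bsub>P'\<^esub> e' (map s J))"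
        unfolding r_def using I Tw ec wt_closed fc[OF lin_maps_closed[OF \<iota> eI]]
        by (intro P'.M.finsum_cong') (auto simp: \<iota>e pair_q'[symmetric])
      also have "\<dots> = n \<odot>\<^bsub>P'\<^esub> e' (map s I)"
        unfolding q_def n_def T_def
        using I(1) ec(2) sk'[OF _ Tw(2)[OF I(1)]] permute_word_map[of _ I s] perms_permutes
        by (intro orbit_sum[OF P(2) B(1)]) (auto simp: T_def)
      finally show "?f (e' ys) = ?g (e' ys)" using fr[OF eI] eI I by simp
    qed
    from fun_cong[OF this, of y] show ?thesis using fr[OF y] y by simp
  qed
  have \<iota>r: "\<iota> (r f) = n \<odot>\<^bsub>dual K P\<^esub> f" if f: "f \<in> carrier (dual K P)" for f
  proof (rule eqP)
    show "\<iota> (r f) \<in> lin_maps K P (ring_module K)"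
      using lin_maps_closed[OF \<iota> rc[OF f]] by (simp add: dual_simps(1))
    show "n \<odot>\<^bsub>dual K P\<^esub> f \<in> lin_maps K P (ring_module K)"
      using DP.smult_closed[OF Units_closed[OF n] f] by (simp add: dual_simps(1))
    fix I assume "length I = d" "set I \<subseteq> B"
    then have I: "I \<in> T" by (simp add: T_def)
    have fl: "f \<in> lin_maps K P (ring_module K)" using f by (simp add: dual_simps(1))
    have \<iota>c: "\<iota> (e' (map s J)) \<in> carrier (dual K P)" if "J \<in> T" for J
      by (rule lin_maps_closed[OF \<iota> ec(2)[OF that]])
    have "\<iota> (r f) = (\<Oplus>\<^bsub>dual K P\<^esub>J\<in>T. \<iota> (f (e J) \<odot>\<^bsub>P'\<^esub> e' (map s J)))"
      unfolding r_def using fc[OF f] ec by (intro lin_maps_finsum[OF P(2,3) \<iota> T]) auto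
    then have "\<iota> (r f) (e I) = (\<Oplus>\<^bsub>dual K P\<^esub>J\<in>T. \<iota> (f (e J) \<odot>\<^bsub>P'\<^esub> e' (map s J))) (e I)"
      by simp
    also have "\<dots> = (\<Oplus>J\<in>T. \<iota> (f (e J) \<odot>\<^bsub>P'\<^esub> e' (map s J)) (e I))"
      using fc[OF f] ec I by (intro dual_finsum_apply[OF P(1) T] lin_maps_closed[OF \<iota>]) auto
    also have "\<dots> = (\<Oplus>J\<in>T. q I J \<odot>\<^bsub>ring_module K\<^esub> f (e J))"
    proof (intro finsum_cong' refl)
      fix J assume J: "J \<in> T"
      have "\<iota> (f (e J) \<odot>\<^bsub>P'\<^esub> e' (map s J)) (e I) = f (e J) \<otimes> \<iota> (e' (map s J)) (e I)"
        using fc[OF f J] ec[OF J] ec[OF I] by (simp add: lin_maps_smult[OF \<iota>] dual_simps(4))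
      moreover have "\<iota> (e' (map s J)) (e I) = q I J" using Tw I J by (simp add: \<iota>e pair_q)
      moreover have "q I J \<in> carrier K" using dual_closed[OF \<iota>c[OF J] ec(1)[OF I]] calculation(2) by simp
      ultimately show "\<iota> (f (e J) \<odot>\<^bsub>P'\<^esub> e' (map s J)) (e I) = q I J \<odot>\<^bsub>ring_module K\<^esub> f (e J)"
        using fc[OF f J] by (simp add: m_comm)
    next
      show "(\<lambda>J. q I J \<odot>\<^bsub>ring_module K\<^esub> f (e J)) \<in> T \<rightarrow> carrier K"
        using fc[OF f] wt_closed by (auto simp: q_def intro!: finsum_closed m_closed)
    qed
    \<comment> \<open>Now the family in \<open>orbit_sum\<close> consists of the scalars
      \<open>f (e J)\<close>, with \<open>K\<close> as a module over itself. It inherits the skew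
      rule from \<open>e\<close> by linearity of \<open>f\<close>.\<close>
    also have "\<dots> = n \<odot>\<^bsub>ring_module K\<^esub> f (e I)"
    proof -
      have "(\<Oplus>\<^bsub>ring_module K\<^esub>J\<in>T. q I J \<odot>\<^bsub>ring_module K\<^esub> f (e J)) = n \<odot>\<^bsub>ring_module K\<^esub> f (e I)"
        unfolding q_def n_def T_def
        using I fc[OF f] sk[OF _ Tw(1)[OF I]] lin_maps_smult[OF fl wt_closed ec(1)[OF I]]
        by (intro orbit_sum[OF R B(1)]) (auto simp: T_def)
      then show ?thesis by (simp only: finsum_ring_module)
    qed
    also have "\<dots> = (n \<odot>\<^bsub>dual K P\<^esub> f) (e I)" using ec(1)[OF I] by (simp add: dual_simps(4))
    finally show "\<iota> (r f) (e I) = (n \<odot>\<^bsub>dual K P\<^esub> f) (e I)" .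
  qed
  have nn: "inv n \<in> carrier K" "n \<in> carrier K" "inv n \<otimes> n = \<one>" using n by auto
  have "bij_betw \<iota> (carrier P') (carrier (dual K P))"
  proof (rule bij_betw_byWitness[where f' = "\<lambda>f. inv n \<odot>\<^bsub>P'\<^esub> r f"])
    show "\<forall>y\<in>carrier P'. inv n \<odot>\<^bsub>P'\<^esub> r (\<iota> y) = y"
      using nn by (simp add: r\<iota> P'.smult_assoc1[symmetric])
    show "\<forall>f\<in>carrier (dual K P). \<iota> (inv n \<odot>\<^bsub>P'\<^esub> r f) = f"
      using nn rc by (simp add: lin_maps_smult[OF \<iota>] \<iota>r DP.smult_assoc1[symmetric])
    show "\<iota> ` carrier P' \<subseteq> carrier (dual K P)" using lin_maps_closed[OF \<iota>] by blast
    show "(\<lambda>f. inv n \<odot>\<^bsub>P'\<^esub> r f) ` carrier (dual K P) \<subseteq> carrier P'" using nn rc by auto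
  qed
  then show ?thesis by (simp add: \<iota>_def P_def P'_def)
qed

end

subsection \<open>Graded duals and functoriality\<close>

lemma dsum_map_lin:
  assumes K: "cring K" and M: "\<And>i. i \<in> I \<Longrightarrow> module K (M i)" and N: "\<And>i. i \<in> I \<Longrightarrow> module K (N i)"
    and h: "\<And>i. i \<in> I \<Longrightarrow> h i \<in> lin_maps K (M i) (N i)"
  shows "dsum_map I M h \<in> lin_maps K (dsum I M) (dsum I N)"
  unfolding dsum_map_def
proof (rule lin_maps_restrictI)
  show "module K (dsum I M)" by (rule dsum_is_module[OF K M])
  fix f assume f: "f \<in> carrier (dsum I M)"
  have "{i \<in> I. (\<lambda>i\<in>I. h i (f i)) i \<noteq> \<zero>\<^bsub>N i\<^esub>} \<subseteq> {i \<in> I. f i \<noteq> \<zero>\<^bsub>M i\<^esub>}"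
    using lin_maps_zero[OF M N h] by auto
  moreover have "finite {i \<in> I. f i \<noteq> \<zero>\<^bsub>M i\<^esub>}" using f by (simp add: dsum_simps)
  ultimately have "finite {i \<in> I. (\<lambda>i\<in>I. h i (f i)) i \<noteq> \<zero>\<^bsub>N i\<^esub>}" by (rule finite_subset)
  then show "(\<lambda>i\<in>I. h i (f i)) \<in> carrier (dsum I N)"
    using dsum_mem[OF f] lin_maps_closed[OF h] by (intro dsum_carrierI) simp_all
  show "(\<lambda>i\<in>I. h i ((f \<oplus>\<^bsub>dsum I M\<^esub> g) i)) = (\<lambda>i\<in>I. h i (f i)) \<oplus>\<^bsub>dsum I N\<^esub> (\<lambda>i\<in>I. h i (g i))"
    if g: "g \<in> carrier (dsum I M)" for g
    using dsum_mem[OF f] dsum_mem[OF g] lin_maps_add[OF h] by (auto simp: dsum_simps(3) intro!: restrict_ext)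
  show "(\<lambda>i\<in>I. h i ((a \<odot>\<^bsub>dsum I M\<^esub> f) i)) = a \<odot>\<^bsub>dsum I N\<^esub> (\<lambda>i\<in>I. h i (f i))"
    if a: "a \<in> carrier K" for a
    using dsum_mem[OF f] lin_maps_smult[OF h a]
    by (auto simp: dsum_simps(4) intro!: restrict_ext)
qed

lemma dsum_map_iso:
  assumes K: "cring K" and M: "\<And>i. i \<in> I \<Longrightarrow> module K (M i)" and N: "\<And>i. i \<in> I \<Longrightarrow> module K (N i)"
    and h: "\<And>i. i \<in> I \<Longrightarrow> h i \<in> lin_maps K (M i) (N i)"
    and bij: "\<And>i. i \<in> I \<Longrightarrow> bij_betw (h i) (carrier (M i)) (carrier (N i))"
  shows "dsum_map I M h \<in> lin_isos K (dsum I M) (dsum I N)"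
proof -
  have lin: "dsum_map I M h \<in> lin_maps K (dsum I M) (dsum I N)" by (rule dsum_map_lin[OF K M N h])
  have "inj_on (dsum_map I M h) (carrier (dsum I M))"
  proof (rule inj_onI)
    fix f g assume f: "f \<in> carrier (dsum I M)" and g: "g \<in> carrier (dsum I M)"
      and eq: "dsum_map I M h f = dsum_map I M h g"
    show "f = g"
    proof (rule extensionalityI[OF dsum_extensional[OF f] dsum_extensional[OF g]])
      fix i assume i: "i \<in> I"
      have "h i (f i) = h i (g i)" using fun_cong[OF eq, of i] f g i by (simp add: dsum_map_def)
      then show "f i = g i"
        using bij[OF i] dsum_mem[OF f i] dsum_mem[OF g i] by (auto simp: bij_betw_def dest: inj_onD)
    qed
  qed
  moreover have "carrier (dsum I N) \<subseteq> dsum_map I M h ` carrier (dsum I M)"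
  proof
    fix g assume g: "g \<in> carrier (dsum I N)"
    define f where "f = (\<lambda>i\<in>I. inv_into (carrier (M i)) (h i) (g i))"
    have f: "f i \<in> carrier (M i)" "h i (f i) = g i" if "i \<in> I" for i
      using bij[OF that] dsum_mem[OF g that] that
      by (simp_all add: f_def bij_betw_def inv_into_into f_inv_into_f)
    \<comment> \<open>Preimages are taken componentwise. Injectivity forces the preimage of 0 to be
      0, so finite support survives.\<close>
    have "{i \<in> I. f i \<noteq> \<zero>\<^bsub>M i\<^esub>} \<subseteq> {i \<in> I. g i \<noteq> \<zero>\<^bsub>N i\<^esub>}"
    proof (intro subsetI CollectI conjI; clarify)
      fix i assume i: "i \<in> I" "f i \<noteq> \<zero>\<^bsub>M i\<^esub>" "g i = \<zero>\<^bsub>N i\<^esub>"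
      have "\<zero>\<^bsub>M i\<^esub> \<in> carrier (M i)"
        using module_abelian_group[OF M[OF i(1)]] by (simp add: abelian_groupE(2))
      moreover have "h i (f i) = h i \<zero>\<^bsub>M i\<^esub>"
        using i f(2)[OF i(1)] lin_maps_zero[OF M N h] by simp
      ultimately show False
        using bij[OF i(1)] f(1)[OF i(1)] i(2) by (auto simp: bij_betw_def dest: inj_onD)
    qed
    moreover have "finite {i \<in> I. g i \<noteq> \<zero>\<^bsub>N i\<^esub>}" using g by (simp add: dsum_simps)
    ultimately have "finite {i \<in> I. f i \<noteq> \<zero>\<^bsub>M i\<^esub>}" by (rule finite_subset)
    then have fM: "f \<in> carrier (dsum I M)"
      using f by (intro dsum_carrierI) (simp_all add: f_def)
    moreover have "dsum_map I M h f = g"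
      using fM f dsum_extensional[OF g] by (intro extensionalityI[of _ I]) (simp_all add: dsum_map_def)
    ultimately show "g \<in> dsum_map I M h ` carrier (dsum I M)" by blast
  qed
  ultimately show ?thesis
    using lin lin_maps_closed[OF lin] by (auto simp: lin_isos_def bij_betw_def)
qed

lemma gr_dual_is_module:
  assumes "cring K" "\<And>d. module K (M d)"
  shows "module K (gr_dual K M)"
  unfolding gr_dual_def by (intro dsum_is_module assms dual_is_module)

context
  fixes K :: "('k, 'r) ring_scheme" and M :: "'i \<Rightarrow> ('k, 'a, 'm) module_scheme"
  assumes K: "cring K" and M: "\<And>d. module K (M d)"
begin

interpretation K: cring K by (rule K)

private abbreviation "S \<equiv> dsum UNIV M"

private lemma S: "module K S" by (rule dsum_is_module[OF K M])

interpretation S: module K S by (rule S)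

interpretation D: module K "gr_dual K M" by (rule gr_dual_is_module[OF K M])

private lemma comp_closed: "f \<in> carrier (gr_dual K M) \<Longrightarrow> z \<in> carrier S \<Longrightarrow> f d (z d) \<in> carrier K"
  using dsum_mem[of f UNIV "\<lambda>d. dual K (M d)" d] dsum_mem[of z UNIV M d]
    dual_closed[of "f d" K "M d" "z d"]
  by (simp add: gr_dual_def)

private lemma comp_zero: "f \<in> carrier (gr_dual K M) \<Longrightarrow> f d \<zero>\<^bsub>M d\<^esub> = \<zero>\<^bsub>K\<^esub>"
  using dsum_mem[of f UNIV "\<lambda>d. dual K (M d)" d] lin_maps_zero[OF M ring_module_is_module[OF K], of "f d" d]
  by (simp add: gr_dual_def dual_simps)

text \<open>Frees the sum from the exact support of \<open>z\<close>, which changes under addition.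
  The extra terms vanish because each component is linear.\<close>

lemma gr_dual_incl_eq:
  assumes f: "f \<in> carrier (gr_dual K M)" and z: "z \<in> carrier S"
    and A: "finite A" "\<And>d. z d \<noteq> \<zero>\<^bsub>M d\<^esub> \<Longrightarrow> d \<in> A"
  shows "gr_dual_incl K M f z = (\<Oplus>\<^bsub>K\<^esub>d\<in>A. f d (z d))"
proof -
  have "(\<Oplus>\<^bsub>K\<^esub>d\<in>{d. z d \<noteq> \<zero>\<^bsub>M d\<^esub>}. f d (z d)) = (\<Oplus>\<^bsub>K\<^esub>d\<in>A. f d (z d))"
    using A comp_closed[OF f z] comp_zero[OF f]
    by (intro K.add.finprod_mono_neutral_cong_left) auto
  then show ?thesis using z by (simp add: gr_dual_incl_def)
qed

private lemma supp_finite: "z \<in> carrier S \<Longrightarrow> finite {d. z d \<noteq> \<zero>\<^bsub>M d\<^esub>}"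
  by (simp add: dsum_simps)

lemma gr_dual_incl_inj:
  assumes f: "f \<in> carrier (gr_dual K M)" and x: "x \<in> carrier (M r)"
  shows "gr_dual_incl K M f (dsum_inj UNIV M r x) = f r x"
proof -
  have z: "dsum_inj UNIV M r x \<in> carrier S" by (rule dsum_inj_closed[OF M]) (use x in auto)
  have "f r x \<in> carrier K" using comp_closed[OF f z, of r] by (simp add: dsum_inj_def)
  then have "(\<Oplus>\<^bsub>K\<^esub>d\<in>{r}. f d (dsum_inj UNIV M r x d)) = f r x"
    by (simp add: dsum_inj_def)
  moreover have "gr_dual_incl K M f (dsum_inj UNIV M r x) = (\<Oplus>\<^bsub>K\<^esub>d\<in>{r}. f d (dsum_inj UNIV M r x d))"
    by (rule gr_dual_incl_eq[OF f z]) (auto simp: dsum_inj_def split: if_splits)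
  ultimately show ?thesis by simp
qed

lemma gr_dual_incl_lin:
  assumes f: "f \<in> carrier (gr_dual K M)"
  shows "gr_dual_incl K M f \<in> lin_maps K S (ring_module K)"
  unfolding gr_dual_incl_def
proof (rule lin_maps_restrictI[OF S])
  fix z assume z: "z \<in> carrier S"
  note c = comp_closed[OF f z]
  have fl: "f d \<in> lin_maps K (M d) (ring_module K)" for d
    using dsum_mem[of f UNIV "\<lambda>d. dual K (M d)" d] f by (simp add: gr_dual_def dual_simps)
  have zc: "z d \<in> carrier (M d)" for d using dsum_mem[OF z] by simp
  show "(\<Oplus>\<^bsub>K\<^esub>d\<in>{d. z d \<noteq> \<zero>\<^bsub>M d\<^esub>}. f d (z d)) \<in> carrier (ring_module K)"
    using c by (auto intro!: K.finsum_closed)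
  {
    fix w assume w: "w \<in> carrier S"
    have wc: "w d \<in> carrier (M d)" for d using dsum_mem[OF w] by simp
    let ?A = "{d. z d \<noteq> \<zero>\<^bsub>M d\<^esub>} \<union> {d. w d \<noteq> \<zero>\<^bsub>M d\<^esub>}"
    have A: "finite ?A" using supp_finite z w by simp
    have "d \<in> ?A" if "(z \<oplus>\<^bsub>S\<^esub> w) d \<noteq> \<zero>\<^bsub>M d\<^esub>" for d
    proof -
      interpret Md: module K "M d" by (rule M)
      show ?thesis using that by (auto simp: dsum_simps(3))
    qed
    then have "gr_dual_incl K M f (z \<oplus>\<^bsub>S\<^esub> w) = (\<Oplus>\<^bsub>K\<^esub>d\<in>?A. f d ((z \<oplus>\<^bsub>S\<^esub> w) d))"
      using z w A by (intro gr_dual_incl_eq[OF f]) auto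
    also have "\<dots> = (\<Oplus>\<^bsub>K\<^esub>d\<in>?A. f d (z d) \<oplus>\<^bsub>K\<^esub> f d (w d))"
      using c comp_closed[OF f w] zc wc
      by (intro K.finsum_cong') (auto simp: dsum_simps(3) lin_maps_add[OF fl])
    also have "\<dots> = (\<Oplus>\<^bsub>K\<^esub>d\<in>?A. f d (z d)) \<oplus>\<^bsub>K\<^esub> (\<Oplus>\<^bsub>K\<^esub>d\<in>?A. f d (w d))"
      using c comp_closed[OF f w] by (intro K.finsum_addf) auto
    also have "\<dots> = gr_dual_incl K M f z \<oplus>\<^bsub>K\<^esub> gr_dual_incl K M f w"
      using gr_dual_incl_eq[OF f z A] gr_dual_incl_eq[OF f w A] by simp
    finally show "(\<Oplus>\<^bsub>K\<^esub>d\<in>{d. (z \<oplus>\<^bsub>S\<^esub> w) d \<noteq> \<zero>\<^bsub>M d\<^esub>}. f d ((z \<oplus>\<^bsub>S\<^esub> w) d)) =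
        (\<Oplus>\<^bsub>K\<^esub>d\<in>{d. z d \<noteq> \<zero>\<^bsub>M d\<^esub>}. f d (z d)) \<oplus>\<^bsub>ring_module K\<^esub> (\<Oplus>\<^bsub>K\<^esub>d\<in>{d. w d \<noteq> \<zero>\<^bsub>M d\<^esub>}. f d (w d))"
      using z w by (simp add: gr_dual_incl_def)
  }
  {
    fix a assume a: "a \<in> carrier K"
    let ?A = "{d. z d \<noteq> \<zero>\<^bsub>M d\<^esub>}"
    have A: "finite ?A" by (rule supp_finite[OF z])
    have "gr_dual_incl K M f (a \<odot>\<^bsub>S\<^esub> z) = (\<Oplus>\<^bsub>K\<^esub>d\<in>?A. f d ((a \<odot>\<^bsub>S\<^esub> z) d))"
      using module.smult_r_null[OF M a]
      by (intro gr_dual_incl_eq[OF f S.smult_closed[OF a z] A]) (auto simp: dsum_simps(4))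
    also have "\<dots> = (\<Oplus>\<^bsub>K\<^esub>d\<in>?A. a \<otimes>\<^bsub>K\<^esub> f d (z d))"
      using c zc a by (intro K.finsum_cong') (auto simp: dsum_simps(4) lin_maps_smult[OF fl])
    also have "\<dots> = a \<otimes>\<^bsub>K\<^esub> gr_dual_incl K M f z"
      using c a A z by (simp add: gr_dual_incl_def K.finsum_rdistr Pi_def)
    finally show "(\<Oplus>\<^bsub>K\<^esub>d\<in>{d. (a \<odot>\<^bsub>S\<^esub> z) d \<noteq> \<zero>\<^bsub>M d\<^esub>}. f d ((a \<odot>\<^bsub>S\<^esub> z) d)) =
        a \<odot>\<^bsub>ring_module K\<^esub> (\<Oplus>\<^bsub>K\<^esub>d\<in>{d. z d \<noteq> \<zero>\<^bsub>M d\<^esub>}. f d (z d))"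
      using z a by (simp add: gr_dual_incl_def)
  }
qed

text \<open>The other half of bilinearity: the vector is fixed, so the range of summation stays put.
  It makes products of forms multilinear in the forms.\<close>

lemma gr_dual_incl_eval_lin:
  assumes z: "z \<in> carrier S"
  shows "(\<lambda>f\<in>carrier (gr_dual K M). gr_dual_incl K M f z) \<in> lin_maps K (gr_dual K M) (ring_module K)"
proof (rule lin_maps_restrictI[OF D.module_axioms])
  let ?A = "{d. z d \<noteq> \<zero>\<^bsub>M d\<^esub>}"
  note A = supp_finite[OF z]
  have zc: "z d \<in> carrier (M d)" for d using dsum_mem[OF z] by simp
  have incl: "gr_dual_incl K M f z = (\<Oplus>\<^bsub>K\<^esub>d\<in>?A. f d (z d))" for f
    using z by (simp add: gr_dual_incl_def)
  fix f assume f: "f \<in> carrier (gr_dual K M)"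
  note c = comp_closed[OF f z]
  show "gr_dual_incl K M f z \<in> carrier (ring_module K)"
    using c by (auto simp: incl intro!: K.finsum_closed)
  show "gr_dual_incl K M (f \<oplus>\<^bsub>gr_dual K M\<^esub> g) z = gr_dual_incl K M f z \<oplus>\<^bsub>ring_module K\<^esub> gr_dual_incl K M g z"
    if g: "g \<in> carrier (gr_dual K M)" for g
  proof -
    have "(\<Oplus>\<^bsub>K\<^esub>d\<in>?A. (f \<oplus>\<^bsub>gr_dual K M\<^esub> g) d (z d)) = (\<Oplus>\<^bsub>K\<^esub>d\<in>?A. f d (z d) \<oplus>\<^bsub>K\<^esub> g d (z d))"
      using c comp_closed[OF g z] zc
      by (intro K.finsum_cong') (auto simp: gr_dual_def dsum_simps(3) dual_simps(3))
    then show ?thesis using c comp_closed[OF g z] by (simp add: incl K.finsum_addf Pi_def)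
  qed
  show "gr_dual_incl K M (a \<odot>\<^bsub>gr_dual K M\<^esub> f) z = a \<odot>\<^bsub>ring_module K\<^esub> gr_dual_incl K M f z"
    if a: "a \<in> carrier K" for a
  proof -
    have "(\<Oplus>\<^bsub>K\<^esub>d\<in>?A. (a \<odot>\<^bsub>gr_dual K M\<^esub> f) d (z d)) = (\<Oplus>\<^bsub>K\<^esub>d\<in>?A. a \<otimes>\<^bsub>K\<^esub> f d (z d))"
      using c a zc by (intro K.finsum_cong') (auto simp: gr_dual_def dsum_simps(4) dual_simps(4))
    then show ?thesis using c a A by (simp add: incl K.finsum_rdistr Pi_def)
  qed
qed

end

section \<open>Tensor powers of linear maps and products of linear forms\<close>

lemma words_map:
  assumes "u \<in> lin_maps K M N" "xs \<in> words d M"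
  shows "map u xs \<in> words d N"
  using assms lin_maps_closed[OF assms(1)] by (auto simp: words_def)

lemma multilinear_map:
  assumes u: "u \<in> lin_maps K M N" and h: "multilinear K d N P h"
  shows "multilinear K d M P (\<lambda>xs. h (map u xs))"
  using words_map[OF u] lin_maps_closed[OF u]
  by (intro multilinearI)
    (simp_all add: multilinear_closed[OF h] map_update lin_maps_add[OF u] lin_maps_smult[OF u]
      multilinear_add[OF h] multilinear_smult[OF h])

lemma tensor_map_tensor:
  assumes M: "module K M" and N: "module K N" and u: "u \<in> lin_maps K M N" and xs: "xs \<in> words d M"
  shows "tensor_map K d M N u (tensor K d M xs) = tensor K d N (map u xs)"
proof -
  note T = tensor_power_is_module[OF M] tensor_power_is_module[OF N]
  obtain g where g: "g \<in> lin_maps K (tensor_power K d M) (tensor_power K d N)"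
    "\<forall>xs\<in>words d M. g (tensor K d M xs) = tensor K d N (map u xs)"
    using tensor_lift[OF M T(2) multilinear_map[OF u tensor_multilinear[OF N]]] by (rule bexE)
  have "tensor_map K d M N u = g"
    unfolding tensor_map_def by (rule lin_ext_eq[OF T tensor_generates[OF M] g(1)]) (rule bspec[OF g(2)])
  then show ?thesis using g xs by simp
qed

text \<open>Nested lifts as for \<open>iota_deg\<close>: \<open>j\<close> makes the product
  multilinear in the vectors, \<open>j'\<close> makes it multilinear in the forms. The second
  property is again tested on decomposable tensors.\<close>

lemma tensor_forms_tensor:
  assumes M: "module K M" and G: "module K G"
    and j: "\<And>f. f \<in> carrier G \<Longrightarrow> j f \<in> lin_maps K M (ring_module K)"
    and j': "\<And>z. z \<in> carrier M \<Longrightarrow> (\<lambda>f\<in>carrier G. j f z) \<in> lin_maps K G (ring_module K)"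
    and fs: "fs \<in> words k G" and zs: "zs \<in> words k M"
  shows "tensor_forms K k M G j (tensor K k G fs) (tensor K k M zs) =
    (\<Otimes>\<^bsub>K\<^esub>i\<in>{..<k}. j (fs ! i) (zs ! i))"
proof -
  interpret M: module K M by (rule M)
  note T = tensor_power_is_module[OF M, of k] tensor_power_is_module[OF G, of k]
    and R = ring_module_is_module[OF M.R.is_cring]
  define F where "F fs = lin_ext K (tensor_power K k M) (ring_module K) (words k M) (tensor K k M)
    (\<lambda>zs. \<Otimes>\<^bsub>K\<^esub>i\<in>{..<k}. j (fs ! i) (zs ! i))" for fs
  have F: "F fs \<in> carrier (dual K (tensor_power K k M)) \<and>
      (\<forall>zs\<in>words k M. F fs (tensor K k M zs) = (\<Otimes>\<^bsub>K\<^esub>i\<in>{..<k}. j (fs ! i) (zs ! i)))"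
    if fs: "fs \<in> words k G" for fs
  proof -
    have "multilinear K k M (ring_module K) (\<lambda>zs. \<Otimes>\<^bsub>K\<^esub>i\<in>{..<k}. j (fs ! i) (zs ! i))"
      by (intro prod_multilinear M j words_nth[OF fs])
    then obtain g where g: "g \<in> lin_maps K (tensor_power K k M) (ring_module K)"
      "\<And>zs. zs \<in> words k M \<Longrightarrow> g (tensor K k M zs) = (\<Otimes>\<^bsub>K\<^esub>i\<in>{..<k}. j (fs ! i) (zs ! i))"
      using tensor_lift[OF M R] by blast
    have "F fs = g" unfolding F_def by (rule lin_ext_eq[OF T(1) R tensor_generates[OF M] g])
    then show ?thesis using g by (simp add: dual_simps)
  qed
  have jc: "j (fs ! i) (zs ! i) \<in> carrier K" if "fs \<in> words k G" "zs \<in> words k M" "i < k" for fs zs i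
    using lin_maps_closed[OF j[OF words_nth[OF that(1,3)]] words_nth[OF that(2,3)]] by simp
  have "multilinear K k G (dual K (tensor_power K k M)) F"
  proof (rule multilinear_into_dual[OF G T(1) tensor_generates[OF M]])
    fix zs assume zs: "zs \<in> words k M"
    have "multilinear K k G (ring_module K)
        (\<lambda>fs. \<Otimes>\<^bsub>K\<^esub>i\<in>{..<k}. (\<lambda>f\<in>carrier G. j f (zs ! i)) (fs ! i))"
      by (intro prod_multilinear G j' words_nth[OF zs])
    then show "multilinear K k G (ring_module K) (\<lambda>fs. F fs (tensor K k M zs))"
    proof (rule multilinear_cong[OF G])
      fix fs assume fs: "fs \<in> words k G"
      show "(\<Otimes>\<^bsub>K\<^esub>i\<in>{..<k}. (\<lambda>f\<in>carrier G. j f (zs ! i)) (fs ! i)) = F fs (tensor K k M zs)"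
        using F[OF fs] zs words_nth[OF fs] jc[OF fs zs] by (auto intro!: M.R.finprod_cong')
    qed
  qed (use F in blast)
  then obtain g where g: "g \<in> lin_maps K (tensor_power K k G) (dual K (tensor_power K k M))"
    "\<And>fs. fs \<in> words k G \<Longrightarrow> g (tensor K k G fs) = F fs"
    using tensor_lift[OF G dual_is_module[OF T(1)]] by blast
  have "tensor_forms K k M G j = g"
    unfolding tensor_forms_def F_def[symmetric]
    by (rule lin_ext_eq[OF T(2) dual_is_module[OF T(1)] tensor_generates[OF G] g])
  then show ?thesis using g(2)[OF fs] F[OF fs] zs by simp
qed

lemma transpose_map_lin:
  assumes M: "module K M" and N: "module K N" and u: "u \<in> lin_maps K M N"
  shows "transpose_map K M N u \<in> lin_maps K (dual K N) (dual K M)"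
  unfolding transpose_map_def
proof (rule lin_maps_restrictI[OF dual_is_module[OF N]])
  note uc = lin_maps_closed[OF u]
  show "(\<lambda>x\<in>carrier M. f (u x)) \<in> carrier (dual K M)" if "f \<in> carrier (dual K N)" for f
    using lin_maps_compose[OF M u, of f "ring_module K"] that by (simp add: dual_simps(1))
qed (use lin_maps_closed[OF u] in \<open>auto simp: dual_simps(3,4) intro!: restrict_ext\<close>)

section \<open>Functoriality of the powers and naturality of the comparison map\<close>

context weight
begin

lemma chi_power_map:
  assumes M: "module K M" and N: "module K N" and u: "u \<in> lin_maps K M N"
  shows chi_power_map_lin:
      "chi_power_map K W chi d M N u \<in> lin_maps K (chi_power K W chi d M) (chi_power K W chi d N)"
    and chi_power_map_product: "\<And>xs. xs \<in> words d M \<Longrightarrow>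
      chi_power_map K W chi d M N u (chi_product K W chi d M xs) = chi_product K W chi d N (map u xs)"
proof -
  note P = chi_power_is_module[OF M, of d] chi_power_is_module[OF N, of d]
  have ml: "multilinear K d M (chi_power K W chi d N) (\<lambda>xs. chi_product K W chi d N (map u xs))"
    by (rule multilinear_map[OF u chi_product_multilinear[OF N]])
  have "skew d M (chi_power K W chi d N) (\<lambda>xs. chi_product K W chi d N (map u xs))"
    unfolding skew_def
  proof (intro impI ballI)
    fix p xs assume d: "d \<noteq> 0" and p: "p \<in> W d" and xs: "xs \<in> words d M"
    have "permute_word p (map u xs) = map u (permute_word p xs)"
      using permute_word_map[of p xs u] perms_permutes[of p d] d p words_length[OF xs]
      by (simp add: perms_def)
    then show "chi_product K W chi d N (map u (permute_word p xs)) =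
        inv (chi d p) \<odot>\<^bsub>chi_power K W chi d N\<^esub> chi_product K W chi d N (map u xs)"
      using chi_product_skew[OF N, of d] d p words_map[OF u xs] unfolding skew_def by metis
  qed
  then obtain g where g: "g \<in> lin_maps K (chi_power K W chi d M) (chi_power K W chi d N)"
    "\<And>xs. xs \<in> words d M \<Longrightarrow> g (chi_product K W chi d M xs) = chi_product K W chi d N (map u xs)"
    using chi_power_lift[OF M P(2) ml] by blast
  have "chi_power_map K W chi d M N u = g"
    unfolding chi_power_map_def by (rule lin_ext_eq[OF P chi_product_generates[OF M] g])
  then show "chi_power_map K W chi d M N u \<in> lin_maps K (chi_power K W chi d M) (chi_power K W chi d N)"
    "\<And>xs. xs \<in> words d M \<Longrightarrow>
      chi_power_map K W chi d M N u (chi_product K W chi d M xs) = chi_product K W chi d N (map u xs)"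
    using g by auto
qed

text \<open>Naturality at its root: factor by factor, a transposed form at a letter is the form at
  the image of that letter, and applying \<open>u\<close> letterwise commutes with permuting
  positions.\<close>

lemma pairing_transpose:
  assumes M: "module K M" and N: "module K N" and u: "u \<in> lin_maps K M N"
    and xs: "xs \<in> words d M" and ys: "ys \<in> words d (dual K N)"
  shows "pairing d xs (map (transpose_map K M N u) ys) = pairing d (map u xs) ys"
proof -
  have "eval_prod K d (permute_word p xs) (map (transpose_map K M N u) ys) =
      eval_prod K d (permute_word p (map u xs)) ys" if p: "p \<in> perms d" for p
  proof -
    note pp = perms_permutes[OF p]
    note px = permute_word_words[OF pp xs]
    have "permute_word p (map u xs) = map u (permute_word p xs)"
      using permute_word_map[of p xs u] pp words_length[OF xs] by simp
    moreover have "(ys ! i) (u (permute_word p xs ! i)) \<in> carrier K" if "i < d" for i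
      by (intro dual_closed[OF words_nth[OF ys that]] lin_maps_closed[OF u] words_nth[OF px that])
    ultimately show ?thesis
      using words_nth[OF ys] words_nth[OF px] words_length[OF px] words_length[OF ys]
      by (auto simp: eval_prod_def transpose_map_def intro!: finprod_cong')
  qed
  moreover have "eval_prod K d (permute_word p (map u xs)) ys \<in> carrier K" if "p \<in> perms d" for p
    by (rule eval_prod_closed[OF is_cring permute_word_words[OF perms_permutes[OF that] words_map[OF u xs]] ys])
  ultimately show ?thesis
    using wt_closed by (auto simp: pairing_def intro!: finsum_cong')
qed

text \<open>Both sides are linear in \<open>y\<close> with values in linear forms, so they are
  compared first on decomposable forms and then on decomposable vectors, where
  \<open>pairing_transpose\<close> decides.\<close>

lemma iota_deg_natural:
  assumes M: "module K M" and N: "module K N" and u: "u \<in> lin_maps K M N"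
    and y: "y \<in> carrier (chi_power K W chi d (dual K N))"
  shows "iota_deg K W chi d M (chi_power_map K W chi d (dual K N) (dual K M) (transpose_map K M N u) y) =
    transpose_map K (chi_power K W chi d M) (chi_power K W chi d N) (chi_power_map K W chi d M N u)
      (iota_deg K W chi d N y)"
proof -
  note M' = dual_is_module[OF M] and N' = dual_is_module[OF N]
  note P = chi_power_is_module[OF M, of d] chi_power_is_module[OF N, of d]
    and P' = chi_power_is_module[OF N', of d]
  note tu = transpose_map_lin[OF M N u]
  note cu = chi_power_map_lin[OF M N u, of d]
  note tcu = transpose_map_lin[OF P cu]
  let ?t = "transpose_map K M N u"
  let ?f = "\<lambda>y\<in>carrier (chi_power K W chi d (dual K N)).
    iota_deg K W chi d M (chi_power_map K W chi d (dual K N) (dual K M) ?t y)"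
  let ?g = "\<lambda>y\<in>carrier (chi_power K W chi d (dual K N)).
    transpose_map K (chi_power K W chi d M) (chi_power K W chi d N) (chi_power_map K W chi d M N u)
      (iota_deg K W chi d N y)"
  have "?f = ?g"
  proof (rule generates_lin_eq[OF P' dual_is_module[OF P(1)] chi_product_generates[OF N']])
    show f: "?f \<in> lin_maps K (chi_power K W chi d (dual K N)) (dual K (chi_power K W chi d M))"
      by (rule lin_maps_compose[OF P' chi_power_map_lin[OF N' M' tu] iota_deg_lin[OF M]])
    show g: "?g \<in> lin_maps K (chi_power K W chi d (dual K N)) (dual K (chi_power K W chi d M))"
      by (rule lin_maps_compose[OF P' iota_deg_lin[OF N] tcu])
    fix z assume "z \<in> chi_product K W chi d (dual K N) ` words d (dual K N)"
    then obtain ys where ys: "ys \<in> words d (dual K N)" "z = chi_product K W chi d (dual K N) ys" by blast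
    note zc = chi_product_closed[OF N' ys(1)]
    show "?f z = ?g z"
    proof (rule generates_lin_eq[OF P(1) ring_module_is_module[OF is_cring] chi_product_generates[OF M]])
      show "?f z \<in> lin_maps K (chi_power K W chi d M) (ring_module K)"
        "?g z \<in> lin_maps K (chi_power K W chi d M) (ring_module K)"
        using lin_maps_closed[OF f zc] lin_maps_closed[OF g zc] ys(2) by (simp_all only: dual_simps(1))
      fix v assume "v \<in> chi_product K W chi d M ` words d M"
      then obtain xs where xs: "xs \<in> words d M" "v = chi_product K W chi d M xs" by blast
      have "?f z v = pairing d xs (map ?t ys)"
        using zc xs ys iota_deg_apply[OF M xs(1) words_map[OF tu ys(1)]]
        by (simp add: chi_power_map_product[OF N' M' tu])
      moreover have "?g z v = pairing d (map u xs) ys"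
        using zc xs ys iota_deg_apply[OF N words_map[OF u xs(1)] ys(1)]
          lin_maps_closed[OF iota_deg_lin[OF N] zc] chi_product_closed[OF M xs(1)]
        by (simp add: transpose_map_def chi_power_map_product[OF M N u])
      ultimately show "?f z v = ?g z v" using pairing_transpose[OF M N u xs(1) ys(1)] by simp
    qed
  qed
  from fun_cong[OF this, of y] show ?thesis using y by simp
qed

lemma iota_lin:
  assumes E: "module K E"
  shows "iota K W chi E \<in> lin_maps K (semi_sym K W chi (dual K E)) (semi_sym_gr_dual K W chi E)"
  unfolding iota_def semi_sym_def semi_sym_gr_dual_def gr_dual_def
  by (rule dsum_map_lin[OF is_cring]) (simp_all add: chi_power_is_module dual_is_module E iota_deg_lin)

lemma iota_iso:
  assumes Q: "Q_ring K" and E: "module K E" and fb: "has_finite_basis K E"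
  shows "iota K W chi E \<in> lin_isos K (semi_sym K W chi (dual K E)) (semi_sym_gr_dual K W chi E)"
  unfolding iota_def semi_sym_def semi_sym_gr_dual_def gr_dual_def
  by (rule dsum_map_iso[OF is_cring])
    (simp_all add: chi_power_is_module dual_is_module E iota_deg_lin iota_deg_bij[OF Q E fb])

lemma semi_sym_is_module: "module K M \<Longrightarrow> module K (semi_sym K W chi M)"
  unfolding semi_sym_def by (intro dsum_is_module is_cring chi_power_is_module)

lemma decomp_closed:
  assumes "module K M" "xs \<in> words d M"
  shows "decomp K W chi M xs \<in> carrier (semi_sym K W chi M)"
  unfolding decomp_def semi_sym_def words_length[OF assms(2)]
  by (rule dsum_inj_closed[where K = K])
    (simp_all add: chi_power_is_module assms chi_product_closed)

text \<open>The comparison map acts degree by degree, and outside degree \<open>s\<close> it is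
  applied to 0.\<close>

lemma iota_decomp:
  assumes E: "module K E" and ys: "ys \<in> words s (dual K E)"
  shows "iota K W chi E (decomp K W chi (dual K E) ys) r =
    (if r = s then iota_deg K W chi s E (chi_product K W chi s (dual K E) ys)
     else \<zero>\<^bsub>dual K (chi_power K W chi r E)\<^esub>)"
proof -
  note E' = dual_is_module[OF E]
  have "iota_deg K W chi r E \<zero>\<^bsub>chi_power K W chi r (dual K E)\<^esub> = \<zero>\<^bsub>dual K (chi_power K W chi r E)\<^esub>"
    by (intro lin_maps_zero[OF _ _ iota_deg_lin[OF E]] chi_power_is_module dual_is_module E)
  then show ?thesis
    using decomp_closed[OF E' ys] words_length[OF ys]
    by (simp add: iota_def dsum_map_def semi_sym_def decomp_def dsum_inj_def)
qed

lemma iota_naturality: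
  assumes E: "module K E" and F: "module K F" and u: "u \<in> lin_maps K E F"
    and z: "z \<in> carrier (semi_sym K W chi (dual K F))"
  shows "iota K W chi E (semi_sym_map K W chi (dual K F) (dual K E) (transpose_map K E F u) z) =
    semi_sym_gr_dual_map K W chi E F u (iota K W chi F z)"
proof -
  note E' = dual_is_module[OF E] and F' = dual_is_module[OF F]
  note tu = transpose_map_lin[OF E F u]
  have zc: "z \<in> carrier (dsum UNIV (\<lambda>d. chi_power K W chi d (dual K F)))"
    using z by (simp add: semi_sym_def)
  have 1: "semi_sym_map K W chi (dual K F) (dual K E) (transpose_map K E F u) z
      \<in> carrier (dsum UNIV (\<lambda>d. chi_power K W chi d (dual K E)))"
    unfolding semi_sym_map_def
    by (rule lin_maps_closed[OF dsum_map_lin[OF is_cring chi_power_is_module[OF F']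
          chi_power_is_module[OF E'] chi_power_map_lin[OF F' E' tu]] zc])
  have 2: "iota K W chi F z \<in> carrier (dsum UNIV (\<lambda>d. dual K (chi_power K W chi d F)))"
    unfolding iota_def
    by (rule lin_maps_closed[OF dsum_map_lin[OF is_cring chi_power_is_module[OF F']
          dual_is_module[OF chi_power_is_module[OF F]] iota_deg_lin[OF F]] zc])
  show ?thesis
  proof
    fix d
    have "z d \<in> carrier (chi_power K W chi d (dual K F))" using dsum_mem[OF zc] by simp
    from iota_deg_natural[OF E F u this]
    show "iota K W chi E (semi_sym_map K W chi (dual K F) (dual K E) (transpose_map K E F u) z) d =
        semi_sym_gr_dual_map K W chi E F u (iota K W chi F z) d"
      using 1 2 zc by (simp add: iota_def semi_sym_map_def semi_sym_gr_dual_map_def dsum_map_def)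
  qed
qed

section \<open>Values of the canonical forms on decomposable elements\<close>

lemma canon_form_decomp:
  assumes E: "module K E" and xs: "xs \<in> words r E" and ys: "ys \<in> words s (dual K E)"
  shows "canon_form (decomp K W chi E xs) (form_ident K W chi E (decomp K W chi (dual K E) ys)) =
    (if r \<noteq> s then \<zero> else if r \<ge> 1 then d_chi K W chi r (gram xs ys) else \<one>)"
proof -
  let ?f = "iota K W chi E (decomp K W chi (dual K E) ys)"
  have "?f \<in> carrier (gr_dual K (\<lambda>d. chi_power K W chi d E))"
    using lin_maps_closed[OF iota_lin[OF E] decomp_closed[OF dual_is_module[OF E] ys]]
    by (simp add: semi_sym_gr_dual_def)
  \<comment> \<open>The vector is homogeneous of degree \<open>r\<close>, so of all components of
    the form only the one in degree \<open>r\<close> is evaluated.\<close>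
  then have "canon_form (decomp K W chi E xs) (form_ident K W chi E (decomp K W chi (dual K E) ys)) =
      ?f r (chi_product K W chi r E xs)"
    unfolding canon_form_def form_ident_def semi_sym_incl_def decomp_def[of _ _ _ E] words_length[OF xs]
    by (intro gr_dual_incl_inj[where M = "\<lambda>d. chi_power K W chi d E"] is_cring
        chi_power_is_module[OF E] chi_product_closed[OF E xs])
  also have "\<dots> = (if r \<noteq> s then \<zero> else pairing r xs ys)"
    using chi_product_closed[OF E xs] iota_deg_apply[OF E xs, of ys] ys
    by (auto simp: iota_decomp[OF E ys] dual_simps(2))
  also have "\<dots> = (if r \<noteq> s then \<zero> else if r \<ge> 1 then d_chi K W chi r (gram xs ys) else \<one>)"
    using pairing_d_chi[OF xs, of ys] ys by auto
  finally show ?thesis .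
qed

lemma canon_form_decomp_closed:
  assumes E: "module K E" and xs: "xs \<in> words r E" and ys: "ys \<in> words s (dual K E)"
  shows "canon_form (decomp K W chi E xs) (form_ident K W chi E (decomp K W chi (dual K E) ys)) \<in> carrier K"
proof (cases "r = s")
  case True
  then have ys': "ys \<in> words r (dual K E)" using ys by simp
  show ?thesis
    unfolding canon_form_decomp[OF E xs ys'] using pairing_closed[OF E xs ys'] pairing_d_chi[OF xs ys']
    by (simp split: if_splits)
qed (simp add: canon_form_decomp[OF E xs ys])

text \<open>The product formula is proved regardless of degrees: the comparison map is first applied
  in every tensor factor, and the resulting linear forms are then multiplied. Unequal degrees merely
  make some factor vanish.\<close>

lemma canon_form_tensor:
  assumes E: "module K E" and len: "length xss = k" "length yss = k"
    and xss: "\<forall>xs \<in> set xss. set xs \<subseteq> carrier E" and yss: "\<forall>ys \<in> set yss. set ys \<subseteq> carrier (dual K E)"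
  shows "canon_form (tensor K k (semi_sym K W chi E) (map (decomp K W chi E) xss))
      (tensor_form_ident K W chi k E
        (tensor K k (semi_sym K W chi (dual K E)) (map (decomp K W chi (dual K E)) yss))) =
    (\<Otimes>i\<in>{..<k}. canon_form (decomp K W chi E (xss ! i))
      (form_ident K W chi E (decomp K W chi (dual K E) (yss ! i))))"
proof -
  note E' = dual_is_module[OF E]
  have G: "module K (semi_sym_gr_dual K W chi E)"
    unfolding semi_sym_gr_dual_def by (intro gr_dual_is_module is_cring chi_power_is_module E)
  note iota = iota_lin[OF E]
  have ds: "map (decomp K W chi E) xss \<in> words k (semi_sym K W chi E)"
    using len xss decomp_closed[OF E] by (auto simp: words_def)
  have ds': "map (decomp K W chi (dual K E)) yss \<in> words k (semi_sym K W chi (dual K E))"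
    using len yss decomp_closed[OF E'] by (auto simp: words_def)
  have incl: "semi_sym_incl K W chi E f \<in> lin_maps K (semi_sym K W chi E) (ring_module K)"
    if "f \<in> carrier (semi_sym_gr_dual K W chi E)" for f
    unfolding semi_sym_incl_def semi_sym_def
    by (rule gr_dual_incl_lin[OF is_cring chi_power_is_module[OF E]])
      (use that in \<open>simp add: semi_sym_gr_dual_def\<close>)
  have incl': "(\<lambda>f\<in>carrier (semi_sym_gr_dual K W chi E). semi_sym_incl K W chi E f z)
      \<in> lin_maps K (semi_sym_gr_dual K W chi E) (ring_module K)"
    if "z \<in> carrier (semi_sym K W chi E)" for z
    unfolding semi_sym_incl_def semi_sym_gr_dual_def
    by (rule gr_dual_incl_eval_lin[OF is_cring chi_power_is_module[OF E]])
      (use that in \<open>simp add: semi_sym_def\<close>)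
  have "(\<Otimes>i\<in>{..<k}. semi_sym_incl K W chi E (map (iota K W chi E) (map (decomp K W chi (dual K E)) yss) ! i)
        (map (decomp K W chi E) xss ! i)) =
      (\<Otimes>i\<in>{..<k}. canon_form (decomp K W chi E (xss ! i))
        (form_ident K W chi E (decomp K W chi (dual K E) (yss ! i))))"
    using len lin_maps_closed[OF incl[OF words_nth[OF words_map[OF iota ds']]] words_nth[OF ds]]
    by (intro finprod_cong') (auto simp: canon_form_def form_ident_def)
  then show ?thesis
    unfolding canon_form_def tensor_form_ident_def
    by (simp only: tensor_map_tensor[OF semi_sym_is_module[OF E'] G iota ds']
      tensor_forms_tensor[OF semi_sym_is_module[OF E] G incl incl' words_map[OF iota ds'] ds])
qed

end

theorem theorem16:
  fixes K :: "'k ring"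
    and W :: "nat \<Rightarrow> (nat \<Rightarrow> nat) set"
    and chi :: "nat \<Rightarrow> (nat \<Rightarrow> nat) \<Rightarrow> 'k"
    and E :: "('k, 'e) module"
  assumes "domain K" and "Q_ring K"
    and "omega_invariant K W chi"
    and "module K E" and "has_finite_basis K E"
  shows
    "(iota K W chi E \<in>
        lin_isos K (semi_sym K W chi (dual K E)) (semi_sym_gr_dual K W chi E) \<and>
      (\<forall>(F :: ('k, 'f) module) u.
         module K F \<and> has_finite_basis K F \<and> u \<in> lin_maps K E F \<longrightarrow>
         (\<forall>z \<in> carrier (semi_sym K W chi (dual K F)).
            iota K W chi E
              (semi_sym_map K W chi (dual K F) (dual K E) (transpose_map K E F u) z) =
            semi_sym_gr_dual_map K W chi E F u (iota K W chi F z))))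
     \<and>
     (\<forall>r s. \<forall>xs \<in> words r E. \<forall>ys \<in> words s (dual K E).
        canon_form (decomp K W chi E xs)
          (form_ident K W chi E (decomp K W chi (dual K E) ys)) =
        (if r \<noteq> s then \<zero>\<^bsub>K\<^esub>
         else if r \<ge> 1 then d_chi K W chi r (gram xs ys)
         else \<one>\<^bsub>K\<^esub>))
     \<and>
     (\<forall>k \<ge> 2. \<forall>xss yss.
        length xss = k \<and> length yss = k \<and>
        (\<forall>xs \<in> set xss. set xs \<subseteq> carrier E) \<and>
        (\<forall>ys \<in> set yss. set ys \<subseteq> carrier (dual K E)) \<longrightarrow>
        canon_form
          (tensor K k (semi_sym K W chi E) (map (decomp K W chi E) xss))
          (tensor_form_ident K W chi k E
             (tensor K k (semi_sym K W chi (dual K E)) (map (decomp K W chi (dual K E)) yss))) =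
        (if map length xss \<noteq> map length yss then \<zero>\<^bsub>K\<^esub>
         else \<Otimes>\<^bsub>K\<^esub>i\<in>{..<k}. canon_form (decomp K W chi E (xss ! i))
                (form_ident K W chi E (decomp K W chi (dual K E) (yss ! i)))))"
proof -
  interpret domain K by fact
  interpret weight K W chi by unfold_locales fact
  note E = \<open>module K E\<close>
  note form = canon_form_decomp[OF E]
  show ?thesis
  proof (intro conjI allI impI ballI)
    show "iota K W chi E \<in> lin_isos K (semi_sym K W chi (dual K E)) (semi_sym_gr_dual K W chi E)"
      by (rule iota_iso) fact+
    show "iota K W chi E (semi_sym_map K W chi (dual K F) (dual K E) (transpose_map K E F u) z) =
        semi_sym_gr_dual_map K W chi E F u (iota K W chi F z)"
      if "module K F \<and> has_finite_basis K F \<and> u \<in> lin_maps K E F"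
        and "z \<in> carrier (semi_sym K W chi (dual K F))" for F :: "('k, 'f) module" and u z
      using that by (intro iota_naturality E) auto
    show "canon_form (decomp K W chi E xs) (form_ident K W chi E (decomp K W chi (dual K E) ys)) =
        (if r \<noteq> s then \<zero>\<^bsub>K\<^esub>
         else if r \<ge> 1 then d_chi K W chi r (gram xs ys)
         else \<one>\<^bsub>K\<^esub>)"
      if "xs \<in> words r E" "ys \<in> words s (dual K E)" for r s xs ys
      by (rule form[OF that])
    fix k xss yss
    assume *: "length xss = k \<and> length yss = k \<and>
        (\<forall>xs \<in> set xss. set xs \<subseteq> carrier E) \<and> (\<forall>ys \<in> set yss. set ys \<subseteq> carrier (dual K E))"
    let ?c = "\<lambda>i. canon_form (decomp K W chi E (xss ! i))
      (form_ident K W chi E (decomp K W chi (dual K E) (yss ! i)))"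
    have w: "xss ! i \<in> words (length (xss ! i)) E" "yss ! i \<in> words (length (yss ! i)) (dual K E)"
      if "i < k" for i
      using * that by (auto simp: words_def)
    \<comment> \<open>Different degree sequences of the same length \<open>k\<close> differ at some
      position, and the factor at that position is 0. This makes the general product formula agree
      with the case distinction.\<close>
    have "(\<Otimes>\<^bsub>K\<^esub>i\<in>{..<k}. ?c i) = \<zero>\<^bsub>K\<^esub>" if "map length xss \<noteq> map length yss"
    proof -
      have "\<exists>i<k. length (xss ! i) \<noteq> length (yss ! i)"
      proof (rule ccontr)
        assume "\<not> (\<exists>i<k. length (xss ! i) \<noteq> length (yss ! i))"
        then have "map length xss = map length yss" using * by (intro nth_equalityI) simp_all
        with that show False by simp
      qed
      then obtain i where i: "i < k" "length (xss ! i) \<noteq> length (yss ! i)" by blast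
      show ?thesis
      proof (rule finprod_zero_factor)
        show "?c i = \<zero>\<^bsub>K\<^esub>" using form[OF w[OF i(1)]] i(2) by simp
        show "?c \<in> {..<k} \<rightarrow> carrier K"
        proof
          fix i assume "i \<in> {..<k}"
          then have "i < k" by simp
          note w = w[OF this]
          show "?c i \<in> carrier K"
            by (rule canon_form_decomp_closed[OF E w])
        qed
      qed (use i in auto)
    qed
    then show "canon_form (tensor K k (semi_sym K W chi E) (map (decomp K W chi E) xss))
        (tensor_form_ident K W chi k E
          (tensor K k (semi_sym K W chi (dual K E)) (map (decomp K W chi (dual K E)) yss))) =
      (if map length xss \<noteq> map length yss then \<zero>\<^bsub>K\<^esub> else \<Otimes>\<^bsub>K\<^esub>i\<in>{..<k}. ?c i)"
      using canon_form_tensor[OF E, of xss k yss] * by simp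
  qed
qed

end
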